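(* Let $\beta>0$, $L>0$, $n,M\ge1$, and suppose that the forward operator and input assumption, the noise assumption ((B1) with constant $\sigma$, and (B2)) and the fourth-moment condition with constant $\kappa$ described in the context hold. Let the data be generated with true kernel $\phi_*=\sum_{k\ge1}\theta_k^*\psi_k\in H^\beta_\rho(L)$, and let $\boldsymbol\theta_n^*=(\theta_1^*,\dots,\theta_n^* )^\top$. Then, with $\overline A_{n,M}$, $\overline b_{n,M}$ and the event $\mathcal A$ defined in the context, $$\mathbb E\big[\|\overline A_{n,M}^{-1}\overline b_{n,M}-\boldsymbol\theta_n^*\|^2\mathbf 1_{\mathcal A}\big]\le\frac{16\kappa L^2}{M}\lambda_n^{\beta-1}\sum_{k=1}^n\lambda_k+\begin{cases}\dfrac{4\sigma^2}{M}\dfrac{n}{\lambda_n},&\text{if the spectral decay is polynomial},\\[2mm]\dfrac{4\sigma^2}{M}\displaystyle\sum_{k=1}^n\lambda_k^{-1},&\text{if the spectral decay is exponential}.\end{cases}$$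
   Context: Setting. $\mathcal S\subset\mathbb R^d$ is compact, $\rho$ is a Borel measure on $\mathcal S$, $L^2_\rho=L^2(\mathcal S,\mathcal B(\mathcal S),\rho)$; $\mathbb X$ is a Banach space, $\mathbb Y$ a (finite- or infinite-dimensional) separable real Hilbert space with inner product $\langle\cdot,\cdot\rangle_{\mathbb Y}$. For every $\phi\in L^2_\rho$, $R_\phi:\mathbb X\to\mathbb Y$ is a measurable, possibly nonlinear, map; $u$ is an $\mathbb X$-valued random variable on a complete probability space $(\Omega,\mathcal F,\mathbb P)$. Forward operator and input assumption. (1) $R_\phi[u]$ is linear in $\phi$ for each $u\in\mathbb X$. (2) The normal operator $\mathcal L:L^2_\rho\to L^2_\rho$ defined by $\langle\mathcal L\phi,\psi\rangle_{L^2_\rho}=\mathbb E[\langle R_\phi[u],R_\psi[u]\rangle_{\mathbb Y}]$ (these expectations being finite) is nonnegative, self-adjoint and compact, with positive eigenvalues $\lambda_1\ge\lambda_2\ge\cdots>0$ (infinitely many, counted with multiplicity) decaying either polynomially ($ak^{-2r}\le\lambda_k\le bk^{-2r}$ for all $k$, $r>1/4$) or exponentially ($ae^{-rk}\le\lambda_k\le be^{-rk}$ for all $k$, $r>0$), with $b\ge a>0$. Let $\{\psi_k\}_{k\ge1}$ be corresponding orthonormal eigenfunctions. Noise assumption. $\varepsilon:\mathbb Y\to L^2(\Omega)$, $y\mapsto\langle\varepsilon,y\rangle$, is a linear map, independent of $u$, such that: (B1) $\mathbb E[\langle\varepsilon,y\rangle]=0$ and $\mathbb E[\langle\varepsilon,y\rangle^2]\le\sigma^2\|y\|_{\mathbb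 Y}^2$ for all $y\in\mathbb Y$, for some constant $\sigma>0$. (B2) For some orthonormal basis $\{y_i\}$ of $\mathbb Y$, for every $N\le\dim\mathbb Y$ the vector $(\langle\varepsilon,y_1\rangle,\dots,\langle\varepsilon,y_N\rangle)$ has a Lebesgue density $p_N$ on $\mathbb R^N$, and there is $\tau>0$, uniform in $N$ and $v$, with $\int_{\mathbb R^N}\log\big(\frac{p_N(x)}{p_N(x+v)}\big)p_N(x)\,dx\le\frac\tau2\|v\|^2$ for all $v\in\mathbb R^N$. Fourth-moment condition. There is $\kappa\ge1$ with $\mathbb E[\|R_\phi[u]\|_{\mathbb Y}^4]\le\kappa\,(\mathbb E[\|R_\phi[u]\|_{\mathbb Y}^2])^2$ for all $\phi\in H^\beta_\rho$. Spectral Sobolev spaces. $H^\beta_\rho=\{\phi=\sum_{k\ge1}\theta_k\psi_k:\ \|\phi\|_{H^\beta_\rho}^2=\sum_{k\ge1}\lambda_k^{-\beta}\theta_k^2<\infty\}$ and $H^\beta_\rho(L)=\{\phi\in H^\beta_\rho:\|\phi\|_{H^\beta_\rho}^2\le L^2\}$. Data. $\{(u^m,\varepsilon^m)\}_{m=1}^M$ are i.i.d. copies of $(u,\varepsilon)$ and $f^m=R_{\phi_*}[u^m]+\varepsilon^m$, understood weakly: $\langle f^m,y\rangle=\langle R_{\phi_*}[u^m],y\rangle_{\mathbb Y}+\langle\varepsilon^m,y\rangle$. For a square-integrable $\mathbb Y$-valued random variable $U$ independent of $\varepsilon^m$, $\langle\varepsilon^m,U\rangle$ denotes the $L^2(\Omega)$-limit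 of $\sum_{i\le N}\langle U,y_i\rangle_{\mathbb Y}\langle\varepsilon^m,y_i\rangle$, and $\langle f^m,R_\psi[u^m]\rangle=\langle R_{\phi_*}[u^m],R_\psi[u^m]\rangle_{\mathbb Y}+\langle\varepsilon^m,R_\psi[u^m]\rangle$. Normal matrix, vector, and event. For $1\le k,l\le n$, $\overline A_{n,M}(k,l)=\frac1M\sum_{m=1}^M\langle R_{\psi_k}[u^m],R_{\psi_l}[u^m]\rangle_{\mathbb Y}$ and $\overline b_{n,M}(k)=\frac1M\sum_{m=1}^M\langle f^m,R_{\psi_k}[u^m]\rangle$. With $\lambda_k(\cdot)$ the eigenvalues of a symmetric matrix in descending order and $\lambda_{\min}(\cdot)$ the smallest, the event $\mathcal A$ is $\{\lambda_{\min}(\overline A_{n,M})>\lambda_n/4\}$ in the case of polynomial spectral decay and $\{\lambda_k(\overline A_{n,M})>\lambda_k/4\ \text{for all }k\le n\}$ in the case of exponential spectral decay. On $\mathcal A$ the matrix $\overline A_{n,M}$ is invertible. *)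

theory Defs
  imports
    "HOL-Probability.Probability"
    "Jordan_Normal_Form.Spectral_Radius"
    "Jordan_Normal_Form.Gauss_Jordan_Elimination"
begin

section \<open>Square-integrable functions\<close>

text \<open>
  Elements of an \<open>L\<^sup>2\<close> space are represented by square-integrable functions; equality in
  \<open>L\<^sup>2\<close> is equality almost everywhere. The same notions serve for the function space over
  the measure \<open>\<rho>\<close> and for the square-integrable random variables.
\<close>

definition L2 :: "'a measure \<Rightarrow> ('a \<Rightarrow> real) set" where
  "L2 M = {f \<in> borel_measurable M. integrable M (\<lambda>x. (f x)\<^sup>2)}"

definition L2_inner :: "'a measure \<Rightarrow> ('a \<Rightarrow> real) \<Rightarrow> ('a \<Rightarrow> real) \<Rightarrow> real" where
  "L2_inner M f g = (\<integral>x. f x * g x \<partial>M)"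

definition L2_norm :: "'a measure \<Rightarrow> ('a \<Rightarrow> real) \<Rightarrow> real" where
  "L2_norm M f = sqrt (L2_inner M f f)"

definition L2_tendsto :: "'a measure \<Rightarrow> (nat \<Rightarrow> 'a \<Rightarrow> real) \<Rightarrow> ('a \<Rightarrow> real) \<Rightarrow> bool" where
  "L2_tendsto M F f \<longleftrightarrow> (\<forall>N. F N \<in> L2 M) \<and> f \<in> L2 M \<and>
     (\<lambda>N. L2_norm M (\<lambda>x. F N x - f x)) \<longlonglongrightarrow> 0"

text \<open>The second conjunct says that \<open>T\<close> acts on equivalence classes.\<close>

definition L2_linear_operator :: "'a measure \<Rightarrow> (('a \<Rightarrow> real) \<Rightarrow> ('a \<Rightarrow> real)) \<Rightarrow> bool" where
  "L2_linear_operator M T \<longleftrightarrow>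
     (\<forall>f\<in>L2 M. T f \<in> L2 M) \<and>
     (\<forall>f\<in>L2 M. \<forall>g\<in>L2 M. (AE x in M. f x = g x) \<longrightarrow> (AE x in M. T f x = T g x)) \<and>
     (\<forall>f\<in>L2 M. \<forall>g\<in>L2 M. AE x in M. T (\<lambda>z. f z + g z) x = T f x + T g x) \<and>
     (\<forall>c. \<forall>f\<in>L2 M. AE x in M. T (\<lambda>z. c * f z) x = c * T f x)"

definition L2_self_adjoint :: "'a measure \<Rightarrow> (('a \<Rightarrow> real) \<Rightarrow> ('a \<Rightarrow> real)) \<Rightarrow> bool" where
  "L2_self_adjoint M T \<longleftrightarrow> (\<forall>f\<in>L2 M. \<forall>g\<in>L2 M. L2_inner M (T f) g = L2_inner M f (T g))"

definition L2_nonneg :: "'a measure \<Rightarrow> (('a \<Rightarrow> real) \<Rightarrow> ('a \<Rightarrow> real)) \<Rightarrow> bool" where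
  "L2_nonneg M T \<longleftrightarrow> (\<forall>f\<in>L2 M. 0 \<le> L2_inner M (T f) f)"

definition L2_compact :: "'a measure \<Rightarrow> (('a \<Rightarrow> real) \<Rightarrow> ('a \<Rightarrow> real)) \<Rightarrow> bool" where
  "L2_compact M T \<longleftrightarrow>
     (\<forall>F C. (\<forall>N. F N \<in> L2 M \<and> L2_norm M (F N) \<le> C) \<longrightarrow>
       (\<exists>r g. strict_mono (r :: nat \<Rightarrow> nat) \<and> L2_tendsto M (\<lambda>N. T (F (r N))) g))"


section \<open>Forward operator and normal operator\<close>

definition forward_operator ::
  "'s measure \<Rightarrow> (('s \<Rightarrow> real) \<Rightarrow> 'x::banach \<Rightarrow> 'y::{real_inner, polish_space}) \<Rightarrow> bool" where
  "forward_operator \<rho> R \<longleftrightarrow>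
     (\<forall>\<phi>\<in>L2 \<rho>. R \<phi> \<in> borel \<rightarrow>\<^sub>M borel) \<and>
     (\<forall>\<phi>\<in>L2 \<rho>. \<forall>\<eta>\<in>L2 \<rho>. (AE s in \<rho>. \<phi> s = \<eta> s) \<longrightarrow> R \<phi> = R \<eta>) \<and>
     (\<forall>v. \<forall>\<phi>\<in>L2 \<rho>. \<forall>\<eta>\<in>L2 \<rho>. R (\<lambda>s. \<phi> s + \<eta> s) v = R \<phi> v + R \<eta> v) \<and>
     (\<forall>v c. \<forall>\<phi>\<in>L2 \<rho>. R (\<lambda>s. c * \<phi> s) v = c *\<^sub>R R \<phi> v)"

definition normal_operator ::
  "'s measure \<Rightarrow> 'w measure \<Rightarrow> (('s \<Rightarrow> real) \<Rightarrow> 'x::banach \<Rightarrow> 'y::{real_inner, polish_space}) \<Rightarrow>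
   ('w \<Rightarrow> 'x) \<Rightarrow> (('s \<Rightarrow> real) \<Rightarrow> ('s \<Rightarrow> real)) \<Rightarrow> bool" where
  "normal_operator \<rho> P R u T \<longleftrightarrow> L2_linear_operator \<rho> T \<and>
     (\<forall>\<phi>\<in>L2 \<rho>. \<forall>\<eta>\<in>L2 \<rho>.
        integrable P (\<lambda>\<omega>. R \<phi> (u \<omega>) \<bullet> R \<eta> (u \<omega>)) \<and>
        L2_inner \<rho> (T \<phi>) \<eta> = (\<integral>\<omega>. R \<phi> (u \<omega>) \<bullet> R \<eta> (u \<omega>) \<partial>P))"

text \<open>
  Sequences of eigenvalues, eigenfunctions and coefficients are indexed from 1; the value at index 0
  is never used. The last conjunct says that each eigenspace of a positive eigenvalue \<open>\<mu>\<close> is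
  spanned by the listed eigenfunctions, i.e. that all positive eigenvalues are listed with
  their multiplicity. (The index set is finite whenever \<open>lam\<close> tends to 0.)
\<close>

definition positive_eigensystem ::
  "'s measure \<Rightarrow> (('s \<Rightarrow> real) \<Rightarrow> ('s \<Rightarrow> real)) \<Rightarrow> (nat \<Rightarrow> real) \<Rightarrow> (nat \<Rightarrow> 's \<Rightarrow> real) \<Rightarrow> bool" where
  "positive_eigensystem \<rho> T lam \<psi> \<longleftrightarrow>
     (\<forall>k\<ge>1. 0 < lam k \<and> lam (Suc k) \<le> lam k) \<and>
     (\<forall>k\<ge>1. \<psi> k \<in> L2 \<rho>) \<and>
     (\<forall>k\<ge>1. \<forall>l\<ge>1. L2_inner \<rho> (\<psi> k) (\<psi> l) = (if k = l then 1 else 0)) \<and>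
     (\<forall>k\<ge>1. AE s in \<rho>. T (\<psi> k) s = lam k * \<psi> k s) \<and>
     (\<forall>\<mu>>0. \<forall>\<phi>\<in>L2 \<rho>. (AE s in \<rho>. T \<phi> s = \<mu> * \<phi> s) \<longrightarrow>
        (\<exists>c. AE s in \<rho>. \<phi> s = (\<Sum>k | 1 \<le> k \<and> lam k = \<mu>. c k * \<psi> k s)))"

definition polynomial_decay :: "(nat \<Rightarrow> real) \<Rightarrow> bool" where
  "polynomial_decay lam \<longleftrightarrow> (\<exists>a b r. 0 < a \<and> a \<le> b \<and> r > 1/4 \<and>
     (\<forall>k\<ge>1. a * real k powr (-2 * r) \<le> lam k \<and> lam k \<le> b * real k powr (-2 * r)))"

definition exponential_decay :: "(nat \<Rightarrow> real) \<Rightarrow> bool" where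
  "exponential_decay lam \<longleftrightarrow> (\<exists>a b r. 0 < a \<and> a \<le> b \<and> r > 0 \<and>
     (\<forall>k\<ge>1. a * exp (- r * real k) \<le> lam k \<and> lam k \<le> b * exp (- r * real k)))"


section \<open>Spectral Sobolev spaces\<close>

definition L2_expansion :: "'s measure \<Rightarrow> (nat \<Rightarrow> 's \<Rightarrow> real) \<Rightarrow> (nat \<Rightarrow> real) \<Rightarrow> ('s \<Rightarrow> real) \<Rightarrow> bool" where
  "L2_expansion \<rho> \<psi> \<theta> \<phi> \<longleftrightarrow> L2_tendsto \<rho> (\<lambda>N s. \<Sum>k=1..N. \<theta> k * \<psi> k s) \<phi>"

definition sobolev_space ::
  "'s measure \<Rightarrow> (nat \<Rightarrow> real) \<Rightarrow> (nat \<Rightarrow> 's \<Rightarrow> real) \<Rightarrow> real \<Rightarrow> ('s \<Rightarrow> real) set" where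
  "sobolev_space \<rho> lam \<psi> \<beta> = {\<phi> \<in> L2 \<rho>. \<exists>\<theta>. L2_expansion \<rho> \<psi> \<theta> \<phi> \<and>
     summable (\<lambda>k. lam (Suc k) powr (-\<beta>) * (\<theta> (Suc k))\<^sup>2)}"

definition sobolev_ball ::
  "'s measure \<Rightarrow> (nat \<Rightarrow> real) \<Rightarrow> (nat \<Rightarrow> 's \<Rightarrow> real) \<Rightarrow> real \<Rightarrow> real \<Rightarrow> ('s \<Rightarrow> real) set" where
  "sobolev_ball \<rho> lam \<psi> \<beta> L = {\<phi> \<in> L2 \<rho>. \<exists>\<theta>. L2_expansion \<rho> \<psi> \<theta> \<phi> \<and>
     summable (\<lambda>k. lam (Suc k) powr (-\<beta>) * (\<theta> (Suc k))\<^sup>2) \<and>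
     (\<Sum>k. lam (Suc k) powr (-\<beta>) * (\<theta> (Suc k))\<^sup>2) \<le> L\<^sup>2}"

definition fourth_moment_condition ::
  "'w measure \<Rightarrow> (('s \<Rightarrow> real) \<Rightarrow> 'x::banach \<Rightarrow> 'y::{real_inner, polish_space}) \<Rightarrow> ('w \<Rightarrow> 'x) \<Rightarrow>
   ('s \<Rightarrow> real) set \<Rightarrow> real \<Rightarrow> bool" where
  "fourth_moment_condition P R u H \<kappa> \<longleftrightarrow> (\<forall>\<phi>\<in>H.
     integrable P (\<lambda>\<omega>. norm (R \<phi> (u \<omega>)) ^ 4) \<and>
     (\<integral>\<omega>. norm (R \<phi> (u \<omega>)) ^ 4 \<partial>P) \<le> \<kappa> * (\<integral>\<omega>. (norm (R \<phi> (u \<omega>)))\<^sup>2 \<partial>P)\<^sup>2)"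


section \<open>Noise\<close>

text \<open>A linear map into \<open>L\<^sup>2\<close> of the probability space; \<open>\<epsilon> y\<close> is the variable written
  \<open>\<langle>\<epsilon>, y\<rangle>\<close>.\<close>

definition linear_noise :: "'w measure \<Rightarrow> ('y::{real_inner, polish_space} \<Rightarrow> 'w \<Rightarrow> real) \<Rightarrow> bool" where
  "linear_noise P \<epsilon> \<longleftrightarrow>
     (\<forall>y. \<epsilon> y \<in> L2 P) \<and>
     (\<forall>y z. AE \<omega> in P. \<epsilon> (y + z) \<omega> = \<epsilon> y \<omega> + \<epsilon> z \<omega>) \<and>
     (\<forall>c y. AE \<omega> in P. \<epsilon> (c *\<^sub>R y) \<omega> = c * \<epsilon> y \<omega>)"

text \<open>Realisations of the noise, as functions on \<open>Y\<close>, carry the product \<open>\<sigma>\<close>-algebra, which is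
  generated by the variables \<open>\<langle>\<epsilon>, y\<rangle>\<close>.\<close>

abbreviation noise_path_algebra :: "('y \<Rightarrow> real) measure" where
  "noise_path_algebra \<equiv> Pi\<^sub>M UNIV (\<lambda>_. borel)"

text \<open>Independence of \<open>u\<close> and \<open>\<epsilon>\<close>, i.e. of the generated \<open>\<sigma>\<close>-algebras (\<open>indep_var\<close> would
  require both to take values in the same type).\<close>

definition noise_indep :: "'w measure \<Rightarrow> ('w \<Rightarrow> 'x::banach) \<Rightarrow> ('y \<Rightarrow> 'w \<Rightarrow> real) \<Rightarrow> bool" where
  "noise_indep P u \<epsilon> \<longleftrightarrow> prob_space.indep_set P
     (sets (vimage_algebra (space P) u borel))
     (sets (vimage_algebra (space P) (\<lambda>\<omega> y. \<epsilon> y \<omega>) noise_path_algebra))"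

definition noise_moments :: "'w measure \<Rightarrow> ('y::{real_inner, polish_space} \<Rightarrow> 'w \<Rightarrow> real) \<Rightarrow> real \<Rightarrow> bool" where
  "noise_moments P \<epsilon> \<sigma> \<longleftrightarrow> (\<forall>y. (\<integral>\<omega>. \<epsilon> y \<omega> \<partial>P) = 0 \<and> (\<integral>\<omega>. (\<epsilon> y \<omega>)\<^sup>2 \<partial>P) \<le> \<sigma>\<^sup>2 * (norm y)\<^sup>2)"

text \<open>An orthonormal basis is indexed by the positive integers up to \<open>D\<close>, which is then the
  dimension of the space; \<open>D = \<infinity>\<close> in the infinite-dimensional case.\<close>

definition basis_index :: "enat \<Rightarrow> nat set" where
  "basis_index D = {i. 1 \<le> i \<and> enat i \<le> D}"

definition orthonormal_basis :: "enat \<Rightarrow> (nat \<Rightarrow> 'y::{real_inner, polish_space}) \<Rightarrow> bool" where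
  "orthonormal_basis D yb \<longleftrightarrow>
     (\<forall>i\<in>basis_index D. \<forall>j\<in>basis_index D. yb i \<bullet> yb j = (if i = j then 1 else 0)) \<and>
     closure (span (yb ` basis_index D)) = UNIV"

text \<open>
  The space \<open>\<real>\<^sup>N\<close> is the product space over the index set \<open>{1..N}\<close>. The integral of
  \<open>log (p(x) / p(x + v)) p(x)\<close> has an integrable negative part, hence it is below a finite bound
  iff the integrand is integrable. The clause on the positivity of \<open>p(x + v)\<close> is
  needed because \<open>log (p(x) / 0)\<close> means \<open>\<infinity>\<close>, whereas division by 0 and \<open>ln 0\<close> are 0 in HOL.
\<close>

definition noise_shift_entropy ::
  "'w measure \<Rightarrow> enat \<Rightarrow> (nat \<Rightarrow> 'y::{real_inner, polish_space}) \<Rightarrow> ('y \<Rightarrow> 'w \<Rightarrow> real) \<Rightarrow> bool" where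
  "noise_shift_entropy P D yb \<epsilon> \<longleftrightarrow> (\<exists>(p :: nat \<Rightarrow> (nat \<Rightarrow> real) \<Rightarrow> real) \<tau>. \<tau> > 0 \<and> (\<forall>N\<in>basis_index D.
     (let leb = Pi\<^sub>M {1..N} (\<lambda>_. lborel) in
      (\<forall>x. 0 \<le> p N x) \<and>
      distributed P leb (\<lambda>\<omega>. \<lambda>i\<in>{1..N}. \<epsilon> (yb i) \<omega>) (\<lambda>x. ennreal (p N x)) \<and>
      (\<forall>v :: nat \<Rightarrow> real.
         let sh = (\<lambda>x. \<lambda>i\<in>{1..N}. x i + v i) in
         (AE x in leb. 0 < p N x \<longrightarrow> 0 < p N (sh x)) \<and>
         integrable leb (\<lambda>x. ln (p N x / p N (sh x)) * p N x) \<and>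
         (\<integral>x. ln (p N x / p N (sh x)) * p N x \<partial>leb) \<le> \<tau> / 2 * (\<Sum>i=1..N. (v i)\<^sup>2)))))"


section \<open>Data\<close>

text \<open>
  \<open>(us m, \<epsilon>s m)\<close> for \<open>1 \<le> m \<le> M\<close> are i.i.d. copies of \<open>(u, \<epsilon>)\<close>. Equality of the laws on the
  product \<open>\<sigma>\<close>-algebra is equality of the joint laws with finitely many
  \<open>\<langle>\<epsilon>, y\<^sub>1\<rangle>, \<dots>, \<langle>\<epsilon>, y\<^sub>N\<rangle>\<close>.
\<close>

abbreviation sample_algebra :: "('x::banach \<times> ('y \<Rightarrow> real)) measure" where
  "sample_algebra \<equiv> borel \<Otimes>\<^sub>M noise_path_algebra"

definition iid_copies ::
  "'w measure \<Rightarrow> ('w \<Rightarrow> 'x::banach) \<Rightarrow> ('y \<Rightarrow> 'w \<Rightarrow> real) \<Rightarrow> nat \<Rightarrow>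
   (nat \<Rightarrow> 'w \<Rightarrow> 'x) \<Rightarrow> (nat \<Rightarrow> 'y \<Rightarrow> 'w \<Rightarrow> real) \<Rightarrow> bool" where
  "iid_copies P u \<epsilon> M us \<epsilon>s \<longleftrightarrow>
     prob_space.indep_vars P (\<lambda>_. sample_algebra) (\<lambda>m \<omega>. (us m \<omega>, \<lambda>y. \<epsilon>s m y \<omega>)) {1..M} \<and>
     (\<forall>m\<in>{1..M}. distr P sample_algebra (\<lambda>\<omega>. (us m \<omega>, \<lambda>y. \<epsilon>s m y \<omega>)) =
                 distr P sample_algebra (\<lambda>\<omega>. (u \<omega>, \<lambda>y. \<epsilon> y \<omega>)))"

text \<open>\<open>\<langle>\<epsilon>, U\<rangle>\<close> for a random \<open>U\<close>: some version of the \<open>L\<^sup>2\<close>-limit, which is unique up to null sets.\<close>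

definition noise_pairing ::
  "'w measure \<Rightarrow> enat \<Rightarrow> (nat \<Rightarrow> 'y::{real_inner, polish_space}) \<Rightarrow> ('y \<Rightarrow> 'w \<Rightarrow> real) \<Rightarrow>
   ('w \<Rightarrow> 'y) \<Rightarrow> 'w \<Rightarrow> real" where
  "noise_pairing P D yb \<epsilon> U = (SOME Z.
     L2_tendsto P (\<lambda>N \<omega>. \<Sum>i\<in>basis_index D \<inter> {..N}. (U \<omega> \<bullet> yb i) * \<epsilon> (yb i) \<omega>) Z)"

text \<open>\<open>\<langle>f\<^sup>m, R\<^sub>\<eta>[u\<^sup>m]\<rangle>\<close> for the datum \<open>f\<^sup>m = R\<^sub>\<phi>[u\<^sup>m] + \<epsilon>\<^sup>m\<close>, where \<open>v = u\<^sup>m\<close> and \<open>\<epsilon> = \<epsilon>\<^sup>m\<close>.\<close>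

definition data_pairing ::
  "'w measure \<Rightarrow> enat \<Rightarrow> (nat \<Rightarrow> 'y::{real_inner, polish_space}) \<Rightarrow>
   (('s \<Rightarrow> real) \<Rightarrow> 'x::banach \<Rightarrow> 'y) \<Rightarrow> ('s \<Rightarrow> real) \<Rightarrow> ('w \<Rightarrow> 'x) \<Rightarrow> ('y \<Rightarrow> 'w \<Rightarrow> real) \<Rightarrow>
   ('s \<Rightarrow> real) \<Rightarrow> 'w \<Rightarrow> real" where
  "data_pairing P D yb R \<phi> v \<epsilon> \<eta> \<omega> =
     R \<phi> (v \<omega>) \<bullet> R \<eta> (v \<omega>) + noise_pairing P D yb \<epsilon> (\<lambda>\<omega>. R \<eta> (v \<omega>)) \<omega>"


section \<open>Normal matrix, normal vector, and the event\<close>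

text \<open>Matrix and vector indices start at 0, so entry \<open>(i, j)\<close> belongs to \<open>\<psi> (Suc i)\<close> and
  \<open>\<psi> (Suc j)\<close>.\<close>

definition normal_matrix ::
  "(('s \<Rightarrow> real) \<Rightarrow> 'x::banach \<Rightarrow> 'y::{real_inner, polish_space}) \<Rightarrow> (nat \<Rightarrow> 's \<Rightarrow> real) \<Rightarrow>
   (nat \<Rightarrow> 'w \<Rightarrow> 'x) \<Rightarrow> nat \<Rightarrow> nat \<Rightarrow> 'w \<Rightarrow> real Matrix.mat" where
  "normal_matrix R \<psi> us n M \<omega> = Matrix.mat n n (\<lambda>(i, j).
     1 / real M * (\<Sum>m=1..M. R (\<psi> (Suc i)) (us m \<omega>) \<bullet> R (\<psi> (Suc j)) (us m \<omega>)))"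

definition normal_vector ::
  "'w measure \<Rightarrow> enat \<Rightarrow> (nat \<Rightarrow> 'y::{real_inner, polish_space}) \<Rightarrow>
   (('s \<Rightarrow> real) \<Rightarrow> 'x::banach \<Rightarrow> 'y) \<Rightarrow> (nat \<Rightarrow> 's \<Rightarrow> real) \<Rightarrow> ('s \<Rightarrow> real) \<Rightarrow>
   (nat \<Rightarrow> 'w \<Rightarrow> 'x) \<Rightarrow> (nat \<Rightarrow> 'y \<Rightarrow> 'w \<Rightarrow> real) \<Rightarrow> nat \<Rightarrow> nat \<Rightarrow> 'w \<Rightarrow> real Matrix.vec" where
  "normal_vector P D yb R \<psi> \<phi> us \<epsilon>s n M \<omega> = Matrix.vec n (\<lambda>i.
     1 / real M * (\<Sum>m=1..M. data_pairing P D yb R \<phi> (us m) (\<epsilon>s m) (\<psi> (Suc i)) \<omega>))"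

text \<open>Eigenvalues of a real symmetric matrix with multiplicity, in descending order, \<open>1 \<le> k \<le> n\<close>.\<close>

definition matrix_eigenvalue :: "real Matrix.mat \<Rightarrow> nat \<Rightarrow> real" where
  "matrix_eigenvalue A k = rev (sorted_list_of_multiset (proots (char_poly A))) ! (k - 1)"

definition matrix_min_eigenvalue :: "real Matrix.mat \<Rightarrow> real" where
  "matrix_min_eigenvalue A = Min (spectrum A)"

definition event_polynomial :: "'w measure \<Rightarrow> (nat \<Rightarrow> real) \<Rightarrow> nat \<Rightarrow> ('w \<Rightarrow> real Matrix.mat) \<Rightarrow> 'w set" where
  "event_polynomial P lam n A = {\<omega> \<in> space P. matrix_min_eigenvalue (A \<omega>) > lam n / 4}"

definition event_exponential :: "'w measure \<Rightarrow> (nat \<Rightarrow> real) \<Rightarrow> nat \<Rightarrow> ('w \<Rightarrow> real Matrix.mat) \<Rightarrow> 'w set" where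
  "event_exponential P lam n A =
     {\<omega> \<in> space P. \<forall>k\<in>{1..n}. matrix_eigenvalue (A \<omega>) k > lam k / 4}"

text \<open>Squared Euclidean distance of \<open>A\<^sup>-\<^sup>1 b\<close> from \<open>(\<theta>\<^sub>1, \<dots>, \<theta>\<^sub>n)\<close>, for invertible \<open>A\<close>.\<close>

definition estimation_error ::
  "nat \<Rightarrow> real Matrix.mat \<Rightarrow> real Matrix.vec \<Rightarrow> (nat \<Rightarrow> real) \<Rightarrow> real" where
  "estimation_error n A b \<theta> =
     (\<Sum>i<n. (vec_index (the (mat_inverse A) *\<^sub>v b - Matrix.vec n (\<lambda>i. \<theta> (Suc i))) i)\<^sup>2)"

text \<open>Expectation of \<open>X\<close> on the event \<open>E\<close> for nonnegative \<open>X\<close>, as an extended real: a Bochner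
  integral would be 0 if \<open>X\<close> were not integrable on \<open>E\<close>.\<close>

definition expectation_on :: "'w measure \<Rightarrow> 'w set \<Rightarrow> ('w \<Rightarrow> real) \<Rightarrow> ennreal" where
  "expectation_on P E X = (\<integral>\<^sup>+\<omega>. ennreal (X \<omega>) * indicator E \<omega> \<partial>P)"

end

theory Submission
  imports Defs
begin

text \<open>
  Write \<open>\<phi> = \<Sum>\<^sub>k\<^sub>\<le>\<^sub>n \<theta>\<^sub>k \<psi>\<^sub>k + \<zeta>\<close>. The normal vector is then \<open>A \<theta> + d + e\<close>, where \<open>d\<close> averages
  \<open>\<langle>R\<^sub>\<zeta>[u\<^sup>m], R\<^sub>\<psi>[u\<^sup>m]\<rangle>\<close> and \<open>e\<close> averages the noise pairings, so the error on the event is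
  \<open>\<parallel>A\<^sup>-\<^sup>1 (d + e)\<parallel>\<^sup>2\<close>. Given the inputs, \<open>e\<close> is centred with covariance at most \<open>\<sigma>\<^sup>2 A / M\<close>; hence the cross
  term vanishes and \<open>e\<close> contributes at most \<open>\<sigma>\<^sup>2 tr (A\<^sup>-\<^sup>1) / M\<close>. The variables averaged in \<open>d\<close> have mean
  \<open>\<langle>T \<zeta>, \<psi>\<^sub>k\<rangle> = 0\<close> and, by the fourth-moment condition, variance at most \<open>\<kappa> \<lambda>\<^sub>k \<langle>T \<zeta>, \<zeta>\<rangle>\<close>, where
  \<open>\<langle>T \<zeta>, \<zeta>\<rangle> \<le> \<lambda>\<^sub>n\<^bsup>1+\<beta>\<^esup> L\<^sup>2\<close>. On the event the spectral theorem bounds both \<open>\<parallel>A\<^sup>-\<^sup>1\<parallel>\<close> and \<open>tr (A\<^sup>-\<^sup>1)\<close>.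
  Conditioning on the inputs is replaced by approximating \<open>e\<close> by finite sums over the basis, each
  term being a product of an input variable and a noise variable.
\<close>

section \<open>Square-integrable functions\<close>

text \<open>The noise pairings are limits picked by \<open>SOME\<close>, so nothing can be said
  about them until a limit is known to exist; this is what completeness of the square-integrable
  variables is for. The error multiplies these pairings by entries of the inverse, which are random
  and exist only on the event. For the products to stay square integrable and for the input and
  noise factors to separate, the weights must be bounded and depend on the inputs alone; the
  spectral threshold supplies the bound. Independence is given between samples and inside one
  sample, and has to be regrouped into independence of all inputs from all noises. The noise
  contributes a trace because A^-1 A A^-1 = A^-1. The two decay cases differ only in the bound for
  this trace: n times the reciprocal of the smallest threshold, or the sum of the reciprocals of all
  thresholds. The thresholds \<open>lam k / 4\<close> yield the factor 4. The factor 16 is its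
  square, from the squared norm of the inverse, and lam_n^(1+beta) / lam_n^2 explains the exponent
  beta - 1.\<close>

lemma L2D: "f \<in> L2 M \<Longrightarrow> f \<in> borel_measurable M" "f \<in> L2 M \<Longrightarrow> integrable M (\<lambda>x. (f x)\<^sup>2)"
  by (auto simp: L2_def)

lemma L2_mult_integrable:
  assumes "f \<in> L2 M" "g \<in> L2 M"
  shows "integrable M (\<lambda>x. f x * g x)"
proof (rule Bochner_Integration.integrable_bound)
  show "integrable M (\<lambda>x. (f x)\<^sup>2 + (g x)\<^sup>2)" using assms by (auto simp: L2_def)
  show "(\<lambda>x. f x * g x) \<in> borel_measurable M" using assms by (auto simp: L2_def)
  have "\<bar>a * b\<bar> \<le> a\<^sup>2 + b\<^sup>2" for a b :: real
  proof -
    have "2 * (\<bar>a\<bar> * \<bar>b\<bar>) \<le> a\<^sup>2 + b\<^sup>2" using sum_squares_bound[of "\<bar>a\<bar>" "\<bar>b\<bar>"] by (simp add: mult.assoc)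
    moreover have "0 \<le> \<bar>a\<bar> * \<bar>b\<bar>" by simp
    ultimately show ?thesis unfolding abs_mult by linarith
  qed
  then show "AE x in M. norm (f x * g x) \<le> norm ((f x)\<^sup>2 + (g x)\<^sup>2)" by (simp add: abs_mult)
qed

lemma L2_add:
  assumes "f \<in> L2 M" "g \<in> L2 M"
  shows "(\<lambda>x. f x + g x) \<in> L2 M"
proof -
  have "integrable M (\<lambda>x. (f x)\<^sup>2 + 2 * (f x * g x) + (g x)\<^sup>2)"
    using assms L2_mult_integrable[OF assms] by (auto simp: L2_def)
  then have "integrable M (\<lambda>x. (f x + g x)\<^sup>2)"
    by (rule Bochner_Integration.integrable_cong[THEN iffD1, rotated -1]) (auto simp: power2_sum)
  then show ?thesis using assms by (auto simp: L2_def)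
qed

lemma L2_cmult: "f \<in> L2 M \<Longrightarrow> (\<lambda>x. c * f x) \<in> L2 M"
  by (auto simp: L2_def power_mult_distrib)

lemma L2_zero: "(\<lambda>x. 0) \<in> L2 M"
  by (auto simp: L2_def)

lemma L2_diff:
  assumes "f \<in> L2 M" "g \<in> L2 M"
  shows "(\<lambda>x. f x - g x) \<in> L2 M"
  using L2_add[OF assms(1) L2_cmult[OF assms(2), of "-1"]] by simp

lemma L2_sum:
  assumes "\<And>i. i \<in> I \<Longrightarrow> f i \<in> L2 M"
  shows "(\<lambda>x. \<Sum>i\<in>I. f i x) \<in> L2 M"
  using assms by (induction I rule: infinite_finite_induct) (auto intro: L2_zero L2_add)

lemma L2_bounded_mult:
  assumes f: "f \<in> L2 M" and b: "b \<in> borel_measurable M" "\<And>x. x \<in> space M \<Longrightarrow> \<bar>b x\<bar> \<le> K"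
  shows "(\<lambda>x. b x * f x) \<in> L2 M"
proof -
  have "integrable M (\<lambda>x. (b x * f x)\<^sup>2)"
  proof (rule Bochner_Integration.integrable_bound)
    show "integrable M (\<lambda>x. K\<^sup>2 * (f x)\<^sup>2)" using f by (auto simp: L2_def)
    show "(\<lambda>x. (b x * f x)\<^sup>2) \<in> borel_measurable M" using f b by (auto simp: L2_def)
    show "AE x in M. norm ((b x * f x)\<^sup>2) \<le> norm (K\<^sup>2 * (f x)\<^sup>2)"
    proof (rule AE_I2)
      fix x assume "x \<in> space M"
      then have "\<bar>b x\<bar>\<^sup>2 \<le> K\<^sup>2" using b(2) by (intro power_mono) auto
      then show "norm ((b x * f x)\<^sup>2) \<le> norm (K\<^sup>2 * (f x)\<^sup>2)"
        by (simp add: power_mult_distrib mult_right_mono)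
    qed
  qed
  then show ?thesis using f b by (auto simp: L2_def)
qed

lemma L2_Cauchy_Schwarz:
  assumes f: "f \<in> L2 M" and g: "g \<in> L2 M"
  shows "(\<integral>x. f x * g x \<partial>M)\<^sup>2 \<le> (\<integral>x. (f x)\<^sup>2 \<partial>M) * (\<integral>x. (g x)\<^sup>2 \<partial>M)"
proof -
  let ?a = "\<integral>x. (f x)\<^sup>2 \<partial>M" and ?b = "\<integral>x. f x * g x \<partial>M" and ?c = "\<integral>x. (g x)\<^sup>2 \<partial>M"
  note int = L2D(2)[OF f] L2D(2)[OF g] L2_mult_integrable[OF f g]
  show ?thesis
  proof (cases "?c = 0")
    case True
    then have "AE x in M. (g x)\<^sup>2 = 0"
      using integral_nonneg_eq_0_iff_AE[OF int(2)] by simp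
    then have "?b = (\<integral>x. 0 \<partial>M)"
      using f g by (intro integral_cong_AE) (auto simp: L2_def)
    then show ?thesis using True by simp
  next
    case False
    moreover have "?c \<ge> 0" by simp
    ultimately have c: "?c > 0" by linarith
    \<comment> \<open>This \<open>t\<close> minimizes the quadratic polynomial obtained by expanding
      the integral of \<open>(f x - t * g x)^2\<close>.\<close>
    define t where "t = ?b / ?c"
    have "0 \<le> (\<integral>x. (f x - t * g x)\<^sup>2 \<partial>M)" by simp
    also have "\<dots> = (\<integral>x. (f x)\<^sup>2 - 2 * t * (f x * g x) + t\<^sup>2 * (g x)\<^sup>2 \<partial>M)"
      by (rule Bochner_Integration.integral_cong) (auto simp: power2_eq_square algebra_simps)
    also have "\<dots> = ?a - 2 * t * ?b + t\<^sup>2 * ?c" using int by simp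
    also have "\<dots> = ?a - ?b\<^sup>2 / ?c"
    proof -
      have "a - 2 * (b / k) * b + (b / k)\<^sup>2 * k = a - b\<^sup>2 / k" if "k > 0" for a b k :: real
        using that by (simp add: field_simps power2_eq_square)
      then show ?thesis unfolding t_def using c .
    qed
    finally have "?b\<^sup>2 / ?c \<le> ?a" by simp
    then show ?thesis using c by (simp only: pos_divide_le_eq)
  qed
qed

section \<open>Mean-square convergence and completeness\<close>

lemma tendsto_zero_dominated:
  fixes f g :: "nat \<Rightarrow> real"
  assumes "g \<longlonglongrightarrow> 0" "\<And>N. f N \<le> g N" "\<And>N. 0 \<le> f N"
  shows "f \<longlonglongrightarrow> 0"
  using assms by (intro tendsto_sandwich[OF _ _ tendsto_const assms(1)] always_eventually) auto

lemma L2_tendsto_iff: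
  "L2_tendsto M F f \<longleftrightarrow> (\<forall>N. F N \<in> L2 M) \<and> f \<in> L2 M \<and> (\<lambda>N. \<integral>x. (F N x - f x)\<^sup>2 \<partial>M) \<longlonglongrightarrow> 0"
proof -
  have "(\<lambda>N. sqrt (\<integral>x. (F N x - f x)\<^sup>2 \<partial>M)) \<longlonglongrightarrow> 0 \<longleftrightarrow> (\<lambda>N. \<integral>x. (F N x - f x)\<^sup>2 \<partial>M) \<longlonglongrightarrow> 0"
  proof
    assume "(\<lambda>N. sqrt (\<integral>x. (F N x - f x)\<^sup>2 \<partial>M)) \<longlonglongrightarrow> 0"
    from tendsto_power[OF this, of 2] show "(\<lambda>N. \<integral>x. (F N x - f x)\<^sup>2 \<partial>M) \<longlonglongrightarrow> 0" by simp
  next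
    assume "(\<lambda>N. \<integral>x. (F N x - f x)\<^sup>2 \<partial>M) \<longlonglongrightarrow> 0"
    from tendsto_real_sqrt[OF this] show "(\<lambda>N. sqrt (\<integral>x. (F N x - f x)\<^sup>2 \<partial>M)) \<longlonglongrightarrow> 0" by simp
  qed
  then show ?thesis by (simp add: L2_tendsto_def L2_norm_def L2_inner_def power2_eq_square)
qed

lemma L2_tendsto_inner:
  assumes F: "L2_tendsto M F f" and g: "g \<in> L2 M"
  shows "(\<lambda>N. \<integral>x. F N x * g x \<partial>M) \<longlonglongrightarrow> (\<integral>x. f x * g x \<partial>M)"
proof -
  have L: "F N \<in> L2 M" "f \<in> L2 M" for N using F by (auto simp: L2_tendsto_iff)
  have "(\<lambda>N. (\<integral>x. (F N x - f x)\<^sup>2 \<partial>M) * (\<integral>x. (g x)\<^sup>2 \<partial>M)) \<longlonglongrightarrow> 0"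
    using F unfolding L2_tendsto_iff by (intro tendsto_mult_left_zero) auto
  then have "(\<lambda>N. (\<integral>x. (F N x - f x) * g x \<partial>M)\<^sup>2) \<longlonglongrightarrow> 0"
    by (rule tendsto_zero_dominated) (intro zero_le_power2 L2_Cauchy_Schwarz L2_diff L g)+
  from tendsto_real_sqrt[OF this] have "(\<lambda>N. \<integral>x. (F N x - f x) * g x \<partial>M) \<longlonglongrightarrow> 0"
    by (simp add: tendsto_rabs_zero_iff)
  moreover have "(\<integral>x. (F N x - f x) * g x \<partial>M) = (\<integral>x. F N x * g x \<partial>M) - (\<integral>x. f x * g x \<partial>M)" for N
    using L2_mult_integrable[OF L(1) g] L2_mult_integrable[OF L(2) g] by (simp add: left_diff_distrib)
  ultimately show ?thesis by (simp add: LIM_zero_iff)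
qed

text \<open>Since |F|^2 = |F - f|^2 + 2 <F, f> - |f|^2, the claim reduces to convergence of the
  inner products with the fixed function \<open>f\<close>.\<close>

lemma L2_tendsto_square:
  assumes F: "L2_tendsto M F f"
  shows "(\<lambda>N. \<integral>x. (F N x)\<^sup>2 \<partial>M) \<longlonglongrightarrow> (\<integral>x. (f x)\<^sup>2 \<partial>M)"
proof -
  have L: "F N \<in> L2 M" "f \<in> L2 M" for N using F by (auto simp: L2_tendsto_iff)
  have "(\<integral>x. (F N x)\<^sup>2 \<partial>M) = (\<integral>x. (F N x - f x)\<^sup>2 \<partial>M) + 2 * (\<integral>x. F N x * f x \<partial>M) - (\<integral>x. (f x)\<^sup>2 \<partial>M)" for N
  proof -
    have "(\<integral>x. (F N x)\<^sup>2 \<partial>M) = (\<integral>x. (F N x - f x)\<^sup>2 + 2 * (F N x * f x) - (f x)\<^sup>2 \<partial>M)"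
      by (rule Bochner_Integration.integral_cong) (auto simp: power2_eq_square algebra_simps)
    then show ?thesis
      using L2D(2)[OF L2_diff[OF L]] L2_mult_integrable[OF L] L2D(2)[OF L(2)] by simp
  qed
  moreover have "(\<lambda>N. (\<integral>x. (F N x - f x)\<^sup>2 \<partial>M) + 2 * (\<integral>x. F N x * f x \<partial>M) - (\<integral>x. (f x)\<^sup>2 \<partial>M))
    \<longlonglongrightarrow> 0 + 2 * (\<integral>x. f x * f x \<partial>M) - (\<integral>x. (f x)\<^sup>2 \<partial>M)"
    using F L2_tendsto_inner[OF F L(2)] unfolding L2_tendsto_iff by (intro tendsto_add tendsto_diff tendsto_mult tendsto_const) auto
  ultimately show ?thesis by (simp add: power2_eq_square)
qed

lemma L2_tendsto_add:
  assumes F: "L2_tendsto M F f" and G: "L2_tendsto M G g"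
  shows "L2_tendsto M (\<lambda>N x. F N x + G N x) (\<lambda>x. f x + g x)"
proof -
  have L: "F N \<in> L2 M" "f \<in> L2 M" "G N \<in> L2 M" "g \<in> L2 M" for N using F G by (auto simp: L2_tendsto_iff)
  have "(\<lambda>N. 2 * (\<integral>x. (F N x - f x)\<^sup>2 \<partial>M) + 2 * (\<integral>x. (G N x - g x)\<^sup>2 \<partial>M)) \<longlonglongrightarrow> 0"
    using F G unfolding L2_tendsto_iff by (intro tendsto_add_zero tendsto_mult_right_zero) auto
  moreover have "(\<integral>x. (F N x + G N x - (f x + g x))\<^sup>2 \<partial>M)
    \<le> 2 * (\<integral>x. (F N x - f x)\<^sup>2 \<partial>M) + 2 * (\<integral>x. (G N x - g x)\<^sup>2 \<partial>M)" for N
  proof -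
    have "(a + b - (c + d))\<^sup>2 \<le> 2 * (a - c)\<^sup>2 + 2 * (b - d)\<^sup>2" for a b c d :: real
      using zero_le_power2[of "(a - c) - (b - d)"] by (simp add: power2_eq_square algebra_simps)
    then have "(\<integral>x. (F N x + G N x - (f x + g x))\<^sup>2 \<partial>M)
      \<le> (\<integral>x. 2 * (F N x - f x)\<^sup>2 + 2 * (G N x - g x)\<^sup>2 \<partial>M)"
      using L by (intro integral_mono Bochner_Integration.integrable_add integrable_mult_right L2D(2) L2_diff L2_add) auto
    then show ?thesis
      using L2D(2)[OF L2_diff[OF L(1)[of N] L(2)]] L2D(2)[OF L2_diff[OF L(3)[of N] L(4)]] by simp
  qed
  ultimately have "(\<lambda>N. \<integral>x. (F N x + G N x - (f x + g x))\<^sup>2 \<partial>M) \<longlonglongrightarrow> 0"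
    by (rule tendsto_zero_dominated) simp
  then show ?thesis using L by (simp add: L2_tendsto_iff L2_add)
qed

lemma L2_tendsto_const: "f \<in> L2 M \<Longrightarrow> L2_tendsto M (\<lambda>N. f) f"
  by (simp add: L2_tendsto_iff)

lemma L2_tendsto_sum:
  assumes "\<And>i. i \<in> I \<Longrightarrow> L2_tendsto M (F i) (f i)"
  shows "L2_tendsto M (\<lambda>N x. \<Sum>i\<in>I. F i N x) (\<lambda>x. \<Sum>i\<in>I. f i x)"
  using assms
  by (induction I rule: infinite_finite_induct) (auto intro: L2_tendsto_const L2_zero L2_tendsto_add)

text \<open>Serves to pass to the limit in sums of noise terms with random weights; a multiplier
  without a uniform bound need not preserve square integrability.\<close>

lemma L2_tendsto_bounded_mult:
  assumes F: "L2_tendsto M F f" and b: "b \<in> borel_measurable M" "\<And>x. x \<in> space M \<Longrightarrow> \<bar>b x\<bar> \<le> K"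
  shows "L2_tendsto M (\<lambda>N x. b x * F N x) (\<lambda>x. b x * f x)"
proof -
  have L: "F N \<in> L2 M" "f \<in> L2 M" for N using F by (auto simp: L2_tendsto_iff)
  have "(\<lambda>N. K\<^sup>2 * (\<integral>x. (F N x - f x)\<^sup>2 \<partial>M)) \<longlonglongrightarrow> 0"
    using F unfolding L2_tendsto_iff by (intro tendsto_mult_right_zero) auto
  moreover have "(\<integral>x. (b x * F N x - b x * f x)\<^sup>2 \<partial>M) \<le> K\<^sup>2 * (\<integral>x. (F N x - f x)\<^sup>2 \<partial>M)" for N
  proof -
    have "(\<integral>x. (b x * F N x - b x * f x)\<^sup>2 \<partial>M) \<le> (\<integral>x. K\<^sup>2 * (F N x - f x)\<^sup>2 \<partial>M)"
    proof (intro integral_mono L2D(2) L2_diff L2_bounded_mult[OF _ b] integrable_mult_right L)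
      fix x assume "x \<in> space M"
      then have "\<bar>b x\<bar>\<^sup>2 \<le> K\<^sup>2" using b(2) by (intro power_mono) auto
      then show "(b x * F N x - b x * f x)\<^sup>2 \<le> K\<^sup>2 * (F N x - f x)\<^sup>2"
        by (simp add: power_mult_distrib mult_right_mono flip: right_diff_distrib)
    qed auto
    then show ?thesis by simp
  qed
  ultimately have "(\<lambda>N. \<integral>x. (b x * F N x - b x * f x)\<^sup>2 \<partial>M) \<longlonglongrightarrow> 0"
    by (rule tendsto_zero_dominated) simp
  then show ?thesis
    unfolding L2_tendsto_iff using L2_bounded_mult[OF L(1) b] L2_bounded_mult[OF L(2) b] by simp
qed

lemma L2_tendsto_cmult:
  "L2_tendsto M F f \<Longrightarrow> L2_tendsto M (\<lambda>N x. c * F N x) (\<lambda>x. c * f x)"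
  using L2_tendsto_bounded_mult[of M F f "\<lambda>_. c" "\<bar>c\<bar>"] by simp

text \<open>Riesz-Fischer: a fast subsequence converges almost everywhere, and Fatou's lemma turns
  the Cauchy estimate into convergence of the whole sequence to that pointwise limit.\<close>

lemma (in prob_space) L2_complete:
  assumes L: "\<And>N. F N \<in> L2 M"
    and cauchy: "\<And>e. e > 0 \<Longrightarrow> \<exists>K. \<forall>m\<ge>K. \<forall>n\<ge>K. (\<integral>x. (F m x - F n x)\<^sup>2 \<partial>M) \<le> e"
  shows "\<exists>f. L2_tendsto M F f"
proof -
  have "\<exists>K. \<forall>m\<ge>K. \<forall>n\<ge>K. (\<integral>x. (F m x - F n x)\<^sup>2 \<partial>M) \<le> (1/4) ^ k" for k
    by (rule cauchy) simp
  then obtain K where K: "\<And>k m n. m \<ge> K k \<Longrightarrow> n \<ge> K k \<Longrightarrow> (\<integral>x. (F m x - F n x)\<^sup>2 \<partial>M) \<le> (1/4) ^ k"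
    by metis
  \<comment> \<open>A rapidly Cauchy subsequence, whose increments are absolutely summable almost everywhere.\<close>
  define r where "r k = k + Max (K ` {..k})" for k
  have rK: "r k \<ge> K k" for k unfolding r_def by (simp add: trans_le_add2)
  have rS: "r (Suc k) \<ge> K k" for k
    unfolding r_def by (intro trans_le_add2 Max_ge) auto
  have rk: "r k \<ge> k" for k by (simp add: r_def)
  define D where "D k x = F (r (Suc k)) x - F (r k) x" for k x
  have DL: "D k \<in> L2 M" for k unfolding D_def by (intro L2_diff L)
  have D1: "integrable M (D k)" for k
    using L2_mult_integrable[OF DL[of k], of "\<lambda>_. 1"] by (simp add: L2_def)
  have Dint: "(\<integral>x. \<bar>D k x\<bar> \<partial>M) \<le> (1/2) ^ k" for k
  proof -
    have "(\<integral>x. \<bar>D k x\<bar> \<partial>M) \<le> (\<integral>x. (2 ^ k * (D k x)\<^sup>2 + (1/2) ^ k) / 2 \<partial>M)"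
    proof (intro integral_mono integrable_abs D1)
      fix x
      \<comment> \<open>A weighted arithmetic-geometric mean inequality. Since the mean of
        \<open>(D k x)^2\<close> is at most 4^-k, the weight 2^k makes both summands of the upper
        bound at most 2^-k after integration.\<close>
      have "0 \<le> (1/2) ^ k * (2 ^ k * \<bar>D k x\<bar> - 1)\<^sup>2" by simp
      also have "\<dots> = 2 ^ k * (D k x)\<^sup>2 + (1/2) ^ k - 2 * \<bar>D k x\<bar>"
        by (simp add: power2_diff power_mult_distrib field_simps power2_eq_square power_divide)
      finally show "\<bar>D k x\<bar> \<le> (2 ^ k * (D k x)\<^sup>2 + (1/2) ^ k) / 2" by simp
    qed (use L2D(2)[OF DL] in auto)
    also have "\<dots> = (2 ^ k * (\<integral>x. (D k x)\<^sup>2 \<partial>M) + (1/2) ^ k) / 2"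
      using L2D(2)[OF DL] by (simp add: prob_space)
    also have "\<dots> \<le> (2 ^ k * (1/4) ^ k + (1/2) ^ k) / 2"
      unfolding D_def using K[OF rS rK] by (intro divide_right_mono add_right_mono mult_left_mono) auto
    also have "(2::real) ^ k * (1/4) ^ k = (1/2) ^ k" by (simp flip: power_mult_distrib)
    finally show ?thesis by simp
  qed
  have "(\<integral>\<^sup>+x. (\<Sum>k. ennreal \<bar>D k x\<bar>) \<partial>M) = (\<Sum>k. \<integral>\<^sup>+x. ennreal \<bar>D k x\<bar> \<partial>M)"
    using L2D(1)[OF DL] by (intro nn_integral_suminf) auto
  also have "\<dots> = (\<Sum>k. ennreal (\<integral>x. \<bar>D k x\<bar> \<partial>M))"
    using D1 by (intro suminf_cong nn_integral_eq_integral) auto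
  also have "\<dots> \<le> (\<Sum>k. ennreal ((1/2) ^ k))"
    by (intro suminf_le) (auto intro!: ennreal_leI Dint)
  also have "\<dots> < \<infinity>"
    by (subst suminf_ennreal2) (auto intro: summable_geometric)
  finally have fin: "(\<integral>\<^sup>+x. (\<Sum>k. ennreal \<bar>D k x\<bar>) \<partial>M) \<noteq> \<infinity>" by simp
  have "AE x in M. (\<Sum>k. ennreal \<bar>D k x\<bar>) \<noteq> \<infinity>"
    using L2D(1)[OF DL] fin by (intro nn_integral_PInf_AE) auto
  then have summ: "AE x in M. summable (\<lambda>k. D k x)"
  proof eventually_elim
    case (elim x)
    then have "summable (\<lambda>k. \<bar>D k x\<bar>)" by (intro summable_suminf_not_top) auto
    then show ?case by (rule summable_rabs_cancel)
  qed
  \<comment> \<open>Where the series diverges, \<open>Z\<close> has an irrelevant default value;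
    this happens only on a null set.\<close>
  define Z where "Z x = F (r 0) x + (\<Sum>k. D k x)" for x
  have Zm: "Z \<in> borel_measurable M"
    unfolding Z_def using L2D(1)[OF L] L2D(1)[OF DL] by (intro borel_measurable_add borel_measurable_suminf) auto
  have conv: "AE x in M. (\<lambda>k. F (r k) x) \<longlonglongrightarrow> Z x"
    using summ
  proof eventually_elim
    case (elim x)
    have "(\<Sum>k<n. D k x) = F (r n) x - F (r 0) x" for n
      unfolding D_def using sum_lessThan_telescope[of "\<lambda>k. F (r k) x" n] by simp
    then have "(\<lambda>n. F (r n) x) = (\<lambda>n. F (r 0) x + (\<Sum>k<n. D k x))"
      by (metis add.commute diff_add_cancel)
    moreover have "(\<lambda>n. F (r 0) x + (\<Sum>k<n. D k x)) \<longlonglongrightarrow> Z x"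
      unfolding Z_def using elim by (intro tendsto_add tendsto_const summable_LIMSEQ)
    ultimately show ?case by (simp only:)
  qed
  \<comment> \<open>Fatou's lemma along the subsequence. The estimate is stated for the extended
    integral because integrability of \<open>F n - Z\<close> is not yet known; it is deduced from
    the finiteness obtained here.\<close>
  have key: "(\<integral>\<^sup>+x. ennreal ((F n x - Z x)\<^sup>2) \<partial>M) \<le> ennreal e"
    if e: "e > 0" and n: "\<And>m. m \<ge> K' \<Longrightarrow> (\<integral>x. (F n x - F m x)\<^sup>2 \<partial>M) \<le> e" for n e K'
  proof -
    have "(\<integral>\<^sup>+x. ennreal ((F n x - Z x)\<^sup>2) \<partial>M) = (\<integral>\<^sup>+x. liminf (\<lambda>k. ennreal ((F n x - F (r k) x)\<^sup>2)) \<partial>M)"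
    proof (rule nn_integral_cong_AE)
      show "AE x in M. ennreal ((F n x - Z x)\<^sup>2) = liminf (\<lambda>k. ennreal ((F n x - F (r k) x)\<^sup>2))"
        using conv
      proof eventually_elim
        case (elim x)
        have "(\<lambda>k. ennreal ((F n x - F (r k) x)\<^sup>2)) \<longlonglongrightarrow> ennreal ((F n x - Z x)\<^sup>2)"
          using elim by (intro tendsto_ennrealI tendsto_power tendsto_diff tendsto_const)
        then show ?case by (intro lim_imp_Liminf[symmetric]) auto
      qed
    qed
    also have "\<dots> \<le> liminf (\<lambda>k. \<integral>\<^sup>+x. ennreal ((F n x - F (r k) x)\<^sup>2) \<partial>M)"
      using L2D(1)[OF L] by (intro nn_integral_liminf) auto
    also have "\<dots> \<le> limsup (\<lambda>k. \<integral>\<^sup>+x. ennreal ((F n x - F (r k) x)\<^sup>2) \<partial>M)"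
      by (rule Liminf_le_Limsup) simp
    also have "\<dots> \<le> ennreal e"
    proof (rule Limsup_bounded)
      show "\<forall>\<^sub>F k in sequentially. (\<integral>\<^sup>+x. ennreal ((F n x - F (r k) x)\<^sup>2) \<partial>M) \<le> ennreal e"
        using eventually_ge_at_top[of K']
      proof eventually_elim
        case (elim k)
        have "(\<integral>\<^sup>+x. ennreal ((F n x - F (r k) x)\<^sup>2) \<partial>M) = ennreal (\<integral>x. (F n x - F (r k) x)\<^sup>2 \<partial>M)"
          by (intro nn_integral_eq_integral L2D(2) L2_diff L) auto
        then show ?case using n[of "r k"] rk[of k] elim by (simp add: ennreal_leI)
      qed
    qed
    finally show ?thesis .
  qed
  have FZ: "(\<lambda>x. F n x - Z x) \<in> L2 M" if "\<And>m. m \<ge> K' \<Longrightarrow> (\<integral>x. (F n x - F m x)\<^sup>2 \<partial>M) \<le> 1" for n K'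
  proof -
    have "(\<lambda>x. F n x - Z x) \<in> borel_measurable M" using L2D(1)[OF L] Zm by auto
    moreover have "(\<integral>\<^sup>+x. ennreal ((F n x - Z x)\<^sup>2) \<partial>M) < \<infinity>"
      by (rule le_less_trans[OF key[of 1 K' n]]) (use that in auto)
    ultimately show ?thesis unfolding L2_def by (auto intro!: integrableI_nonneg)
  qed
  obtain K1 where K1: "\<And>m n. m \<ge> K1 \<Longrightarrow> n \<ge> K1 \<Longrightarrow> (\<integral>x. (F m x - F n x)\<^sup>2 \<partial>M) \<le> 1"
    using cauchy[of 1] by auto
  have ZL: "Z \<in> L2 M" using L2_diff[OF L[of K1] FZ[of K1 K1]] K1 by simp
  have "(\<lambda>N. \<integral>x. (F N x - Z x)\<^sup>2 \<partial>M) \<longlonglongrightarrow> 0"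
  proof (rule LIMSEQ_I)
    fix e :: real assume e: "e > 0"
    then obtain K2 where K2: "\<And>m n. m \<ge> K2 \<Longrightarrow> n \<ge> K2 \<Longrightarrow> (\<integral>x. (F m x - F n x)\<^sup>2 \<partial>M) \<le> e / 2"
      using cauchy[of "e/2"] by auto
    have "(\<integral>x. (F n x - Z x)\<^sup>2 \<partial>M) \<le> e / 2" if "n \<ge> K2" for n
    proof -
      have "ennreal (\<integral>x. (F n x - Z x)\<^sup>2 \<partial>M) \<le> ennreal (e / 2)"
        using key[of "e/2" K2 n] e K2[OF that]
        by (subst nn_integral_eq_integral[symmetric]) (auto intro!: L2D(2) L2_diff L ZL)
      then show ?thesis using e by (simp add: ennreal_le_iff)
    qed
    then show "\<exists>no. \<forall>n\<ge>no. norm ((\<integral>x. (F n x - Z x)\<^sup>2 \<partial>M) - 0) < e"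
      using e by (intro exI[of _ K2]) force
  qed
  then show ?thesis using L ZL by (auto simp: L2_tendsto_iff)
qed

section \<open>Symmetric real matrices\<close>

no_notation vec_nth (infixl \<open>$\<close> 90)

text \<open>A complex eigenvalue z with eigenvector v exists. The Hermitian form of A at v equals z
  |v|^2, and it is its own conjugate because A is real and symmetric, so z is real. As a root of the
  characteristic polynomial it is then an eigenvalue over the reals, with a real
  eigenvector.\<close>

lemma symmetric_mat_real_eigenvalue:
  fixes A :: "real mat"
  assumes A: "A \<in> carrier_mat n n" and sym: "transpose_mat A = A" and n: "n \<noteq> 0"
  shows "\<exists>e. eigenvalue A e"
proof -
  let ?C = "map_mat complex_of_real A"
  have C: "?C \<in> carrier_mat n n" using A by simp
  from spectrum_non_empty[OF C] n obtain z where "eigenvalue ?C z"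
    unfolding spectrum_def by auto
  then obtain v where v: "v \<in> carrier_vec n" "v \<noteq> 0\<^sub>v n" and ev: "?C *\<^sub>v v = z \<cdot>\<^sub>v v"
    unfolding eigenvalue_def eigenvector_def using C by auto
  have ent: "(\<Sum>j<n. complex_of_real (A $$ (i,j)) * v $ j) = z * v $ i" if "i < n" for i
  proof -
    have "(?C *\<^sub>v v) $ i = (\<Sum>j<n. complex_of_real (A $$ (i,j)) * v $ j)"
      using that A v by (simp add: scalar_prod_def atLeast0LessThan)
    then show ?thesis using ev that v by simp
  qed
  have symA: "A $$ (i,j) = A $$ (j,i)" if "i < n" "j < n" for i j
    using arg_cong[OF sym, of "\<lambda>B. B $$ (i,j)"] that A by simp
  define q where "q = (\<Sum>i<n. \<Sum>j<n. cnj (v $ i) * complex_of_real (A $$ (i,j)) * v $ j)"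
  define s where "s = (\<Sum>i<n. (cmod (v $ i))\<^sup>2)"
  have q1: "q = z * complex_of_real s"
  proof -
    have "q = (\<Sum>i<n. cnj (v $ i) * (z * v $ i))"
      unfolding q_def by (rule sum.cong) (simp_all add: ent[symmetric] sum_distrib_left mult.assoc)
    also have "\<dots> = z * complex_of_real s"
      unfolding s_def of_real_sum sum_distrib_left
      by (rule sum.cong) (simp_all only: complex_norm_square mult_ac)
    finally show ?thesis .
  qed
  have "cnj q = (\<Sum>i<n. \<Sum>j<n. v $ i * complex_of_real (A $$ (i,j)) * cnj (v $ j))"
    unfolding q_def by simp
  also have "\<dots> = (\<Sum>j<n. \<Sum>i<n. v $ i * complex_of_real (A $$ (i,j)) * cnj (v $ j))"
    by (rule sum.swap)
  also have "\<dots> = q"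
    unfolding q_def by (intro sum.cong refl) (simp add: symA mult_ac)
  finally have "cnj q = q" .
  moreover have "s > 0"
  proof -
    obtain i where "i < n" "v $ i \<noteq> 0" using v by (metis carrier_vecD eq_vecI index_zero_vec)
    then show ?thesis unfolding s_def by (intro sum_pos2[of _ i]) auto
  qed
  ultimately have "cnj z = z" using q1 by simp
  then obtain e where e: "z = complex_of_real e" by (metis Reals_cases Reals_cnj_iff)
  interpret of_real_hom: field_hom "complex_of_real" by unfold_locales auto
  have "poly (char_poly ?C) z = 0" using \<open>eigenvalue ?C z\<close> eigenvalue_root_char_poly[OF C] by simp
  then have "poly (map_poly complex_of_real (char_poly A)) (complex_of_real e) = 0"
    unfolding of_real_hom.char_poly_hom[OF A] e .
  moreover have "poly (map_poly complex_of_real p) (complex_of_real e) = complex_of_real (poly p e)" for p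
    by (induct p) (auto simp: map_poly_pCons)
  ultimately have "complex_of_real (poly (char_poly A) e) = 0" by (simp only: )
  then have "poly (char_poly A) e = 0" by (simp only: of_real_eq_0_iff)
  then show ?thesis using eigenvalue_root_char_poly[OF A] by blast
qed

text \<open>The reflection along \<open>x - e\<^sub>0\<close>; it is the identity when \<open>x = e\<^sub>0\<close>.\<close>

lemma householder_mat:
  fixes x :: "real vec"
  assumes x: "x \<in> carrier_vec (Suc n)" and unit: "x \<bullet> x = 1"
  shows "\<exists>W \<in> carrier_mat (Suc n) (Suc n). transpose_mat W = W \<and> W * W = 1\<^sub>m (Suc n) \<and>
    W *\<^sub>v x = unit_vec (Suc n) 0"
proof (cases "x $ 0 = 1")
  case True
  have "(\<Sum>i<Suc n. (x $ i)\<^sup>2) = 1"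
    using unit x by (simp add: scalar_prod_def atLeast0LessThan power2_eq_square)
  then have "(\<Sum>i<n. (x $ Suc i)\<^sup>2) = 0" using True by (simp only: sum.lessThan_Suc_shift) simp
  then have "x $ Suc i = 0" if "i < n" for i using that by (simp add: sum_nonneg_eq_0_iff)
  then have "x = unit_vec (Suc n) 0"
    using True x by (intro eq_vecI) (auto simp: less_Suc_eq_0_disj)
  then show ?thesis by (intro bexI[of _ "1\<^sub>m (Suc n)"]) auto
next
  case False
  define w where "w i = x $ i - (if i = 0 then 1 else 0)" for i
  define c where "c = 1 / (1 - x $ 0)"
  define d :: "nat \<Rightarrow> nat \<Rightarrow> real" where "d i j = (if i = j then 1 else 0)" for i j
  define W where "W = Matrix.mat (Suc n) (Suc n) (\<lambda>(i,j). d i j - c * w i * w j)"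
  have xx: "(\<Sum>i<Suc n. (x $ i)\<^sup>2) = 1"
    using unit x by (simp add: scalar_prod_def atLeast0LessThan power2_eq_square)
  have wx: "(\<Sum>i<Suc n. w i * x $ i) = 1 - x $ 0"
  proof -
    have "(\<Sum>i<Suc n. w i * x $ i) = (\<Sum>i<Suc n. (x $ i)\<^sup>2 - (if i = 0 then x $ 0 else 0))"
      by (intro sum.cong) (auto simp: w_def power2_eq_square algebra_simps)
    then show ?thesis using xx by (simp only: sum_subtractf) simp
  qed
  have ww: "(\<Sum>i<Suc n. w i * w i) = 2 * (1 - x $ 0)"
  proof -
    have "(\<Sum>i<Suc n. w i * w i) = (\<Sum>i<Suc n. w i * x $ i - (if i = 0 then x $ 0 - 1 else 0))"
      by (intro sum.cong) (auto simp: w_def algebra_simps)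
    then show ?thesis using wx by (simp only: sum_subtractf) simp
  qed
  have "W * W = 1\<^sub>m (Suc n)"
  proof (rule eq_matI)
    fix i j assume "i < dim_row (1\<^sub>m (Suc n) :: real mat)" "j < dim_col (1\<^sub>m (Suc n) :: real mat)"
    then have ij: "i < Suc n" "j < Suc n" by auto
    have "(W * W) $$ (i,j) = (\<Sum>k<Suc n. (d i k - c * w i * w k) * (d k j - c * w k * w j))"
      using ij by (simp add: W_def scalar_prod_def atLeast0LessThan)
    also have "\<dots> = (\<Sum>k<Suc n. d i k * d k j - c * (if k = i then w k * w j else 0)
        - c * (if k = j then w i * w k else 0) + c * c * w i * w j * (w k * w k))"
      by (intro sum.cong) (auto simp: d_def algebra_simps)
    also have "\<dots> = (\<Sum>k<Suc n. d i k * d k j) - c * w i * w j - c * w i * w j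
        + c * c * w i * w j * (2 * (1 - x $ 0))"
      using ij unfolding sum.distrib sum_subtractf sum_distrib_left[symmetric] ww
      by (simp add: sum.delta del: sum.lessThan_Suc)
    also have "(\<Sum>k<Suc n. d i k * d k j) = (\<Sum>k<Suc n. if k = i then d k j else 0)"
      by (intro sum.cong) (auto simp: d_def)
    also have "\<dots> = d i j" using ij by (simp del: sum.lessThan_Suc)
    also have "d i j - c * w i * w j - c * w i * w j + c * c * w i * w j * (2 * (1 - x $ 0)) = d i j"
    proof -
      have "c * (1 - x $ 0) = 1" using False by (simp add: c_def)
      then have "c * c * w i * w j * (2 * (1 - x $ 0)) = 2 * (c * w i * w j)"
        by (metis (no_types, lifting) mult.assoc mult.commute mult.right_neutral)
      then show ?thesis by simp
    qed
    finally show "(W * W) $$ (i,j) = 1\<^sub>m (Suc n) $$ (i,j)" using ij by (simp add: d_def)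
  qed (auto simp: W_def)
  moreover have "W *\<^sub>v x = unit_vec (Suc n) 0"
  proof (rule eq_vecI)
    fix i assume "i < dim_vec (unit_vec (Suc n) 0 :: real vec)"
    then have i: "i < Suc n" by simp
    have "(W *\<^sub>v x) $ i = (\<Sum>k<Suc n. (d i k - c * w i * w k) * x $ k)"
      using i x by (simp add: W_def scalar_prod_def atLeast0LessThan)
    also have "\<dots> = (\<Sum>k<Suc n. (if k = i then x $ k else 0) - c * w i * (w k * x $ k))"
      by (intro sum.cong) (auto simp: d_def algebra_simps)
    also have "\<dots> = x $ i - c * w i * (1 - x $ 0)"
      using i unfolding sum_subtractf sum_distrib_left[symmetric] wx by (simp del: sum.lessThan_Suc)
    also have "\<dots> = x $ i - w i" using False by (simp add: c_def field_simps)
    finally show "(W *\<^sub>v x) $ i = unit_vec (Suc n) 0 $ i" using i by (simp add: w_def)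
  qed (auto simp: W_def)
  moreover have "transpose_mat W = W" by (rule eq_matI) (auto simp: W_def d_def)
  ultimately show ?thesis by (intro bexI[of _ W]) (auto simp: W_def)
qed

section \<open>Diagonalization and inverses of symmetric matrices\<close>

definition diagonal_matrix :: "nat \<Rightarrow> (nat \<Rightarrow> real) \<Rightarrow> real mat" where
  "diagonal_matrix n d = Matrix.mat n n (\<lambda>(i,j). if i = j then d i else 0)"

lemma diagonal_matrix_carrier [simp]: "diagonal_matrix n d \<in> carrier_mat n n"
  "dim_row (diagonal_matrix n d) = n" "dim_col (diagonal_matrix n d) = n"
  by (simp_all add: diagonal_matrix_def)

text \<open>Deflation: a reflection \<open>W\<close> moves a unit eigenvector to the first basis
  vector. The conjugated matrix then has a multiple of that vector as its first column and, by
  symmetry, as its first row, so the remaining block is symmetric of smaller size. \<open>W\<close>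
  is its own inverse and transpose, which keeps the composed matrix orthogonal.\<close>

lemma symmetric_mat_diagonalizable:
  fixes A :: "real mat"
  assumes "A \<in> carrier_mat n n" and "transpose_mat A = A"
  shows "\<exists>Q d. Q \<in> carrier_mat n n \<and> transpose_mat Q * Q = 1\<^sub>m n \<and> Q * transpose_mat Q = 1\<^sub>m n \<and>
    A = Q * diagonal_matrix n d * transpose_mat Q"
  using assms
proof (induction n arbitrary: A)
  case 0
  show ?case by (intro exI[of _ "1\<^sub>m 0"] exI[of _ undefined] conjI eq_matI) (use 0 in auto)
next
  case (Suc n)
  note A = Suc.prems(1) and sym = Suc.prems(2)
  let ?N = "Suc n"
  obtain e v where v: "v \<in> carrier_vec ?N" "v \<noteq> 0\<^sub>v ?N" and Av: "A *\<^sub>v v = e \<cdot>\<^sub>v v"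
    using symmetric_mat_real_eigenvalue[OF A sym] A unfolding eigenvalue_def eigenvector_def by auto
  define s where "s = sqrt (v \<bullet> v)"
  have "v \<bullet> v > 0"
  proof -
    obtain i where "i < ?N" "v $ i \<noteq> 0" using v by (metis carrier_vecD eq_vecI index_zero_vec)
    then show ?thesis using v unfolding scalar_prod_def
      by (intro sum_pos2[of _ i]) (auto simp: zero_less_mult_iff linorder_neq_iff)
  qed
  then have s: "s > 0" "s * s = v \<bullet> v" by (auto simp: s_def)
  define x where "x = (1 / s) \<cdot>\<^sub>v v"
  have x: "x \<in> carrier_vec ?N" using v by (simp add: x_def)
  have xx: "x \<bullet> x = 1" using v s by (simp add: x_def flip: s(2))
  have Ax: "A *\<^sub>v x = e \<cdot>\<^sub>v x"
    using v A Av by (simp add: x_def mult_mat_vec smult_smult_assoc mult.commute)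
  obtain W where W: "W \<in> carrier_mat ?N ?N" and Wsym: "transpose_mat W = W"
    and WW: "W * W = 1\<^sub>m ?N" and Wx: "W *\<^sub>v x = unit_vec ?N 0"
    using householder_mat[OF x xx] by blast
  define A' where "A' = W * A * W"
  have A': "A' \<in> carrier_mat ?N ?N" using A W by (simp add: A'_def)
  have A'sym: "transpose_mat A' = A'"
    using A W by (simp add: A'_def transpose_mult[of _ ?N ?N _ ?N] Wsym sym assoc_mult_mat[of _ ?N ?N _ ?N _ ?N])
  have WA'W: "W * A' * W = A"
  proof -
    have "W * A' * W = (W * W) * A * (W * W)"
      using A W by (simp add: A'_def assoc_mult_mat[of _ ?N ?N _ ?N _ ?N])
    then show ?thesis using A WW by simp
  qed
  have "A' *\<^sub>v unit_vec ?N 0 = W *\<^sub>v (A *\<^sub>v ((W * W) *\<^sub>v x))"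
    using A W x by (simp add: A'_def Wx assoc_mult_mat_vec[of _ ?N ?N _ ?N])
  also have "\<dots> = e \<cdot>\<^sub>v unit_vec ?N 0"
    using x W by (simp add: WW Ax mult_mat_vec[OF W] Wx)
  finally have A'e: "A' *\<^sub>v unit_vec ?N 0 = e \<cdot>\<^sub>v unit_vec ?N 0" .
  have A'0: "A' $$ (i,0) = (if i = 0 then e else 0)" if "i < ?N" for i
    using arg_cong[OF A'e, of "\<lambda>v. v $ i"] that A' by simp
  have A'0': "A' $$ (0,i) = (if i = 0 then e else 0)" if "i < ?N" for i
    using arg_cong[OF A'sym, of "\<lambda>B. B $$ (i,0)"] that A' A'0[OF that] by simp
  define A3 where "A3 = Matrix.mat n n (\<lambda>(i,j). A' $$ (Suc i, Suc j))"
  have A3: "A3 \<in> carrier_mat n n" by (simp add: A3_def)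
  have "transpose_mat A3 = A3"
  proof (rule eq_matI)
    fix i j assume "i < dim_row A3" "j < dim_col A3"
    then show "transpose_mat A3 $$ (i,j) = A3 $$ (i,j)"
      using arg_cong[OF A'sym, of "\<lambda>B. B $$ (Suc i,Suc j)"] A' by (simp add: A3_def)
  qed (auto simp: A3_def)
  from Suc.IH[OF A3 this] obtain Q3 d3 where Q3: "Q3 \<in> carrier_mat n n"
    and Q3o: "transpose_mat Q3 * Q3 = 1\<^sub>m n" "Q3 * transpose_mat Q3 = 1\<^sub>m n"
    and A3eq: "A3 = Q3 * diagonal_matrix n d3 * transpose_mat Q3" by blast
  define d where "d i = (case i of 0 \<Rightarrow> e | Suc j \<Rightarrow> d3 j)" for i
  let ?E = "Matrix.mat 1 1 (\<lambda>_. e)"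
  let ?Q4 = "four_block_mat (1\<^sub>m 1) (0\<^sub>m 1 n) (0\<^sub>m n 1) Q3"
  have Q4: "?Q4 \<in> carrier_mat ?N ?N" using Q3 by (auto intro!: carrier_matI)
  have Q4t: "transpose_mat ?Q4 = four_block_mat (1\<^sub>m 1) (0\<^sub>m 1 n) (0\<^sub>m n 1) (transpose_mat Q3)"
    by (subst transpose_four_block_mat[of _ 1 1 _ n _ n]) (use Q3 in auto)
  have D: "diagonal_matrix ?N d = four_block_mat ?E (0\<^sub>m 1 n) (0\<^sub>m n 1) (diagonal_matrix n d3)"
    by (rule eq_matI) (auto simp: diagonal_matrix_def d_def split: nat.split)
  have A'b: "A' = four_block_mat ?E (0\<^sub>m 1 n) (0\<^sub>m n 1) A3"
    using A' by (intro eq_matI) (auto simp: A3_def A'0 A'0')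
  have Q4D: "?Q4 * diagonal_matrix ?N d = four_block_mat ?E (0\<^sub>m 1 n) (0\<^sub>m n 1) (Q3 * diagonal_matrix n d3)"
    unfolding D by (subst mult_four_block_mat[of _ 1 1 _ n _ n]) (use Q3 in auto)
  have "?Q4 * diagonal_matrix ?N d * transpose_mat ?Q4 = A'"
    unfolding Q4D Q4t A'b A3eq by (subst mult_four_block_mat[of _ 1 1 _ n _ n]) (use Q3 in auto)
  note A'eq = this[symmetric]
  have Q4o: "transpose_mat ?Q4 * ?Q4 = 1\<^sub>m ?N" "?Q4 * transpose_mat ?Q4 = 1\<^sub>m ?N"
    unfolding Q4t by (subst mult_four_block_mat[of _ 1 1 _ n _ n _ _ 1 _ n]; use Q3 Q3o in simp)+
  define Q4 where "Q4 = ?Q4"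
  note Q4 = Q4[folded Q4_def] and A'eq = A'eq[folded Q4_def] and Q4o = Q4o[folded Q4_def]
  define Q where "Q = W * Q4"
  have Q: "Q \<in> carrier_mat ?N ?N" using W Q4 by (simp add: Q_def)
  have Qt: "transpose_mat Q = transpose_mat Q4 * W"
    using W Q4 by (simp add: Q_def transpose_mult[of _ ?N ?N _ ?N] Wsym)
  have "transpose_mat Q * Q = transpose_mat Q4 * ((W * W) * Q4)"
    unfolding Qt unfolding Q_def using W Q4 by (simp add: assoc_mult_mat[of _ ?N ?N _ ?N _ ?N])
  then have 1: "transpose_mat Q * Q = 1\<^sub>m ?N" using WW Q4 Q4o by simp
  have "Q * transpose_mat Q = W * ((Q4 * transpose_mat Q4) * W)"
    unfolding Qt unfolding Q_def using W Q4 by (simp add: assoc_mult_mat[of _ ?N ?N _ ?N _ ?N])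
  then have 2: "Q * transpose_mat Q = 1\<^sub>m ?N" using WW W Q4o by simp
  have "Q * diagonal_matrix ?N d * transpose_mat Q = W * A' * W"
    unfolding Qt unfolding Q_def A'eq using W Q4 by (simp add: assoc_mult_mat[of _ ?N ?N _ ?N _ ?N] mult_carrier_mat[of _ ?N ?N _ ?N])
  then show ?case using Q 1 2 WA'W by metis
qed

text \<open>The inverse is Q diag(1/d) Q^T for an orthogonal diagonalization. The same
  \<open>d\<close> is described both as the spectrum, for the event on the smallest eigenvalue, and
  as the multiset of roots, for the event on the ordered eigenvalues; hence the bound
  \<open>c\<close> is quantified after \<open>d\<close> is obtained.\<close>

lemma symmetric_mat_inverse:
  fixes A :: "real mat"
  assumes A: "A \<in> carrier_mat n n" and sym: "transpose_mat A = A"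
  obtains d where "spectrum A = d ` {..<n}" "proots (char_poly A) = mset (map d [0..<n])"
    "\<And>c. c > 0 \<Longrightarrow> (\<And>i. i < n \<Longrightarrow> d i > c) \<Longrightarrow> \<exists>B \<in> carrier_mat n n. A * B = 1\<^sub>m n \<and> B * A = 1\<^sub>m n \<and>
      (\<Sum>i<n. B $$ (i,i)) = (\<Sum>i<n. 1 / d i) \<and>
      (\<forall>x\<in>carrier_vec n. (B *\<^sub>v x) \<bullet> (B *\<^sub>v x) \<le> (x \<bullet> x) / c\<^sup>2)"
proof -
  obtain Q d where Q: "Q \<in> carrier_mat n n" and QQ: "transpose_mat Q * Q = 1\<^sub>m n" "Q * transpose_mat Q = 1\<^sub>m n"
    and AQ: "A = Q * diagonal_matrix n d * transpose_mat Q"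
    using symmetric_mat_diagonalizable[OF A sym] by blast
  have "similar_mat A (diagonal_matrix n d)"
    unfolding similar_mat_def using QQ AQ Q A
    by (intro exI[of _ Q] exI[of _ "transpose_mat Q"] similar_mat_witI[of _ _ n]) auto
  then have "char_poly A = char_poly (diagonal_matrix n d)" by (rule char_poly_similar)
  also have "\<dots> = (\<Prod>a\<leftarrow>diag_mat (diagonal_matrix n d). [:- a, 1:])"
    by (rule char_poly_upper_triangular[of _ n]) (auto simp: diagonal_matrix_def)
  also have "diag_mat (diagonal_matrix n d) = map d [0..<n]"
    by (auto simp: diag_mat_def diagonal_matrix_def)
  finally have cp: "char_poly A = (\<Prod>a\<leftarrow>map d [0..<n]. [:- a, 1:])" .
  have pr: "proots (\<Prod>a\<leftarrow>xs. [:- a, 1:]) = mset xs" for xs :: "real list"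
  proof (induct xs)
    case (Cons x xs)
    have "monic (\<Prod>a\<leftarrow>xs. [:- a, 1:])" by (rule monic_prod_list) auto
    then have "(\<Prod>a\<leftarrow>xs. [:- a, 1:]) \<noteq> 0" by auto
    then have "proots ([:- x, 1:] * (\<Prod>a\<leftarrow>xs. [:- a, 1:])) = proots [:-x, 1:] + mset xs"
      using Cons by (subst proots_mult) auto
    then show ?case by simp
  qed simp
  show ?thesis
  proof (rule that)
    show "proots (char_poly A) = mset (map d [0..<n])" unfolding cp pr ..
    show "spectrum A = d ` {..<n}"
      unfolding spectrum_root_char_poly[OF A] cp by (auto simp: poly_prod_list prod_list_zero_iff)
  next
    fix c :: real assume c: "c > 0" and dc: "\<And>i. i < n \<Longrightarrow> d i > c"
    define E where "E = diagonal_matrix n (\<lambda>i. 1 / d i)"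
    have E: "E \<in> carrier_mat n n" by (simp add: E_def)
    have delta: "(\<Sum>k<n. (if i = k then f k else 0) * g k) = f i * g i" if "i < n"
      for i and f g :: "nat \<Rightarrow> real"
    proof -
      have "(\<Sum>k<n. (if i = k then f k else 0) * g k) = (\<Sum>k<n. if i = k then f k * g k else 0)"
        by (rule sum.cong) auto
      then show ?thesis using that by simp
    qed
    have DE: "diagonal_matrix n f * diagonal_matrix n g = diagonal_matrix n (\<lambda>i. f i * g i)" for f g
      by (rule eq_matI) (auto simp: diagonal_matrix_def scalar_prod_def atLeast0LessThan delta)
    have cong: "diagonal_matrix n f = 1\<^sub>m n" if "\<And>i. i < n \<Longrightarrow> f i = 1" for f
      using that by (intro eq_matI) (auto simp: diagonal_matrix_def)
    have ED: "diagonal_matrix n d * E = 1\<^sub>m n" "E * diagonal_matrix n d = 1\<^sub>m n"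
      unfolding E_def DE using c dc by (intro cong; force)+
    define B where "B = Q * E * transpose_mat Q"
    have B: "B \<in> carrier_mat n n" using Q E by (simp add: B_def)
    note assoc = assoc_mult_mat[of _ n n _ n _ n] mult_carrier_mat[of _ n n _ n]
    have "A * B = Q * (diagonal_matrix n d * ((transpose_mat Q * Q) * (E * transpose_mat Q)))"
      unfolding AQ B_def using Q E by (simp add: assoc)
    also have "\<dots> = Q * ((diagonal_matrix n d * E) * transpose_mat Q)"
      unfolding QQ using Q E by (simp add: assoc)
    finally have AB: "A * B = 1\<^sub>m n" using ED Q QQ by simp
    have BA: "B * A = 1\<^sub>m n" using mat_mult_left_right_inverse[OF A B AB] .
    \<comment> \<open>The diagonal entries of \<open>B\<close> are sums over k of Q(i,k)^2 / d_k.
      Summing over i first leaves the squared norms of the columns of \<open>Q\<close>, which are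
      1.\<close>
    have tr: "(\<Sum>i<n. B $$ (i,i)) = (\<Sum>i<n. 1 / d i)"
    proof -
      have QE: "(Q * E) $$ (i,k) = Q $$ (i,k) / d k" if "i < n" "k < n" for i k
      proof -
        have "(Q * E) $$ (i,k) = (\<Sum>l<n. (if k = l then 1 / d l else 0) * Q $$ (i,l))"
          using Q that by (simp add: E_def diagonal_matrix_def scalar_prod_def atLeast0LessThan)
            (rule sum.cong, auto)
        then show ?thesis using that by (simp only: delta) simp
      qed
      have "B $$ (i,i) = (\<Sum>k<n. Q $$ (i,k) * Q $$ (i,k) / d k)" if "i < n" for i
      proof -
        define F where "F = Q * E"
        have F: "F \<in> carrier_mat n n" "F $$ (i,k) = Q $$ (i,k) / d k" if "k < n" for k
          using QE[OF \<open>i < n\<close> that] Q E by (simp_all add: F_def)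
        then show ?thesis unfolding B_def F_def[symmetric]
          using that Q F(1)[OF that] by (simp add: scalar_prod_def atLeast0LessThan)
      qed
      then have "(\<Sum>i<n. B $$ (i,i)) = (\<Sum>i<n. \<Sum>k<n. Q $$ (i,k) * Q $$ (i,k) / d k)" by simp
      also have "\<dots> = (\<Sum>k<n. (\<Sum>i<n. Q $$ (i,k) * Q $$ (i,k)) / d k)"
        by (subst sum.swap) (simp add: sum_divide_distrib)
      also have "\<dots> = (\<Sum>k<n. 1 / d k)"
      proof (rule sum.cong)
        fix k assume "k \<in> {..<n}"
        then have "(\<Sum>i<n. Q $$ (i,k) * Q $$ (i,k)) = (transpose_mat Q * Q) $$ (k,k)"
          using Q by (simp add: scalar_prod_def atLeast0LessThan)
        then show "(\<Sum>i<n. Q $$ (i,k) * Q $$ (i,k)) / d k = 1 / d k"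
          using QQ \<open>k \<in> {..<n}\<close> by simp
      qed simp
      finally show ?thesis .
    qed
    have iso: "(U *\<^sub>v x) \<bullet> (U *\<^sub>v x) = x \<bullet> x"
      if U: "U \<in> carrier_mat n n" "transpose_mat U * U = 1\<^sub>m n" and x: "x \<in> carrier_vec n" for U :: "real mat" and x
    proof -
      have "(U *\<^sub>v x) \<bullet> (U *\<^sub>v x) = (transpose_mat U *\<^sub>v (U *\<^sub>v x)) \<bullet> x"
        using U x by (subst transpose_vec_mult_scalar[of _ n n]) auto
      also have "transpose_mat U *\<^sub>v (U *\<^sub>v x) = x"
        using U x by (simp flip: assoc_mult_mat_vec[of _ n n _ n])
      finally show ?thesis .
    qed
    have "(B *\<^sub>v x) \<bullet> (B *\<^sub>v x) \<le> (x \<bullet> x) / c\<^sup>2" if x: "x \<in> carrier_vec n" for x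
    proof -
      define y where "y = transpose_mat Q *\<^sub>v x"
      have y: "y \<in> carrier_vec n" using Q x by (simp add: y_def)
      have "B *\<^sub>v x = Q *\<^sub>v (E *\<^sub>v y)"
        unfolding B_def y_def using Q E x by (simp add: assoc_mult_mat_vec[of _ n n _ n])
      then have "(B *\<^sub>v x) \<bullet> (B *\<^sub>v x) = (E *\<^sub>v y) \<bullet> (E *\<^sub>v y)"
        using Q E y QQ iso[of Q "E *\<^sub>v y"] by simp
      also have "\<dots> = (\<Sum>i<n. (y $ i / d i)\<^sup>2)"
      proof -
        have "(E *\<^sub>v y) $ i = y $ i / d i" if "i < n" for i
          using that y delta[OF that, of "\<lambda>k. 1 / d i" "\<lambda>k. y $ k"]
          by (simp add: E_def diagonal_matrix_def scalar_prod_def atLeast0LessThan)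
        then show ?thesis using E y by (simp add: scalar_prod_def atLeast0LessThan power2_eq_square)
      qed
      also have "\<dots> \<le> (\<Sum>i<n. (y $ i)\<^sup>2 / c\<^sup>2)"
      proof (rule sum_mono)
        fix i assume "i \<in> {..<n}"
        then have "c\<^sup>2 \<le> (d i)\<^sup>2" using c dc[of i] by (intro power_mono) auto
        then show "(y $ i / d i)\<^sup>2 \<le> (y $ i)\<^sup>2 / c\<^sup>2"
          using c unfolding power_divide by (intro frac_le) auto
      qed
      also have "\<dots> = (y \<bullet> y) / c\<^sup>2"
        using y by (simp add: scalar_prod_def atLeast0LessThan power2_eq_square sum_divide_distrib)
      also have "y \<bullet> y = x \<bullet> x"
        unfolding y_def using Q x QQ by (intro iso) auto
      finally show ?thesis .
    qed
    then show "\<exists>B \<in> carrier_mat n n. A * B = 1\<^sub>m n \<and> B * A = 1\<^sub>m n \<and>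
      (\<Sum>i<n. B $$ (i,i)) = (\<Sum>i<n. 1 / d i) \<and>
      (\<forall>x\<in>carrier_vec n. (B *\<^sub>v x) \<bullet> (B *\<^sub>v x) \<le> (x \<bullet> x) / c\<^sup>2)"
      using B AB BA tr by blast
  qed
qed

text \<open>Links the inverse occurring in \<open>estimation_error\<close> with Cramer's formula,
  whose measurable dependence on the matrix entries is visible.\<close>

lemma mat_inverse_eq_adj_mat:
  fixes A :: "real mat"
  assumes A: "A \<in> carrier_mat n n" and B: "B \<in> carrier_mat n n" and AB: "A * B = 1\<^sub>m n" and BA: "B * A = 1\<^sub>m n"
  shows "det A \<noteq> 0" "mat_inverse A = Some B" "\<And>i j. i < n \<Longrightarrow> j < n \<Longrightarrow> B $$ (i,j) = adj_mat A $$ (i,j) / det A"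
proof -
  have "det A * det B = 1" using det_mult[OF A B] AB by simp
  then show d: "det A \<noteq> 0" by auto
  obtain C where C: "mat_inverse A = Some C"
    using mat_inverse(1)[OF A, of "()"] AB BA A B by (cases "mat_inverse A") (auto simp: Units_def ring_mat_simps)
  note C' = mat_inverse(2)[OF A C]
  have "C * (A * B) = (C * A) * B"
    using C' A B by (intro assoc_mult_mat[symmetric, of _ n n _ n _ n]) auto
  then have "C = B" using C' B AB by auto
  then show "mat_inverse A = Some B" using C by simp
  have "adj_mat A = B * (A * adj_mat A)"
    using A B BA adj_mat(1)[OF A] by (simp flip: assoc_mult_mat[of _ n n _ n _ n])
  also have "\<dots> = det A \<cdot>\<^sub>m B" unfolding adj_mat(2)[OF A] using B by (simp add: mult_smult_distrib[of _ n n _ n])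
  finally show "B $$ (i,j) = adj_mat A $$ (i,j) / det A" if "i < n" "j < n" for i j
    using that d B by simp
qed

text \<open>Each of the n reciprocal eigenvalues can only be compared with that of the common lower
  bound; this is the origin of the factor n in the polynomial case.\<close>

lemma matrix_min_eigenvalue_gt:
  fixes A :: "real mat"
  assumes A: "A \<in> carrier_mat n n" and sym: "transpose_mat A = A"
    and c: "0 < c" and gt: "matrix_min_eigenvalue A > c"
  shows "\<exists>B. B \<in> carrier_mat n n \<and> A * B = 1\<^sub>m n \<and> B * A = 1\<^sub>m n \<and>
    (\<Sum>i<n. B $$ (i,i)) \<le> real n / c \<and>
    (\<forall>x\<in>carrier_vec n. (B *\<^sub>v x) \<bullet> (B *\<^sub>v x) \<le> (x \<bullet> x) / c\<^sup>2)"
proof -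
  obtain d where sp: "spectrum A = d ` {..<n}" and ex: "\<And>c. c > 0 \<Longrightarrow> (\<And>i. i < n \<Longrightarrow> d i > c) \<Longrightarrow>
      \<exists>B \<in> carrier_mat n n. A * B = 1\<^sub>m n \<and> B * A = 1\<^sub>m n \<and>
      (\<Sum>i<n. B $$ (i,i)) = (\<Sum>i<n. 1 / d i) \<and>
      (\<forall>x\<in>carrier_vec n. (B *\<^sub>v x) \<bullet> (B *\<^sub>v x) \<le> (x \<bullet> x) / c\<^sup>2)"
    by (rule symmetric_mat_inverse[OF A sym]) blast
  have dc: "d i > c" if "i < n" for i
  proof -
    have "Min (spectrum A) \<le> d i" unfolding sp using that by (intro Min_le) auto
    then show ?thesis using gt unfolding matrix_min_eigenvalue_def by simp
  qed
  have "(\<Sum>i<n. 1 / d i) \<le> (\<Sum>i<n. 1 / c)"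
    using dc c by (intro sum_mono) (auto simp: frac_le less_imp_le)
  then have "(\<Sum>i<n. 1 / d i) \<le> real n / c" by simp
  with ex[OF c dc] show ?thesis by force
qed

text \<open>The diagonal entries \<open>d\<close> are unordered, but they form the same multiset as
  the sorted eigenvalues, so the sum of reciprocals may be taken over the sorted list and compared
  term by term. The list position i carries eigenvalue number \<open>Suc i\<close>. The norm bound
  sees only the smallest threshold \<open>c n\<close>.\<close>

lemma matrix_eigenvalue_gt:
  fixes A :: "real mat"
  assumes A: "A \<in> carrier_mat n n" and sym: "transpose_mat A = A"
    and c: "\<And>k. k \<in> {1..n} \<Longrightarrow> 0 < c n \<and> c n \<le> c k"
    and gt: "\<And>k. k \<in> {1..n} \<Longrightarrow> matrix_eigenvalue A k > c k" and n: "n \<ge> 1"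
  shows "\<exists>B. B \<in> carrier_mat n n \<and> A * B = 1\<^sub>m n \<and> B * A = 1\<^sub>m n \<and>
    (\<Sum>i<n. B $$ (i,i)) \<le> (\<Sum>k=1..n. 1 / c k) \<and>
    (\<forall>x\<in>carrier_vec n. (B *\<^sub>v x) \<bullet> (B *\<^sub>v x) \<le> (x \<bullet> x) / (c n)\<^sup>2)"
proof -
  have c0: "0 < c n" using c[of n] n by simp
  obtain d where pr: "proots (char_poly A) = mset (map d [0..<n])" and ex: "\<And>c. c > 0 \<Longrightarrow> (\<And>i. i < n \<Longrightarrow> d i > c) \<Longrightarrow>
      \<exists>B \<in> carrier_mat n n. A * B = 1\<^sub>m n \<and> B * A = 1\<^sub>m n \<and>
      (\<Sum>i<n. B $$ (i,i)) = (\<Sum>i<n. 1 / d i) \<and>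
      (\<forall>x\<in>carrier_vec n. (B *\<^sub>v x) \<bullet> (B *\<^sub>v x) \<le> (x \<bullet> x) / c\<^sup>2)"
    by (rule symmetric_mat_inverse[OF A sym]) blast
  define xs where "xs = rev (sorted_list_of_multiset (proots (char_poly A)))"
  have ms: "mset xs = mset (map d [0..<n])" by (simp add: xs_def pr)
  then have len: "length xs = n" using mset_eq_length by fastforce
  have xs: "xs ! i > c (Suc i)" if "i < n" for i
    using gt[of "Suc i"] that by (simp add: matrix_eigenvalue_def xs_def)
  have dc: "d i > c n" if "i < n" for i
  proof -
    have "d i \<in> set xs" using that mset_eq_setD[OF ms] by simp
    then obtain j where "j < n" "d i = xs ! j" using len by (auto simp: in_set_conv_nth)
    then show ?thesis using xs[of j] c[of "Suc j"] by simp
  qed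
  have "(\<Sum>i<n. 1 / d i) = sum_list (map (\<lambda>a. 1 / a) (map d [0..<n]))"
    by (simp add: interv_sum_list_conv_sum_set_nat atLeast0LessThan comp_def)
  also have "\<dots> = sum_list (map (\<lambda>a. 1 / a) xs)"
    by (metis ms mset_map sum_mset_sum_list)
  also have "\<dots> = (\<Sum>i<n. 1 / xs ! i)"
    by (simp add: sum_list_sum_nth len atLeast0LessThan)
  also have "\<dots> \<le> (\<Sum>i<n. 1 / c (Suc i))"
  proof (rule sum_mono)
    fix i assume "i \<in> {..<n}"
    then show "1 / xs ! i \<le> 1 / c (Suc i)" using xs[of i] c[of "Suc i"]
      by (intro frac_le) auto
  qed
  also have "\<dots> = (\<Sum>k=1..n. 1 / c k)"
    by (simp add: sum.atLeast1_atMost_eq)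
  finally have "(\<Sum>i<n. 1 / d i) \<le> (\<Sum>k=1..n. 1 / c k)" .
  with ex[OF c0 dc] show ?thesis by force
qed

section \<open>Inputs and noise of the sample\<close>

text \<open>Independence passes from generating families to the generated sigma-algebras only if the
  families are closed under intersection.\<close>

lemma Int_stable_vimages: "Int_stable {f -` A \<inter> S | A. A \<in> sets N}"
proof (rule Int_stableI)
  fix a b assume "a \<in> {f -` A \<inter> S | A. A \<in> sets N}" "b \<in> {f -` A \<inter> S | A. A \<in> sets N}"
  then obtain A B where "A \<in> sets N" "B \<in> sets N" "a = f -` A \<inter> S" "b = f -` B \<inter> S" by blast
  then show "a \<inter> b \<in> {f -` A \<inter> S | A. A \<in> sets N}"
    by (intro CollectI exI[of _ "A \<inter> B"]) auto
qed

lemma measurable_sigma_vimages: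
  assumes "\<And>x. x \<in> S \<Longrightarrow> f x \<in> space N" and G: "{f -` A \<inter> S | A. A \<in> sets N} \<subseteq> G" "G \<subseteq> Pow S"
  shows "f \<in> sigma S G \<rightarrow>\<^sub>M N"
proof (rule measurableI)
  fix A assume "A \<in> sets N"
  then have "f -` A \<inter> S \<in> G" using G by blast
  then show "f -` A \<inter> space (sigma S G) \<in> sets (sigma S G)" using G by simp
qed (use assms in auto)

locale noisy_sample = prob_space P
  for P :: "'w measure" +
  fixes u :: "'w \<Rightarrow> 'x::banach" and \<epsilon> :: "'y::{real_inner, polish_space} \<Rightarrow> 'w \<Rightarrow> real"
    and M :: nat and us :: "nat \<Rightarrow> 'w \<Rightarrow> 'x" and \<epsilon>s :: "nat \<Rightarrow> 'y \<Rightarrow> 'w \<Rightarrow> real"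
  assumes u_measurable: "u \<in> P \<rightarrow>\<^sub>M borel" and noise: "linear_noise P \<epsilon>" and indep: "noise_indep P u \<epsilon>"
    and sample: "iid_copies P u \<epsilon> M us \<epsilon>s" and M: "M \<ge> 1"
begin

definition observation :: "nat \<Rightarrow> 'w \<Rightarrow> 'x \<times> ('y \<Rightarrow> real)" where
  "observation m \<omega> = (us m \<omega>, \<lambda>y. \<epsilon>s m y \<omega>)"

definition prototype :: "'w \<Rightarrow> 'x \<times> ('y \<Rightarrow> real)" where
  "prototype \<omega> = (u \<omega>, \<lambda>y. \<epsilon> y \<omega>)"

text \<open>Measurability with respect to this algebra means depending on the inputs alone; it marks
  the quantities that would be constant after conditioning on the inputs.\<close>

definition input_algebra :: "'w measure" where
  "input_algebra = sigma (space P) (\<Union>m\<in>{1..M}. {us m -` A \<inter> space P | A. A \<in> sets borel})"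

definition noise_algebra :: "'w measure" where
  "noise_algebra = sigma (space P)
    (\<Union>m\<in>{1..M}. {(\<lambda>\<omega> y. \<epsilon>s m y \<omega>) -` B \<inter> space P | B. B \<in> sets noise_path_algebra})"

lemma noise_L2: "\<epsilon> y \<in> L2 P"
  using noise by (simp add: linear_noise_def)

lemma prototype_measurable: "prototype \<in> P \<rightarrow>\<^sub>M sample_algebra"
  unfolding prototype_def using u_measurable L2D(1)[OF noise_L2]
  by (intro measurable_Pair measurable_PiM_single') auto

lemma observation_indep: "indep_vars (\<lambda>_. sample_algebra) observation {1..M}"
  using sample by (simp add: iid_copies_def observation_def[abs_def])

lemma observation_measurable: "m \<in> {1..M} \<Longrightarrow> observation m \<in> P \<rightarrow>\<^sub>M sample_algebra"
  using observation_indep by (simp add: indep_vars_def)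

lemma observation_distr: "m \<in> {1..M} \<Longrightarrow> distr P sample_algebra (observation m) = distr P sample_algebra prototype"
  using sample by (simp add: iid_copies_def observation_def[abs_def] prototype_def[abs_def])

lemma fst_observation: "fst \<circ> observation m = us m"
  by (simp add: fun_eq_iff observation_def)

lemma snd_observation: "snd \<circ> observation m = (\<lambda>\<omega> y. \<epsilon>s m y \<omega>)"
  by (simp add: fun_eq_iff observation_def)

lemma us_measurable: "m \<in> {1..M} \<Longrightarrow> us m \<in> P \<rightarrow>\<^sub>M borel"
  using measurable_comp[OF observation_measurable measurable_fst] by (simp add: fst_observation)

lemma noise_path_measurable: "m \<in> {1..M} \<Longrightarrow> (\<lambda>\<omega> y. \<epsilon>s m y \<omega>) \<in> P \<rightarrow>\<^sub>M noise_path_algebra"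
  using measurable_comp[OF observation_measurable measurable_snd] by (simp add: snd_observation)

lemma observation_integral:
  fixes g :: "'x \<times> ('y \<Rightarrow> real) \<Rightarrow> real"
  assumes m: "m \<in> {1..M}" and g: "g \<in> sample_algebra \<rightarrow>\<^sub>M borel"
  shows "integrable P (\<lambda>\<omega>. g (observation m \<omega>)) \<longleftrightarrow> integrable P (\<lambda>\<omega>. g (prototype \<omega>))"
    and "(\<integral>\<omega>. g (observation m \<omega>) \<partial>P) = (\<integral>\<omega>. g (prototype \<omega>) \<partial>P)"
  using integrable_distr_eq[OF observation_measurable[OF m] g] integrable_distr_eq[OF prototype_measurable g]
    integral_distr[OF observation_measurable[OF m] g] integral_distr[OF prototype_measurable g]
    observation_distr[OF m] by auto

lemma observation_integral_input:
  fixes g :: "'x \<Rightarrow> real"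
  assumes m: "m \<in> {1..M}" and g: "g \<in> borel \<rightarrow>\<^sub>M borel"
  shows "integrable P (\<lambda>\<omega>. g (us m \<omega>)) \<longleftrightarrow> integrable P (\<lambda>\<omega>. g (u \<omega>))"
    and "(\<integral>\<omega>. g (us m \<omega>) \<partial>P) = (\<integral>\<omega>. g (u \<omega>) \<partial>P)"
proof -
  have "(\<lambda>z. g (fst z)) \<in> sample_algebra \<rightarrow>\<^sub>M borel" by (rule measurable_compose[OF measurable_fst g])
  from observation_integral[OF m this]
  show "integrable P (\<lambda>\<omega>. g (us m \<omega>)) \<longleftrightarrow> integrable P (\<lambda>\<omega>. g (u \<omega>))"
    and "(\<integral>\<omega>. g (us m \<omega>) \<partial>P) = (\<integral>\<omega>. g (u \<omega>) \<partial>P)"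
    by (simp_all add: observation_def prototype_def)
qed

lemma noise_value_measurable: "(\<lambda>z. snd z y) \<in> (sample_algebra :: ('x \<times> ('y \<Rightarrow> real)) measure) \<rightarrow>\<^sub>M borel"
  by (rule measurable_compose[OF measurable_snd measurable_component_singleton]) simp

text \<open>Two evaluation points are allowed so that covariances are covered; means and second
  moments arise from functions \<open>g\<close> that ignore one argument.\<close>

lemma observation_integral_noise:
  assumes m: "m \<in> {1..M}" and g: "case_prod g \<in> borel \<Otimes>\<^sub>M borel \<rightarrow>\<^sub>M borel"
  shows "integrable P (\<lambda>\<omega>. g (\<epsilon>s m y \<omega>) (\<epsilon>s m z \<omega>) :: real) \<longleftrightarrow> integrable P (\<lambda>\<omega>. g (\<epsilon> y \<omega>) (\<epsilon> z \<omega>))"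
    and "(\<integral>\<omega>. g (\<epsilon>s m y \<omega>) (\<epsilon>s m z \<omega>) \<partial>P) = (\<integral>\<omega>. g (\<epsilon> y \<omega>) (\<epsilon> z \<omega>) \<partial>P)"
proof -
  have "(\<lambda>v. case_prod g (snd v y, snd v z)) \<in> (sample_algebra :: ('x \<times> ('y \<Rightarrow> real)) measure) \<rightarrow>\<^sub>M borel"
    by (rule measurable_compose[OF measurable_Pair g]) (rule noise_value_measurable)+
  from observation_integral[OF m this]
  show "integrable P (\<lambda>\<omega>. g (\<epsilon>s m y \<omega>) (\<epsilon>s m z \<omega>)) \<longleftrightarrow> integrable P (\<lambda>\<omega>. g (\<epsilon> y \<omega>) (\<epsilon> z \<omega>))"
    and "(\<integral>\<omega>. g (\<epsilon>s m y \<omega>) (\<epsilon>s m z \<omega>) \<partial>P) = (\<integral>\<omega>. g (\<epsilon> y \<omega>) (\<epsilon> z \<omega>) \<partial>P)"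
    by (simp_all add: observation_def prototype_def)
qed

text \<open>Independence of input and noise is assumed for the prototype. It is a property of the
  joint law on rectangles \<open>A \<times> B\<close>, with the marginals as rectangles having one
  full side, so equality of the laws transfers it to each sample.\<close>

lemma observation_rectangle:
  assumes m: "m \<in> {1..M}" and A: "A \<in> sets borel" and B: "B \<in> sets noise_path_algebra"
  shows "prob (us m -` A \<inter> space P \<inter> ((\<lambda>\<omega> y. \<epsilon>s m y \<omega>) -` B \<inter> space P)) =
    prob (us m -` A \<inter> space P) * prob ((\<lambda>\<omega> y. \<epsilon>s m y \<omega>) -` B \<inter> space P)"
proof -
  have law: "prob (observation m -` C \<inter> space P) = prob (prototype -` C \<inter> space P)"
    if "C \<in> sets sample_algebra" for C
    using measure_distr[OF observation_measurable[OF m] that] measure_distr[OF prototype_measurable that]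
      observation_distr[OF m] by simp
  have top: "space noise_path_algebra = (UNIV :: ('y \<Rightarrow> real) set)" by (simp add: space_PiM)
  have rect: "C \<times> E \<in> sets sample_algebra" if "C \<in> sets borel" "E \<in> sets noise_path_algebra" for C :: "'x set" and E
    using that by auto
  have U: "(UNIV :: ('y \<Rightarrow> real) set) \<in> sets noise_path_algebra"
    using sets.top[of "noise_path_algebra :: ('y \<Rightarrow> real) measure"] unfolding top .
  have "indep_set (sets (vimage_algebra (space P) u borel))
     (sets (vimage_algebra (space P) (\<lambda>\<omega> y. \<epsilon> y \<omega>) noise_path_algebra))"
    using indep by (simp add: noise_indep_def)
  then have "prob (u -` A \<inter> space P \<inter> ((\<lambda>\<omega> y. \<epsilon> y \<omega>) -` B \<inter> space P)) =
    prob (u -` A \<inter> space P) * prob ((\<lambda>\<omega> y. \<epsilon> y \<omega>) -` B \<inter> space P)"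
    by (rule indep_setD) (intro in_vimage_algebra A B)+
  moreover have "u -` A \<inter> space P \<inter> ((\<lambda>\<omega> y. \<epsilon> y \<omega>) -` B \<inter> space P) = prototype -` (A \<times> B) \<inter> space P"
    "u -` A \<inter> space P = prototype -` (A \<times> UNIV) \<inter> space P"
    "(\<lambda>\<omega> y. \<epsilon> y \<omega>) -` B \<inter> space P = prototype -` (UNIV \<times> B) \<inter> space P"
    by (auto simp: prototype_def)
  moreover have "us m -` A \<inter> space P \<inter> ((\<lambda>\<omega> y. \<epsilon>s m y \<omega>) -` B \<inter> space P) = observation m -` (A \<times> B) \<inter> space P"
    "us m -` A \<inter> space P = observation m -` (A \<times> UNIV) \<inter> space P"
    "(\<lambda>\<omega> y. \<epsilon>s m y \<omega>) -` B \<inter> space P = observation m -` (UNIV \<times> B) \<inter> space P"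
    by (auto simp: observation_def)
  ultimately show ?thesis
    using law[OF rect[OF A B]] law[OF rect[OF A U]] law[OF rect[OF _ B, of UNIV]] by simp
qed

text \<open>The pairs are independent of each other and each pair is independent inside. Together
  this makes the 2M families indexed by \<open>(m, b)\<close>, with \<open>b\<close> telling inputs
  from noises, jointly independent; they are then grouped by \<open>b\<close> instead of
  \<open>m\<close>.\<close>

lemma indep_input_noise: "indep_set (sets input_algebra) (sets noise_algebra)"
proof -
  define F where "F = (\<lambda>(m, b). if b then {us m -` A \<inter> space P | A. A \<in> sets borel}
    else {(\<lambda>\<omega> y. \<epsilon>s m y \<omega>) -` B \<inter> space P | B. B \<in> sets noise_path_algebra})"
  let ?I = "{1..M} \<times> (UNIV :: bool set)"
  have top: "(UNIV :: ('y \<Rightarrow> real) set) \<in> sets noise_path_algebra"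
    using sets.top[of "noise_path_algebra :: ('y \<Rightarrow> real) measure"] by (simp add: space_PiM)
  have events: "F i \<subseteq> events" if "i \<in> ?I" for i
    using that us_measurable noise_path_measurable
    by (auto simp: F_def split: if_splits intro: measurable_sets)
  have space_F: "space P \<in> F i" for i
    unfolding F_def using top by (cases i) (auto intro!: exI[of _ UNIV])
  have "indep_sets F ?I"
  \<comment> \<open>Every family contains the whole space, so the product rule for intersections
    over the full index set already implies it for all subsets of indices.\<close>
  proof (subst indep_sets_finite)
    show "?I \<noteq> {}" "finite ?I" using M by auto
    show "\<forall>A\<in>Pi ?I F. prob (\<Inter>j\<in>?I. A j) = (\<Prod>j\<in>?I. prob (A j))"
    proof
      fix E assume E: "E \<in> Pi ?I F"
      have "\<forall>m\<in>{1..M}. \<exists>A. A \<in> sets borel \<and> E (m, True) = us m -` A \<inter> space P"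
      proof
        fix m assume "m \<in> {1..M}"
        then have "E (m, True) \<in> F (m, True)" using E by auto
        then show "\<exists>A. A \<in> sets borel \<and> E (m, True) = us m -` A \<inter> space P" by (auto simp: F_def)
      qed
      then obtain A where A: "\<And>m. m \<in> {1..M} \<Longrightarrow> A m \<in> sets borel"
        "\<And>m. m \<in> {1..M} \<Longrightarrow> E (m, True) = us m -` A m \<inter> space P" by metis
      have "\<forall>m\<in>{1..M}. \<exists>B. B \<in> sets noise_path_algebra \<and> E (m, False) = (\<lambda>\<omega> y. \<epsilon>s m y \<omega>) -` B \<inter> space P"
      proof
        fix m assume "m \<in> {1..M}"
        then have "E (m, False) \<in> F (m, False)" using E by auto
        then show "\<exists>B. B \<in> sets noise_path_algebra \<and> E (m, False) = (\<lambda>\<omega> y. \<epsilon>s m y \<omega>) -` B \<inter> space P"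
          by (auto simp: F_def)
      qed
      then obtain B where B: "\<And>m. m \<in> {1..M} \<Longrightarrow> B m \<in> sets noise_path_algebra"
        "\<And>m. m \<in> {1..M} \<Longrightarrow> E (m, False) = (\<lambda>\<omega> y. \<epsilon>s m y \<omega>) -` B m \<inter> space P" by metis
      have "(\<Inter>j\<in>?I. E j) = (\<Inter>m\<in>{1..M}. E (m, True) \<inter> E (m, False))"
        by (auto simp: UNIV_bool)
      also have "\<dots> = (\<Inter>m\<in>{1..M}. observation m -` (A m \<times> B m) \<inter> space P)"
        by (intro INF_cong) (auto simp: A B observation_def)
      also have "prob \<dots> = (\<Prod>m\<in>{1..M}. prob (observation m -` (A m \<times> B m) \<inter> space P))"
        using M A B by (intro indep_varsD_finite[OF observation_indep]) auto
      also have "\<dots> = (\<Prod>m\<in>{1..M}. prob (E (m, True)) * prob (E (m, False)))"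
      proof (rule prod.cong)
        fix m assume m: "m \<in> {1..M}"
        have "observation m -` (A m \<times> B m) \<inter> space P = E (m, True) \<inter> E (m, False)"
          using A(2) B(2) m by (auto simp: observation_def)
        then show "prob (observation m -` (A m \<times> B m) \<inter> space P) = prob (E (m, True)) * prob (E (m, False))"
          using observation_rectangle[OF m A(1)[OF m] B(1)[OF m]] A(2) B(2) m by simp
      qed simp
      also have "\<dots> = (\<Prod>m\<in>{1..M}. \<Prod>b\<in>UNIV. prob (E (m, b)))"
        by (simp add: UNIV_bool mult.commute)
      also have "\<dots> = (\<Prod>j\<in>?I. prob (E j))"
        by (simp add: prod.cartesian_product)
      finally show "prob (\<Inter>j\<in>?I. E j) = (\<Prod>j\<in>?I. prob (E j))" .
    qed
  qed (use events space_F in auto)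
  moreover have "Int_stable (F i)" for i
    by (cases i) (auto simp: F_def Int_stable_vimages)
  ultimately have "indep_sets (\<lambda>b. sigma_sets (space P) (\<Union>i\<in>{1..M} \<times> {b}. F i)) (UNIV :: bool set)"
    by (intro indep_sets_collect_sigma) (auto simp: disjoint_family_on_def intro: indep_sets_mono_index[rotated])
  moreover have "(\<lambda>b. sigma_sets (space P) (\<Union>i\<in>{1..M} \<times> {b}. F i)) = case_bool (sets input_algebra) (sets noise_algebra)"
  proof
    fix b
    have "(\<Union>i\<in>{1..M} \<times> {b}. F i) = (\<Union>m\<in>{1..M}. F (m, b))" by auto
    then show "sigma_sets (space P) (\<Union>i\<in>{1..M} \<times> {b}. F i) = case_bool (sets input_algebra) (sets noise_algebra) b"
      unfolding input_algebra_def noise_algebra_def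
      by (cases b) (auto simp: F_def intro!: sets_measure_of[symmetric])
  qed
  ultimately show ?thesis by (simp add: indep_set_def)
qed

lemma space_algebras [simp]: "space input_algebra = space P" "space noise_algebra = space P"
  unfolding input_algebra_def noise_algebra_def by (auto intro!: space_measure_of)

lemma us_input_measurable: "m \<in> {1..M} \<Longrightarrow> us m \<in> input_algebra \<rightarrow>\<^sub>M borel"
  unfolding input_algebra_def by (rule measurable_sigma_vimages) (simp, blast, auto)

lemma sample_noise_measurable: "m \<in> {1..M} \<Longrightarrow> \<epsilon>s m y \<in> noise_algebra \<rightarrow>\<^sub>M borel"
proof -
  assume m: "m \<in> {1..M}"
  have "(\<lambda>\<omega> y. \<epsilon>s m y \<omega>) \<in> noise_algebra \<rightarrow>\<^sub>M noise_path_algebra"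
    unfolding noise_algebra_def using m by (intro measurable_sigma_vimages) (simp add: space_PiM, blast, auto)
  from measurable_compose[OF this measurable_component_singleton[of y UNIV]] show ?thesis by simp
qed

lemma input_measurableD: "f \<in> input_algebra \<rightarrow>\<^sub>M N \<Longrightarrow> f \<in> P \<rightarrow>\<^sub>M N"
  using indep_input_noise unfolding indep_sets2_eq by (auto simp: measurable_def)

lemma noise_measurableD: "f \<in> noise_algebra \<rightarrow>\<^sub>M N \<Longrightarrow> f \<in> P \<rightarrow>\<^sub>M N"
  using indep_input_noise unfolding indep_sets2_eq by (auto simp: measurable_def)

text \<open>The sigma-algebras generated by \<open>f\<close> and \<open>g\<close> lie in the two
  independent algebras. This factorization is the form in which conditioning on the inputs
  enters.\<close>

lemma input_noise_product:
  fixes f g :: "'w \<Rightarrow> real"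
  assumes f: "f \<in> borel_measurable input_algebra" "integrable P f"
    and g: "g \<in> borel_measurable noise_algebra" "integrable P g"
  shows "integrable P (\<lambda>\<omega>. f \<omega> * g \<omega>)"
    and "(\<integral>\<omega>. f \<omega> * g \<omega> \<partial>P) = (\<integral>\<omega>. f \<omega> \<partial>P) * (\<integral>\<omega>. g \<omega> \<partial>P)"
proof -
  have sub: "sigma_sets (space P) {h -` A \<inter> space P | A. A \<in> sets borel} \<subseteq> sets N"
    if "h \<in> borel_measurable N" "space N = space P" for h :: "'w \<Rightarrow> real" and N
    using sets.sigma_sets_subset[of "{h -` A \<inter> space P | A. A \<in> sets borel}" N] that measurable_sets[OF that(1)] by auto
  have "indep_var borel f borel g"
    unfolding indep_var_eq
  proof (intro conjI input_measurableD[OF f(1)] noise_measurableD[OF g(1)])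
    show "indep_set (sigma_sets (space P) {f -` A \<inter> space P |A. A \<in> sets borel})
      (sigma_sets (space P) {g -` A \<inter> space P |A. A \<in> sets borel})"
      unfolding indep_sets2_eq
    proof (intro conjI ballI)
      note I = indep_input_noise[unfolded indep_sets2_eq]
      note sf = sub[OF f(1) space_algebras(1)] and sg = sub[OF g(1) space_algebras(2)]
      show "sigma_sets (space P) {f -` A \<inter> space P |A. A \<in> sets borel} \<subseteq> events"
        using I sf by (meson subset_trans)
      show "sigma_sets (space P) {g -` A \<inter> space P |A. A \<in> sets borel} \<subseteq> events"
        using I sg by (meson subset_trans)
      fix a b
      assume "a \<in> sigma_sets (space P) {f -` A \<inter> space P |A. A \<in> sets borel}"
        "b \<in> sigma_sets (space P) {g -` A \<inter> space P |A. A \<in> sets borel}"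
      then have "a \<in> sets input_algebra" "b \<in> sets noise_algebra"
        using sf sg by (meson subsetD)+
      then show "prob (a \<inter> b) = prob a * prob b" using I by simp
    qed
  qed
  from indep_var_integrable[OF this f(2) g(2)] indep_var_lebesgue_integral[OF this f(2) g(2)]
  show "integrable P (\<lambda>\<omega>. f \<omega> * g \<omega>)" "(\<integral>\<omega>. f \<omega> * g \<omega> \<partial>P) = (\<integral>\<omega>. f \<omega> \<partial>P) * (\<integral>\<omega>. g \<omega> \<partial>P)" .
qed

lemma distinct_observations_product:
  fixes f g :: "'x \<times> ('y \<Rightarrow> real) \<Rightarrow> real"
  assumes m: "m \<in> {1..M}" "l \<in> {1..M}" "m \<noteq> l"
    and f: "f \<in> sample_algebra \<rightarrow>\<^sub>M borel" "integrable P (\<lambda>\<omega>. f (prototype \<omega>))"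
    and g: "g \<in> sample_algebra \<rightarrow>\<^sub>M borel" "integrable P (\<lambda>\<omega>. g (prototype \<omega>))"
  shows "integrable P (\<lambda>\<omega>. f (observation m \<omega>) * g (observation l \<omega>))"
    and "(\<integral>\<omega>. f (observation m \<omega>) * g (observation l \<omega>) \<partial>P) = (\<integral>\<omega>. f (prototype \<omega>) \<partial>P) * (\<integral>\<omega>. g (prototype \<omega>) \<partial>P)"
proof -
  \<comment> \<open>Independence of a family needs one indexed function; on the two-element index
    set it is \<open>f\<close> at \<open>m\<close> and \<open>g\<close> at \<open>l\<close>.\<close>
  let ?Y = "\<lambda>i \<omega>. (if i = m then f else g) (observation i \<omega>)"
  have "indep_vars (\<lambda>_. borel) ?Y {m, l}"
    using m f g by (intro indep_vars_compose2[OF indep_vars_subset[OF observation_indep]]) auto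
  moreover have "integrable P (?Y i)" if "i \<in> {m, l}" for i
    using that m f g observation_integral(1)[of i] by auto
  ultimately have *: "integrable P (\<lambda>\<omega>. \<Prod>i\<in>{m, l}. ?Y i \<omega>)"
    "(\<integral>\<omega>. (\<Prod>i\<in>{m, l}. ?Y i \<omega>) \<partial>P) = (\<Prod>i\<in>{m, l}. \<integral>\<omega>. ?Y i \<omega> \<partial>P)"
    using indep_vars_integrable[of "{m, l}" ?Y] indep_vars_lebesgue_integral[of "{m, l}" ?Y] by blast+
  from * m(3) show "integrable P (\<lambda>\<omega>. f (observation m \<omega>) * g (observation l \<omega>))" by simp
  from *(2) m(3) show "(\<integral>\<omega>. f (observation m \<omega>) * g (observation l \<omega>) \<partial>P) = (\<integral>\<omega>. f (prototype \<omega>) \<partial>P) * (\<integral>\<omega>. g (prototype \<omega>) \<partial>P)"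
    using observation_integral(2)[OF m(1) f(1)] observation_integral(2)[OF m(2) g(1)] by simp
qed

end

section \<open>Orthonormal systems and second moments of the noise\<close>

lemma orthonormal_norm_square:
  fixes yb :: "nat \<Rightarrow> 'y::{real_inner, polish_space}"
  assumes "orthonormal_basis D yb" "finite J" "J \<subseteq> basis_index D"
  shows "(norm (\<Sum>i\<in>J. a i *\<^sub>R yb i))\<^sup>2 = (\<Sum>i\<in>J. (a i)\<^sup>2)"
proof -
  have "(norm (\<Sum>i\<in>J. a i *\<^sub>R yb i))\<^sup>2 = (\<Sum>i\<in>J. \<Sum>j\<in>J. a i * (a j * (yb i \<bullet> yb j)))"
    by (simp add: power2_norm_eq_inner inner_sum_left inner_sum_right sum_distrib_left)
      (subst sum.swap, simp add: mult.left_commute)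
  also have "\<dots> = (\<Sum>i\<in>J. \<Sum>j\<in>J. if i = j then (a i)\<^sup>2 else 0)"
    using assms by (intro sum.cong) (auto simp: orthonormal_basis_def power2_eq_square subset_iff)
  also have "\<dots> = (\<Sum>i\<in>J. (a i)\<^sup>2)" using assms by simp
  finally show ?thesis .
qed

lemma orthonormal_Bessel:
  fixes yb :: "nat \<Rightarrow> 'y::{real_inner, polish_space}"
  assumes "orthonormal_basis D yb" "finite J" "J \<subseteq> basis_index D"
  shows "(\<Sum>i\<in>J. (v \<bullet> yb i)\<^sup>2) \<le> (norm v)\<^sup>2"
proof -
  let ?w = "\<Sum>i\<in>J. (v \<bullet> yb i) *\<^sub>R yb i"
  have "0 \<le> (norm (v - ?w))\<^sup>2" by simp
  also have "\<dots> = (norm v)\<^sup>2 - 2 * (v \<bullet> ?w) + (norm ?w)\<^sup>2"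
    by (simp add: power2_norm_eq_inner inner_diff_left inner_diff_right inner_commute)
  also have "v \<bullet> ?w = (\<Sum>i\<in>J. (v \<bullet> yb i)\<^sup>2)" by (simp add: inner_sum_right power2_eq_square)
  finally show ?thesis using orthonormal_norm_square[OF assms, of "\<lambda>i. v \<bullet> yb i"] by simp
qed

locale noisy_sample_moments = noisy_sample P u \<epsilon> M us \<epsilon>s
  for P :: "'w measure" and u :: "'w \<Rightarrow> 'x::banach" and \<epsilon> :: "'y::{real_inner, polish_space} \<Rightarrow> 'w \<Rightarrow> real"
    and M us \<epsilon>s +
  fixes \<sigma> :: real and D :: enat and yb :: "nat \<Rightarrow> 'y"
  assumes moments: "noise_moments P \<epsilon> \<sigma>" and basis: "orthonormal_basis D yb"
begin

lemma sample_noise_L2: "m \<in> {1..M} \<Longrightarrow> \<epsilon>s m y \<in> L2 P"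
  using observation_integral_noise(1)[of m "\<lambda>a b. a\<^sup>2" y y] noise_L2[of y]
    noise_measurableD[OF sample_noise_measurable[of m y]]
  by (auto simp: L2_def)

text \<open>For one sample the covariance depends only on the law, hence equals that of the
  prototype; for different samples it is the product of the means, which vanish by (B1).\<close>

lemma sample_noise_covariance:
  assumes "m \<in> {1..M}" "l \<in> {1..M}"
  shows "(\<integral>\<omega>. \<epsilon>s m y \<omega> * \<epsilon>s l z \<omega> \<partial>P) = (if m = l then \<integral>\<omega>. \<epsilon> y \<omega> * \<epsilon> z \<omega> \<partial>P else 0)"
proof (cases "m = l")
  case True
  then show ?thesis using observation_integral_noise(2)[OF assms(1), of "\<lambda>a b. a * b" y z] by simp
next
  case False
  have int: "integrable P (\<epsilon> y)" for y
    using L2_mult_integrable[OF noise_L2[of y], of "\<lambda>_. 1"] by (simp add: L2_def)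
  have "(\<integral>\<omega>. snd (observation m \<omega>) y * snd (observation l \<omega>) z \<partial>P)
      = (\<integral>\<omega>. snd (prototype \<omega>) y \<partial>P) * (\<integral>\<omega>. snd (prototype \<omega>) z \<partial>P)"
    by (rule distinct_observations_product[OF assms False noise_value_measurable _ noise_value_measurable])
      (simp_all add: prototype_def int)
  then show ?thesis using moments False by (simp add: observation_def prototype_def noise_moments_def)
qed

lemma noise_linear_combination:
  assumes "finite J"
  shows "AE \<omega> in P. \<epsilon> (\<Sum>i\<in>J. a i *\<^sub>R yb i) \<omega> = (\<Sum>i\<in>J. a i * \<epsilon> (yb i) \<omega>)"
  using assms
proof (induction J rule: finite_induct)
  case empty
  \<comment> \<open>The noise is linear only almost surely, so its vanishing at the zero vector is
    read off from scaling by 0.\<close>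
  have "AE \<omega> in P. \<epsilon> (0 *\<^sub>R 0) \<omega> = 0 * \<epsilon> 0 \<omega>" using noise unfolding linear_noise_def by blast
  then show ?case by simp
next
  case (insert j J)
  have "AE \<omega> in P. \<epsilon> (a j *\<^sub>R yb j + (\<Sum>i\<in>J. a i *\<^sub>R yb i)) \<omega> = \<epsilon> (a j *\<^sub>R yb j) \<omega> + \<epsilon> (\<Sum>i\<in>J. a i *\<^sub>R yb i) \<omega>"
    "AE \<omega> in P. \<epsilon> (a j *\<^sub>R yb j) \<omega> = a j * \<epsilon> (yb j) \<omega>"
    using noise unfolding linear_noise_def by blast+
  then show ?case using insert.IH
  proof eventually_elim
    case (elim \<omega>)
    then show ?case using insert.hyps by simp
  qed
qed

text \<open>The quadratic form is the second moment of the noise at the vector with coordinates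
  \<open>a\<close>, so (B1) says that the covariance matrix in an orthonormal system is at most
  sigma^2 times the identity.\<close>

lemma noise_covariance_bound:
  assumes J: "finite J" "J \<subseteq> basis_index D"
  shows "(\<Sum>i\<in>J. \<Sum>j\<in>J. a i * a j * (\<integral>\<omega>. \<epsilon> (yb i) \<omega> * \<epsilon> (yb j) \<omega> \<partial>P)) \<le> \<sigma>\<^sup>2 * (\<Sum>i\<in>J. (a i)\<^sup>2)"
proof -
  let ?v = "\<Sum>i\<in>J. a i *\<^sub>R yb i"
  have int: "integrable P (\<lambda>\<omega>. \<epsilon> (yb i) \<omega> * \<epsilon> (yb j) \<omega>)" for i j
    by (intro L2_mult_integrable noise_L2)
  have "(\<Sum>i\<in>J. \<Sum>j\<in>J. a i * a j * (\<integral>\<omega>. \<epsilon> (yb i) \<omega> * \<epsilon> (yb j) \<omega> \<partial>P))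
    = (\<integral>\<omega>. (\<Sum>i\<in>J. \<Sum>j\<in>J. a i * a j * (\<epsilon> (yb i) \<omega> * \<epsilon> (yb j) \<omega>)) \<partial>P)"
    using int by simp
  also have "\<dots> = (\<integral>\<omega>. (\<epsilon> ?v \<omega>)\<^sup>2 \<partial>P)"
  proof (rule integral_cong_AE)
    show "AE \<omega> in P. (\<Sum>i\<in>J. \<Sum>j\<in>J. a i * a j * (\<epsilon> (yb i) \<omega> * \<epsilon> (yb j) \<omega>)) = (\<epsilon> ?v \<omega>)\<^sup>2"
      using noise_linear_combination[OF J(1), of a]
    proof eventually_elim
      case (elim \<omega>)
      show ?case unfolding elim power2_eq_square sum_product by (intro sum.cong) (auto simp: mult_ac)
    qed
  qed (use L2D(1)[OF noise_L2] in auto)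
  also have "\<dots> \<le> \<sigma>\<^sup>2 * (norm ?v)\<^sup>2" using moments unfolding noise_moments_def by blast
  also have "(norm ?v)\<^sup>2 = (\<Sum>i\<in>J. (a i)\<^sup>2)" by (rule orthonormal_norm_square[OF basis J])
  finally show ?thesis .
qed

lemma input_noise_product_L2:
  assumes f: "f \<in> borel_measurable input_algebra" "f \<in> L2 P"
    and g: "g \<in> borel_measurable noise_algebra" "g \<in> L2 P"
  shows "(\<lambda>\<omega>. f \<omega> * g \<omega>) \<in> L2 P"
proof -
  have "integrable P (\<lambda>\<omega>. (f \<omega>)\<^sup>2 * (g \<omega>)\<^sup>2)"
    using f g by (intro input_noise_product) (auto simp: L2_def)
  then show ?thesis using f g by (auto simp: L2_def power_mult_distrib)
qed

section \<open>Finite sums of noise values with coefficients depending on the inputs\<close>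

context
  fixes c :: "nat \<Rightarrow> nat \<Rightarrow> 'w \<Rightarrow> real" and J :: "nat set" and X :: "'w \<Rightarrow> real"
  assumes J: "finite J" "J \<subseteq> basis_index D"
    and c: "\<And>m i. m \<in> {1..M} \<Longrightarrow> i \<in> J \<Longrightarrow> c m i \<in> borel_measurable input_algebra"
      "\<And>m i. m \<in> {1..M} \<Longrightarrow> i \<in> J \<Longrightarrow> c m i \<in> L2 P"
  defines "X \<equiv> \<lambda>\<omega>. \<Sum>m=1..M. \<Sum>i\<in>J. c m i \<omega> * \<epsilon>s m (yb i) \<omega>"
begin

lemma random_noise_sum_L2: "X \<in> L2 P"
  unfolding X_def
  by (intro L2_sum input_noise_product_L2 c sample_noise_measurable sample_noise_L2) auto

text \<open>In each summand \<open>g\<close> and the coefficient merge into one input variable,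
  which separates from a noise factor of mean zero. This makes the cross term of bias and noise
  vanish.\<close>

lemma random_noise_sum_orthogonal:
  assumes g: "g \<in> borel_measurable input_algebra" "g \<in> L2 P"
  shows "(\<integral>\<omega>. g \<omega> * X \<omega> \<partial>P) = 0"
proof -
  have e: "integrable P (\<epsilon>s m y)" "(\<integral>\<omega>. \<epsilon>s m y \<omega> \<partial>P) = 0" if "m \<in> {1..M}" for m y
    using L2_mult_integrable[OF sample_noise_L2[OF that, of y], of "\<lambda>_. 1"]
      observation_integral_noise(2)[OF that, of "\<lambda>a b. a" y y] moments
    by (auto simp: L2_def noise_moments_def)
  have *: "integrable P (\<lambda>\<omega>. (g \<omega> * c m i \<omega>) * \<epsilon>s m (yb i) \<omega>)"
      "(\<integral>\<omega>. (g \<omega> * c m i \<omega>) * \<epsilon>s m (yb i) \<omega> \<partial>P) = 0" if "m \<in> {1..M}" "i \<in> J" for m i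
  proof -
    have gc: "(\<lambda>\<omega>. g \<omega> * c m i \<omega>) \<in> borel_measurable input_algebra" "integrable P (\<lambda>\<omega>. g \<omega> * c m i \<omega>)"
      using c[OF that] g by (auto intro: L2_mult_integrable)
    show "integrable P (\<lambda>\<omega>. (g \<omega> * c m i \<omega>) * \<epsilon>s m (yb i) \<omega>)"
      "(\<integral>\<omega>. (g \<omega> * c m i \<omega>) * \<epsilon>s m (yb i) \<omega> \<partial>P) = 0"
      using input_noise_product[OF gc sample_noise_measurable[OF that(1)] e(1)[OF that(1)], of "yb i"] e(2)[OF that(1)]
      by auto
  qed
  have "(\<integral>\<omega>. g \<omega> * X \<omega> \<partial>P) = (\<integral>\<omega>. (\<Sum>m=1..M. \<Sum>i\<in>J. (g \<omega> * c m i \<omega>) * \<epsilon>s m (yb i) \<omega>) \<partial>P)"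
    by (simp add: X_def sum_distrib_left mult.assoc)
  also have "\<dots> = (\<Sum>m=1..M. \<Sum>i\<in>J. (\<integral>\<omega>. (g \<omega> * c m i \<omega>) * \<epsilon>s m (yb i) \<omega> \<partial>P))"
    by (subst Bochner_Integration.integral_sum; (intro sum.cong refl Bochner_Integration.integrable_sum Bochner_Integration.integral_sum)?) (use * in auto)
  finally show ?thesis using *(2) by simp
qed

text \<open>After expanding the square, only pairs of terms from the same sample survive. What
  remains is the quadratic form of the noise covariance at the random coefficient vector, which is
  bounded pointwise under the integral.\<close>

lemma random_noise_sum_square:
  "(\<integral>\<omega>. (X \<omega>)\<^sup>2 \<partial>P) \<le> \<sigma>\<^sup>2 * (\<Sum>m=1..M. \<Sum>i\<in>J. \<integral>\<omega>. (c m i \<omega>)\<^sup>2 \<partial>P)"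
proof -
  let ?K = "{1..M} \<times> J"
  let ?Q = "\<lambda>i j. \<integral>\<omega>. \<epsilon> (yb i) \<omega> * \<epsilon> (yb j) \<omega> \<partial>P"
  define C where "C p = c (fst p) (snd p)" for p
  define E where "E p = \<epsilon>s (fst p) (yb (snd p))" for p
  have X: "X \<omega> = (\<Sum>p\<in>?K. C p \<omega> * E p \<omega>)" for \<omega>
    unfolding X_def C_def E_def by (simp add: sum.cartesian_product case_prod_beta)
  have cc: "integrable P (\<lambda>\<omega>. c m i \<omega> * c l j \<omega>)"
    if "m \<in> {1..M}" "l \<in> {1..M}" "i \<in> J" "j \<in> J" for m l i j
    using that by (intro L2_mult_integrable c)
  have product: "integrable P (\<lambda>\<omega>. (C p \<omega> * C q \<omega>) * (E p \<omega> * E q \<omega>))"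
    "(\<integral>\<omega>. (C p \<omega> * C q \<omega>) * (E p \<omega> * E q \<omega>) \<partial>P) =
      (if fst p = fst q then (\<integral>\<omega>. C p \<omega> * C q \<omega> \<partial>P) * ?Q (snd p) (snd q) else 0)"
    if "p \<in> ?K" "q \<in> ?K" for p q
  proof -
    have 1: "(\<lambda>\<omega>. C p \<omega> * C q \<omega>) \<in> borel_measurable input_algebra" "integrable P (\<lambda>\<omega>. C p \<omega> * C q \<omega>)"
      unfolding C_def using that by (auto intro!: borel_measurable_times L2_mult_integrable c)
    have 2: "(\<lambda>\<omega>. E p \<omega> * E q \<omega>) \<in> borel_measurable noise_algebra" "integrable P (\<lambda>\<omega>. E p \<omega> * E q \<omega>)"
      unfolding E_def using that
      by (auto intro!: borel_measurable_times L2_mult_integrable sample_noise_measurable sample_noise_L2)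
    have "(\<integral>\<omega>. E p \<omega> * E q \<omega> \<partial>P) = (if fst p = fst q then ?Q (snd p) (snd q) else 0)"
      unfolding E_def using that by (intro sample_noise_covariance) auto
    with input_noise_product[OF 1 2]
    show "integrable P (\<lambda>\<omega>. (C p \<omega> * C q \<omega>) * (E p \<omega> * E q \<omega>))"
      "(\<integral>\<omega>. (C p \<omega> * C q \<omega>) * (E p \<omega> * E q \<omega>) \<partial>P) =
      (if fst p = fst q then (\<integral>\<omega>. C p \<omega> * C q \<omega> \<partial>P) * ?Q (snd p) (snd q) else 0)" by auto
  qed
  have "(\<integral>\<omega>. (X \<omega>)\<^sup>2 \<partial>P) = (\<integral>\<omega>. (\<Sum>p\<in>?K. \<Sum>q\<in>?K. (C p \<omega> * C q \<omega>) * (E p \<omega> * E q \<omega>)) \<partial>P)"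
    unfolding X power2_eq_square sum_product
    by (intro Bochner_Integration.integral_cong refl sum.cong) (simp add: mult_ac)
  also have "\<dots> = (\<Sum>p\<in>?K. \<integral>\<omega>. (\<Sum>q\<in>?K. (C p \<omega> * C q \<omega>) * (E p \<omega> * E q \<omega>)) \<partial>P)"
    using product(1) by (intro Bochner_Integration.integral_sum Bochner_Integration.integrable_sum)
  also have "\<dots> = (\<Sum>p\<in>?K. \<Sum>q\<in>?K. \<integral>\<omega>. (C p \<omega> * C q \<omega>) * (E p \<omega> * E q \<omega>) \<partial>P)"
    using product(1) by (intro sum.cong refl Bochner_Integration.integral_sum)
  also have "\<dots> = (\<Sum>p\<in>?K. \<Sum>q\<in>?K.
      if fst p = fst q then (\<integral>\<omega>. C p \<omega> * C q \<omega> \<partial>P) * ?Q (snd p) (snd q) else 0)"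
    using product(2) by (intro sum.cong refl)
  also have "\<dots> = (\<Sum>m=1..M. \<Sum>i\<in>J. \<Sum>l=1..M. \<Sum>j\<in>J.
      if m = l then (\<integral>\<omega>. c m i \<omega> * c l j \<omega> \<partial>P) * ?Q i j else 0)"
    by (simp add: sum.cartesian_product' C_def cong: if_cong)
  also have "\<dots> = (\<Sum>m=1..M. \<Sum>i\<in>J. \<Sum>j\<in>J. (\<integral>\<omega>. c m i \<omega> * c m j \<omega> \<partial>P) * ?Q i j)"
  proof (rule sum.cong[OF refl], rule sum.cong[OF refl])
    fix m i assume "m \<in> {1..M}" "i \<in> J"
    have "(\<Sum>l=1..M. \<Sum>j\<in>J. if m = l then (\<integral>\<omega>. c m i \<omega> * c l j \<omega> \<partial>P) * ?Q i j else 0)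
      = (\<Sum>l=1..M. if m = l then (\<Sum>j\<in>J. (\<integral>\<omega>. c m i \<omega> * c l j \<omega> \<partial>P) * ?Q i j) else 0)"
      by (intro sum.cong) auto
    then show "(\<Sum>l=1..M. \<Sum>j\<in>J. if m = l then (\<integral>\<omega>. c m i \<omega> * c l j \<omega> \<partial>P) * ?Q i j else 0)
      = (\<Sum>j\<in>J. (\<integral>\<omega>. c m i \<omega> * c m j \<omega> \<partial>P) * ?Q i j)"
      using \<open>m \<in> {1..M}\<close> by simp
  qed
  \<comment> \<open>The covariances are numbers, so they may be moved back under the integral; at a
    fixed outcome the coefficients then form an ordinary vector to which
    \<open>noise_covariance_bound\<close> applies.\<close>
  also have "\<dots> = (\<Sum>m=1..M. \<integral>\<omega>. (\<Sum>i\<in>J. \<Sum>j\<in>J. c m i \<omega> * c m j \<omega> * ?Q i j) \<partial>P)"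
  proof (rule sum.cong[OF refl])
    fix m assume m: "m \<in> {1..M}"
    have "(\<integral>\<omega>. (\<Sum>i\<in>J. \<Sum>j\<in>J. c m i \<omega> * c m j \<omega> * ?Q i j) \<partial>P)
      = (\<Sum>i\<in>J. \<integral>\<omega>. (\<Sum>j\<in>J. c m i \<omega> * c m j \<omega> * ?Q i j) \<partial>P)"
      using cc[OF m m] by (intro Bochner_Integration.integral_sum Bochner_Integration.integrable_sum integrable_mult_left)
    also have "\<dots> = (\<Sum>i\<in>J. \<Sum>j\<in>J. \<integral>\<omega>. c m i \<omega> * c m j \<omega> * ?Q i j \<partial>P)"
      using cc[OF m m] by (intro sum.cong refl Bochner_Integration.integral_sum integrable_mult_left)
    finally show "(\<Sum>i\<in>J. \<Sum>j\<in>J. (\<integral>\<omega>. c m i \<omega> * c m j \<omega> \<partial>P) * ?Q i j)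
      = (\<integral>\<omega>. (\<Sum>i\<in>J. \<Sum>j\<in>J. c m i \<omega> * c m j \<omega> * ?Q i j) \<partial>P)" by simp
  qed
  also have "\<dots> \<le> (\<Sum>m=1..M. \<integral>\<omega>. \<sigma>\<^sup>2 * (\<Sum>i\<in>J. (c m i \<omega>)\<^sup>2) \<partial>P)"
  proof (intro sum_mono integral_mono noise_covariance_bound[OF J])
    fix m assume m: "m \<in> {1..M}"
    show "integrable P (\<lambda>\<omega>. \<Sum>i\<in>J. \<Sum>j\<in>J. c m i \<omega> * c m j \<omega> * ?Q i j)"
      using cc[OF m m] by (intro Bochner_Integration.integrable_sum integrable_mult_left)
    show "integrable P (\<lambda>\<omega>. \<sigma>\<^sup>2 * (\<Sum>i\<in>J. (c m i \<omega>)\<^sup>2))"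
      using c(2)[OF m] by (intro integrable_mult_right Bochner_Integration.integrable_sum L2D(2))
  qed
  also have "\<dots> = \<sigma>\<^sup>2 * (\<Sum>m=1..M. \<Sum>i\<in>J. \<integral>\<omega>. (c m i \<omega>)\<^sup>2 \<partial>P)"
    unfolding sum_distrib_left[of "\<sigma>\<^sup>2" _ "{1..M}"]
  proof (rule sum.cong[OF refl])
    fix m assume m: "m \<in> {1..M}"
    have "(\<integral>\<omega>. (\<Sum>i\<in>J. (c m i \<omega>)\<^sup>2) \<partial>P) = (\<Sum>i\<in>J. \<integral>\<omega>. (c m i \<omega>)\<^sup>2 \<partial>P)"
      using c(2)[OF m] by (intro Bochner_Integration.integral_sum L2D(2))
    then show "(\<integral>\<omega>. \<sigma>\<^sup>2 * (\<Sum>i\<in>J. (c m i \<omega>)\<^sup>2) \<partial>P) = \<sigma>\<^sup>2 * (\<Sum>i\<in>J. \<integral>\<omega>. (c m i \<omega>)\<^sup>2 \<partial>P)" by simp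
  qed
  finally show ?thesis .
qed

end

section \<open>The noise pairing as a mean-square limit\<close>

lemma inner_basis_L2:
  assumes V: "V \<in> borel_measurable P" "integrable P (\<lambda>\<omega>. (norm (V \<omega>))\<^sup>2)" and i: "i \<in> basis_index D"
  shows "(\<lambda>\<omega>. V \<omega> \<bullet> yb i) \<in> L2 P"
proof -
  have "integrable P (\<lambda>\<omega>. (V \<omega> \<bullet> yb i)\<^sup>2)"
  proof (rule Bochner_Integration.integrable_bound[OF V(2)])
    show "AE \<omega> in P. norm ((V \<omega> \<bullet> yb i)\<^sup>2) \<le> norm ((norm (V \<omega>))\<^sup>2)"
      using orthonormal_Bessel[OF basis, of "{i}"] i by simp
  qed (use V in auto)
  then show ?thesis using V by (auto simp: L2_def)
qed

text \<open>The partial sums are Cauchy: an increment has second moment at most sigma^2 times a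
  block of the series of the second moments of the coordinates of \<open>V\<close>, and Bessel's
  inequality bounds that series by the second moment of |V|. A limit therefore exists and the choice
  in \<open>noise_pairing\<close> is one.\<close>

lemma noise_pairing_tendsto:
  assumes m: "m \<in> {1..M}" and V: "V \<in> borel_measurable input_algebra" "integrable P (\<lambda>\<omega>. (norm (V \<omega>))\<^sup>2)"
  shows "L2_tendsto P (\<lambda>N \<omega>. \<Sum>i\<in>basis_index D \<inter> {..N}. (V \<omega> \<bullet> yb i) * \<epsilon>s m (yb i) \<omega>)
    (noise_pairing P D yb (\<epsilon>s m) V)"
proof -
  define S where "S J \<omega> = (\<Sum>i\<in>J. (V \<omega> \<bullet> yb i) * \<epsilon>s m (yb i) \<omega>)" for J \<omega>
  \<comment> \<open>Zero coefficients for the other samples reduce the pairing with sample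
    \<open>m\<close> to the sums over all samples treated before.\<close>
  define c where "c l i \<omega> = (if l = m then V \<omega> \<bullet> yb i else 0)" for l i \<omega>
  note VL = inner_basis_L2[OF input_measurableD[OF V(1)] V(2)]
  have S: "S J \<in> L2 P" "(\<integral>\<omega>. (S J \<omega>)\<^sup>2 \<partial>P) \<le> \<sigma>\<^sup>2 * (\<Sum>i\<in>J. \<integral>\<omega>. (V \<omega> \<bullet> yb i)\<^sup>2 \<partial>P)"
    if J: "finite J" "J \<subseteq> basis_index D" for J
  proof -
    have c: "c l i \<in> borel_measurable input_algebra" "c l i \<in> L2 P" if "l \<in> {1..M}" "i \<in> J" for l i
    proof -
      show "c l i \<in> borel_measurable input_algebra" unfolding c_def using V(1) by (cases "l = m") auto
      show "c l i \<in> L2 P" unfolding c_def using VL[of i] that J L2_zero by (cases "l = m") auto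
    qed
    have eq: "(\<Sum>l=1..M. \<Sum>i\<in>J. c l i \<omega> * \<epsilon>s l (yb i) \<omega>) = S J \<omega>" for \<omega>
    proof -
      have "(\<Sum>l=1..M. \<Sum>i\<in>J. c l i \<omega> * \<epsilon>s l (yb i) \<omega>) = (\<Sum>l=1..M. if l = m then S J \<omega> else 0)"
        by (intro sum.cong) (auto simp: c_def S_def)
      then show ?thesis using m by simp
    qed
    have "(\<Sum>l=1..M. \<Sum>i\<in>J. \<integral>\<omega>. (c l i \<omega>)\<^sup>2 \<partial>P) = (\<Sum>l=1..M. if l = m then \<Sum>i\<in>J. \<integral>\<omega>. (V \<omega> \<bullet> yb i)\<^sup>2 \<partial>P else 0)"
      by (intro sum.cong) (auto simp: c_def)
    also have "\<dots> = (\<Sum>i\<in>J. \<integral>\<omega>. (V \<omega> \<bullet> yb i)\<^sup>2 \<partial>P)" using m by simp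
    finally show "S J \<in> L2 P" "(\<integral>\<omega>. (S J \<omega>)\<^sup>2 \<partial>P) \<le> \<sigma>\<^sup>2 * (\<Sum>i\<in>J. \<integral>\<omega>. (V \<omega> \<bullet> yb i)\<^sup>2 \<partial>P)"
      using random_noise_sum_L2[OF J, of c, OF c] random_noise_sum_square[OF J, of c, OF c] unfolding eq by auto
  qed
  define F where "F N = S (basis_index D \<inter> {..N})" for N
  define a where "a i = (if i \<in> basis_index D then \<integral>\<omega>. (V \<omega> \<bullet> yb i)\<^sup>2 \<partial>P else 0)" for i
  have a: "a i \<ge> 0" for i by (simp add: a_def)
  have "summable a"
  proof (rule summableI_nonneg_bounded)
    show "(\<Sum>i<N. a i) \<le> (\<integral>\<omega>. (norm (V \<omega>))\<^sup>2 \<partial>P)" for N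
    proof -
      have "(\<Sum>i<N. a i) = (\<Sum>i\<in>basis_index D \<inter> {..<N}. \<integral>\<omega>. (V \<omega> \<bullet> yb i)\<^sup>2 \<partial>P)"
        unfolding a_def by (subst sum.If_cases) (auto intro: sum.cong simp: Int_commute)
      also have "\<dots> = (\<integral>\<omega>. (\<Sum>i\<in>basis_index D \<inter> {..<N}. (V \<omega> \<bullet> yb i)\<^sup>2) \<partial>P)"
        using L2D(2)[OF VL] by (intro Bochner_Integration.integral_sum[symmetric]) auto
      also have "\<dots> \<le> (\<integral>\<omega>. (norm (V \<omega>))\<^sup>2 \<partial>P)"
        using L2D(2)[OF VL] V(2)
        by (intro integral_mono orthonormal_Bessel[OF basis] Bochner_Integration.integrable_sum) auto
      finally show ?thesis .
    qed
  qed (rule a)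
  have diff: "(\<integral>\<omega>. (F N \<omega> - F N' \<omega>)\<^sup>2 \<partial>P) \<le> \<sigma>\<^sup>2 * sum a {Suc N'..<Suc N}" if "N' \<le> N" for N N'
  proof -
    let ?J = "basis_index D \<inter> {Suc N'..<Suc N}"
    have "basis_index D \<inter> {..N} = (basis_index D \<inter> {..N'}) \<union> ?J" using that by auto
    then have "F N \<omega> - F N' \<omega> = S ?J \<omega>" for \<omega>
      unfolding F_def S_def by (simp only:) (subst sum.union_disjoint, auto)
    then have "(\<integral>\<omega>. (F N \<omega> - F N' \<omega>)\<^sup>2 \<partial>P) \<le> \<sigma>\<^sup>2 * (\<Sum>i\<in>?J. \<integral>\<omega>. (V \<omega> \<bullet> yb i)\<^sup>2 \<partial>P)"
      using S(2)[of ?J] by simp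
    also have "(\<Sum>i\<in>?J. \<integral>\<omega>. (V \<omega> \<bullet> yb i)\<^sup>2 \<partial>P) = sum a {Suc N'..<Suc N}"
      unfolding a_def by (subst sum.If_cases) (auto intro: sum.cong simp: Int_commute)
    finally show ?thesis .
  qed
  have "\<exists>f. L2_tendsto P F f"
  proof (rule L2_complete)
    show "F N \<in> L2 P" for N unfolding F_def by (intro S) auto
    fix e :: real assume "e > 0"
    \<comment> \<open>The added 1 keeps the denominator positive without reference to the value of
      sigma.\<close>
    then have "e / (\<sigma>\<^sup>2 + 1) > 0" by (simp add: add_nonneg_pos)
    then obtain K where K: "\<And>k l. k \<ge> K \<Longrightarrow> norm (sum a {k..<l}) < e / (\<sigma>\<^sup>2 + 1)"
      using \<open>summable a\<close> unfolding summable_Cauchy by blast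
    have *: "(\<integral>\<omega>. (F N \<omega> - F N' \<omega>)\<^sup>2 \<partial>P) \<le> e" if "K \<le> N'" "N' \<le> N" for N N'
    proof -
      have "sum a {Suc N'..<Suc N} \<le> e / (\<sigma>\<^sup>2 + 1)"
        using K[of "Suc N'" "Suc N"] that by simp
      then have "(\<sigma>\<^sup>2 + 1) * sum a {Suc N'..<Suc N} \<le> e"
        by (simp add: pos_le_divide_eq add_nonneg_pos mult.commute)
      moreover have "\<sigma>\<^sup>2 * sum a {Suc N'..<Suc N} \<le> (\<sigma>\<^sup>2 + 1) * sum a {Suc N'..<Suc N}"
        using a by (intro mult_right_mono sum_nonneg) auto
      ultimately show ?thesis using diff[OF that(2)] by linarith
    qed
    have "(\<integral>\<omega>. (F N \<omega> - F N' \<omega>)\<^sup>2 \<partial>P) \<le> e" if "K \<le> N'" "K \<le> N" for N N'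
      using *[of N' N] *[of N N'] that by (cases "N' \<le> N") (auto simp: power2_commute)
    then show "\<exists>K. \<forall>k\<ge>K. \<forall>l\<ge>K. (\<integral>\<omega>. (F k \<omega> - F l \<omega>)\<^sup>2 \<partial>P) \<le> e" by blast
  qed
  then have "L2_tendsto P F (SOME Z. L2_tendsto P F Z)" by (rule someI_ex)
  then show ?thesis unfolding noise_pairing_def F_def S_def .
qed

end

text \<open>The off-diagonal products factor into vanishing means, so M of the M^2 terms remain,
  against the prefactor 1 / M^2. It is applied to the bias.\<close>

lemma (in noisy_sample) sample_mean_square:
  fixes g :: "'x \<Rightarrow> real"
  assumes g: "g \<in> borel \<rightarrow>\<^sub>M borel" "(\<lambda>\<omega>. g (u \<omega>)) \<in> L2 P" and mean: "(\<integral>\<omega>. g (u \<omega>) \<partial>P) = 0"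
  shows "(\<lambda>\<omega>. 1 / real M * (\<Sum>m=1..M. g (us m \<omega>))) \<in> L2 P"
    and "(\<integral>\<omega>. (1 / real M * (\<Sum>m=1..M. g (us m \<omega>)))\<^sup>2 \<partial>P) = (\<integral>\<omega>. (g (u \<omega>))\<^sup>2 \<partial>P) / real M"
proof -
  have g2: "(\<lambda>v. (g v)\<^sup>2) \<in> borel \<rightarrow>\<^sub>M borel" using g(1) by simp
  have L: "(\<lambda>\<omega>. g (us m \<omega>)) \<in> L2 P" if "m \<in> {1..M}" for m
    using observation_integral_input(1)[OF that g2] g(2) measurable_compose[OF us_measurable[OF that] g(1)]
    by (simp add: L2_def)
  then show "(\<lambda>\<omega>. 1 / real M * (\<Sum>m=1..M. g (us m \<omega>))) \<in> L2 P"
    by (intro L2_cmult L2_sum)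
  have cov: "(\<integral>\<omega>. g (us m \<omega>) * g (us l \<omega>) \<partial>P) = (if m = l then \<integral>\<omega>. (g (u \<omega>))\<^sup>2 \<partial>P else 0)"
    if m: "m \<in> {1..M}" "l \<in> {1..M}" for m l
  proof (cases "m = l")
    case True
    then show ?thesis using observation_integral_input(2)[OF m(1) g2] by (simp add: power2_eq_square)
  next
    case False
    have gf: "(\<lambda>z. g (fst z)) \<in> (sample_algebra :: ('x \<times> ('y \<Rightarrow> real)) measure) \<rightarrow>\<^sub>M borel"
      by (rule measurable_compose[OF measurable_fst g(1)])
    have int: "integrable P (\<lambda>\<omega>. g (fst (prototype \<omega>)))"
      using L2_mult_integrable[OF g(2), of "\<lambda>_. 1"] by (simp add: L2_def prototype_def)
    have "(\<integral>\<omega>. g (us m \<omega>) * g (us l \<omega>) \<partial>P) = (\<integral>\<omega>. g (u \<omega>) \<partial>P) * (\<integral>\<omega>. g (u \<omega>) \<partial>P)"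
      using distinct_observations_product(2)[OF m False gf int gf int] by (simp add: observation_def prototype_def)
    then show ?thesis using mean False by simp
  qed
  have "(\<integral>\<omega>. (\<Sum>m=1..M. g (us m \<omega>))\<^sup>2 \<partial>P) = (\<integral>\<omega>. (\<Sum>m=1..M. \<Sum>l=1..M. g (us m \<omega>) * g (us l \<omega>)) \<partial>P)"
    by (simp add: power2_eq_square sum_product)
  also have "\<dots> = (\<Sum>m=1..M. \<integral>\<omega>. (\<Sum>l=1..M. g (us m \<omega>) * g (us l \<omega>)) \<partial>P)"
    by (intro Bochner_Integration.integral_sum Bochner_Integration.integrable_sum L2_mult_integrable L)
  also have "\<dots> = (\<Sum>m=1..M. \<Sum>l=1..M. \<integral>\<omega>. g (us m \<omega>) * g (us l \<omega>) \<partial>P)"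
    by (intro sum.cong refl Bochner_Integration.integral_sum L2_mult_integrable L)
  also have "\<dots> = (\<Sum>m=1..M. \<Sum>l=1..M. if m = l then \<integral>\<omega>. (g (u \<omega>))\<^sup>2 \<partial>P else 0)"
    using cov by (intro sum.cong refl) auto
  also have "\<dots> = real M * (\<integral>\<omega>. (g (u \<omega>))\<^sup>2 \<partial>P)" by simp
  finally show "(\<integral>\<omega>. (1 / real M * (\<Sum>m=1..M. g (us m \<omega>)))\<^sup>2 \<partial>P) = (\<integral>\<omega>. (g (u \<omega>))\<^sup>2 \<partial>P) / real M"
    unfolding power_mult_distrib using M by (simp add: power2_eq_square)
qed

section \<open>Second moment of an input-dependent linear image of bias plus noise\<close>

context noisy_sample_moments
begin

text \<open>The vector e of the overview, for arbitrary features \<open>r k\<close>; the average is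
  of pairings, so it inherits their choice of version.\<close>

definition noise_vector :: "(nat \<Rightarrow> 'x \<Rightarrow> 'y) \<Rightarrow> nat \<Rightarrow> 'w \<Rightarrow> real" where
  "noise_vector r k \<omega> = 1 / real M * (\<Sum>m=1..M. noise_pairing P D yb (\<epsilon>s m) (\<lambda>\<omega>. r k (us m \<omega>)) \<omega>)"

context
  fixes n :: nat and r :: "nat \<Rightarrow> 'x \<Rightarrow> 'y" and G :: "nat \<Rightarrow> nat \<Rightarrow> 'w \<Rightarrow> real" and d :: "nat \<Rightarrow> 'w \<Rightarrow> real" and K t :: real
  assumes r: "\<And>k. k < n \<Longrightarrow> r k \<in> borel \<rightarrow>\<^sub>M borel" "\<And>k. k < n \<Longrightarrow> integrable P (\<lambda>\<omega>. (norm (r k (u \<omega>)))\<^sup>2)"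
    and G: "\<And>j k. j < n \<Longrightarrow> k < n \<Longrightarrow> G j k \<in> borel_measurable input_algebra"
      "\<And>j k \<omega>. j < n \<Longrightarrow> k < n \<Longrightarrow> \<omega> \<in> space P \<Longrightarrow> \<bar>G j k \<omega>\<bar> \<le> K"
    and d: "\<And>k. k < n \<Longrightarrow> d k \<in> borel_measurable input_algebra" "\<And>k. k < n \<Longrightarrow> d k \<in> L2 P"
    and trace: "\<And>\<omega>. \<omega> \<in> space P \<Longrightarrow>
      (\<Sum>j<n. \<Sum>m=1..M. (norm (\<Sum>k<n. G j k \<omega> *\<^sub>R r k (us m \<omega>)))\<^sup>2) \<le> real M * t"
begin

definition truncated_noise :: "nat \<Rightarrow> nat \<Rightarrow> 'w \<Rightarrow> real" where
  "truncated_noise N k \<omega> =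
    1 / real M * (\<Sum>m=1..M. \<Sum>i\<in>basis_index D \<inter> {..N}. (r k (us m \<omega>) \<bullet> yb i) * \<epsilon>s m (yb i) \<omega>)"

lemma r_us_measurable: "k < n \<Longrightarrow> m \<in> {1..M} \<Longrightarrow> (\<lambda>\<omega>. r k (us m \<omega>)) \<in> input_algebra \<rightarrow>\<^sub>M borel"
  by (rule measurable_compose[OF us_input_measurable r(1)])

lemma r_us_integrable: "k < n \<Longrightarrow> m \<in> {1..M} \<Longrightarrow> integrable P (\<lambda>\<omega>. (norm (r k (us m \<omega>)))\<^sup>2)"
  using observation_integral_input(1)[of m "\<lambda>v. (norm (r k v))\<^sup>2"] r[of k] by simp

lemma truncated_noise_tendsto: "k < n \<Longrightarrow> L2_tendsto P (\<lambda>N. truncated_noise N k) (noise_vector r k)"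
  unfolding truncated_noise_def[abs_def] noise_vector_def[abs_def]
  by (intro L2_tendsto_cmult L2_tendsto_sum noise_pairing_tendsto r_us_measurable r_us_integrable)

lemma weighted_error_tendsto:
  assumes j: "j < n"
  shows "L2_tendsto P (\<lambda>N \<omega>. \<Sum>k<n. G j k \<omega> * (d k \<omega> + truncated_noise N k \<omega>))
    (\<lambda>\<omega>. \<Sum>k<n. G j k \<omega> * (d k \<omega> + noise_vector r k \<omega>))"
proof (intro L2_tendsto_sum L2_tendsto_bounded_mult)
  fix k assume k: "k \<in> {..<n}"
  then show "L2_tendsto P (\<lambda>N x. d k x + truncated_noise N k x) (\<lambda>x. d k x + noise_vector r k x)"
    by (intro L2_tendsto_add L2_tendsto_const d truncated_noise_tendsto) auto
  show "G j k \<in> borel_measurable P" using k by (intro input_measurableD G j) auto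
  show "\<bar>G j k x\<bar> \<le> K" if "x \<in> space P" for x using k by (intro G j that) auto
qed

text \<open>Applying row \<open>j\<close> of \<open>G\<close> to the noise amounts to testing the
  noise of sample m against the weighted feature \<open>w j m\<close>. Hence \<open>Y j\<close> is a
  finite noise sum with input coefficients, orthogonal to the bias part \<open>Z j\<close>; Bessel's
  inequality returns from the coordinates of \<open>w j m\<close> to its norm, and
  \<open>trace\<close> bounds the total.\<close>

lemma weighted_error_truncated:
  "(\<Sum>j<n. \<integral>\<omega>. (\<Sum>k<n. G j k \<omega> * (d k \<omega> + truncated_noise N k \<omega>))\<^sup>2 \<partial>P)
    \<le> (\<Sum>j<n. \<integral>\<omega>. (\<Sum>k<n. G j k \<omega> * d k \<omega>)\<^sup>2 \<partial>P) + \<sigma>\<^sup>2 * t / real M"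
proof -
  let ?J = "basis_index D \<inter> {..N}"
  have J: "finite ?J" "?J \<subseteq> basis_index D" by auto
  define w where "w j m \<omega> = (1 / real M) *\<^sub>R (\<Sum>k<n. G j k \<omega> *\<^sub>R r k (us m \<omega>))" for j m \<omega>
  define c where "c j m i \<omega> = w j m \<omega> \<bullet> yb i" for j m i \<omega>
  define Y where "Y j \<omega> = (\<Sum>m=1..M. \<Sum>i\<in>?J. c j m i \<omega> * \<epsilon>s m (yb i) \<omega>)" for j \<omega>
  define Z where "Z j \<omega> = (\<Sum>k<n. G j k \<omega> * d k \<omega>)" for j \<omega>
  have w_meas: "w j m \<in> borel_measurable input_algebra" if "j < n" "m \<in> {1..M}" for j m
    unfolding w_def using that
    by (intro borel_measurable_scaleR borel_measurable_const borel_measurable_sum G r_us_measurable) auto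
  \<comment> \<open>Here the uniform bound \<open>K\<close> is used: it dominates the norm of
    \<open>w j m\<close> by a combination of the square-integrable norms of the features.\<close>
  have w_int: "integrable P (\<lambda>\<omega>. (norm (w j m \<omega>))\<^sup>2)" if j: "j < n" and m: "m \<in> {1..M}" for j m
  proof (rule Bochner_Integration.integrable_bound)
    have "(\<lambda>\<omega>. norm (r k (us m \<omega>))) \<in> L2 P" if "k < n" for k
      using r_us_integrable[OF that m] input_measurableD[OF r_us_measurable[OF that m]] by (simp add: L2_def)
    then have "(\<lambda>\<omega>. 1 / real M * (\<Sum>k<n. K * norm (r k (us m \<omega>)))) \<in> L2 P"
      by (intro L2_cmult L2_sum) auto
    then show "integrable P (\<lambda>\<omega>. (1 / real M * (\<Sum>k<n. K * norm (r k (us m \<omega>))))\<^sup>2)" by (rule L2D)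
    show "(\<lambda>\<omega>. (norm (w j m \<omega>))\<^sup>2) \<in> borel_measurable P"
      using input_measurableD[OF w_meas[OF j m]] by simp
    show "AE \<omega> in P. norm ((norm (w j m \<omega>))\<^sup>2) \<le> norm ((1 / real M * (\<Sum>k<n. K * norm (r k (us m \<omega>))))\<^sup>2)"
    proof (rule AE_I2)
      fix \<omega> assume \<omega>: "\<omega> \<in> space P"
      have "norm (\<Sum>k<n. G j k \<omega> *\<^sub>R r k (us m \<omega>)) \<le> (\<Sum>k<n. K * norm (r k (us m \<omega>)))"
        using G(2)[OF j _ \<omega>] by (intro sum_norm_le) (auto intro: mult_right_mono)
      then have "norm (w j m \<omega>) \<le> 1 / real M * (\<Sum>k<n. K * norm (r k (us m \<omega>)))"
        using M by (simp add: w_def divide_right_mono)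
      then have "(norm (w j m \<omega>))\<^sup>2 \<le> (1 / real M * (\<Sum>k<n. K * norm (r k (us m \<omega>))))\<^sup>2"
        by (intro power_mono) auto
      then show "norm ((norm (w j m \<omega>))\<^sup>2) \<le> norm ((1 / real M * (\<Sum>k<n. K * norm (r k (us m \<omega>))))\<^sup>2)"
        by simp
    qed
  qed
  have c_meas: "c j m i \<in> borel_measurable input_algebra" if "j < n" "m \<in> {1..M}" for j m i
    unfolding c_def using w_meas[OF that] by simp
  have c_L2: "c j m i \<in> L2 P" if "j < n" "m \<in> {1..M}" "i \<in> ?J" for j m i
    unfolding c_def using that by (intro inner_basis_L2 w_int input_measurableD[OF w_meas]) auto
  have Z: "Z j \<in> borel_measurable input_algebra" "Z j \<in> L2 P" if "j < n" for j
  proof -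
    show "Z j \<in> borel_measurable input_algebra"
      unfolding Z_def using that G(1) d(1) by (intro borel_measurable_sum borel_measurable_times) auto
    show "Z j \<in> L2 P"
      unfolding Z_def using that by (intro L2_sum L2_bounded_mult[where K = K] d input_measurableD[OF G(1)] G(2)) auto
  qed
  have Y_L2: "Y j \<in> L2 P" if "j < n" for j
    unfolding Y_def using that by (intro random_noise_sum_L2[OF J] c_meas c_L2)
  have ZY: "(\<integral>\<omega>. Z j \<omega> * Y j \<omega> \<partial>P) = 0" if "j < n" for j
    unfolding Y_def using that by (intro random_noise_sum_orthogonal[OF J] c_meas c_L2 Z)
  have YY: "(\<integral>\<omega>. (Y j \<omega>)\<^sup>2 \<partial>P) \<le> \<sigma>\<^sup>2 * (\<Sum>m=1..M. \<integral>\<omega>. (norm (w j m \<omega>))\<^sup>2 \<partial>P)" if j: "j < n" for j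
  proof -
    have "(\<integral>\<omega>. (Y j \<omega>)\<^sup>2 \<partial>P) \<le> \<sigma>\<^sup>2 * (\<Sum>m=1..M. \<Sum>i\<in>?J. \<integral>\<omega>. (c j m i \<omega>)\<^sup>2 \<partial>P)"
      unfolding Y_def using j by (intro random_noise_sum_square[OF J] c_meas c_L2)
    also have "\<dots> \<le> \<sigma>\<^sup>2 * (\<Sum>m=1..M. \<integral>\<omega>. (norm (w j m \<omega>))\<^sup>2 \<partial>P)"
    proof (intro mult_left_mono sum_mono)
      fix m assume m: "m \<in> {1..M}"
      have "(\<Sum>i\<in>?J. \<integral>\<omega>. (c j m i \<omega>)\<^sup>2 \<partial>P) = (\<integral>\<omega>. (\<Sum>i\<in>?J. (c j m i \<omega>)\<^sup>2) \<partial>P)"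
        using L2D(2)[OF c_L2[OF j m]] by (intro Bochner_Integration.integral_sum[symmetric])
      also have "\<dots> \<le> (\<integral>\<omega>. (norm (w j m \<omega>))\<^sup>2 \<partial>P)"
        using L2D(2)[OF c_L2[OF j m]]
        by (intro integral_mono w_int j m Bochner_Integration.integrable_sum)
          (auto simp: c_def intro: orthonormal_Bessel[OF basis J])
      finally show "(\<Sum>i\<in>?J. \<integral>\<omega>. (c j m i \<omega>)\<^sup>2 \<partial>P) \<le> (\<integral>\<omega>. (norm (w j m \<omega>))\<^sup>2 \<partial>P)" .
    qed simp
    finally show ?thesis .
  qed
  \<comment> \<open>Linearity of the pairing in its argument is applied at a finite truncation,
    where it is an interchange of finite sums.\<close>
  have split: "(\<Sum>k<n. G j k \<omega> * (d k \<omega> + truncated_noise N k \<omega>)) = Z j \<omega> + Y j \<omega>" for j \<omega>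
  proof -
    have "Y j \<omega> = (\<Sum>m=1..M. \<Sum>i\<in>?J. \<Sum>k<n. G j k \<omega> * (1 / real M * ((r k (us m \<omega>) \<bullet> yb i) * \<epsilon>s m (yb i) \<omega>)))"
      unfolding Y_def c_def w_def
      by (simp add: inner_sum_left sum_distrib_left sum_distrib_right mult_ac divide_inverse)
    also have "\<dots> = (\<Sum>m=1..M. \<Sum>k<n. \<Sum>i\<in>?J. G j k \<omega> * (1 / real M * ((r k (us m \<omega>) \<bullet> yb i) * \<epsilon>s m (yb i) \<omega>)))"
      by (intro sum.cong refl sum.swap)
    also have "\<dots> = (\<Sum>k<n. \<Sum>m=1..M. \<Sum>i\<in>?J. G j k \<omega> * (1 / real M * ((r k (us m \<omega>) \<bullet> yb i) * \<epsilon>s m (yb i) \<omega>)))"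
      by (rule sum.swap)
    also have "\<dots> = (\<Sum>k<n. G j k \<omega> * truncated_noise N k \<omega>)"
      unfolding truncated_noise_def by (simp add: sum_distrib_left)
    finally show ?thesis by (simp add: Z_def sum.distrib distrib_left)
  qed
  have "(\<integral>\<omega>. (Z j \<omega> + Y j \<omega>)\<^sup>2 \<partial>P) \<le> (\<integral>\<omega>. (Z j \<omega>)\<^sup>2 \<partial>P) + \<sigma>\<^sup>2 * (\<Sum>m=1..M. \<integral>\<omega>. (norm (w j m \<omega>))\<^sup>2 \<partial>P)"
    if j: "j < n" for j
  proof -
    have "(\<integral>\<omega>. (Z j \<omega> + Y j \<omega>)\<^sup>2 \<partial>P) = (\<integral>\<omega>. (Z j \<omega>)\<^sup>2 + 2 * (Z j \<omega> * Y j \<omega>) + (Y j \<omega>)\<^sup>2 \<partial>P)"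
      by (simp add: power2_sum algebra_simps)
    also have "\<dots> = (\<integral>\<omega>. (Z j \<omega>)\<^sup>2 \<partial>P) + 2 * (\<integral>\<omega>. Z j \<omega> * Y j \<omega> \<partial>P) + (\<integral>\<omega>. (Y j \<omega>)\<^sup>2 \<partial>P)"
      using L2D(2)[OF Z(2)[OF j]] L2D(2)[OF Y_L2[OF j]] L2_mult_integrable[OF Z(2)[OF j] Y_L2[OF j]] by simp
    finally show ?thesis using ZY[OF j] YY[OF j] by simp
  qed
  then have "(\<Sum>j<n. \<integral>\<omega>. (Z j \<omega> + Y j \<omega>)\<^sup>2 \<partial>P)
    \<le> (\<Sum>j<n. (\<integral>\<omega>. (Z j \<omega>)\<^sup>2 \<partial>P) + \<sigma>\<^sup>2 * (\<Sum>m=1..M. \<integral>\<omega>. (norm (w j m \<omega>))\<^sup>2 \<partial>P))"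
    by (intro sum_mono) auto
  also have "\<dots> = (\<Sum>j<n. \<integral>\<omega>. (Z j \<omega>)\<^sup>2 \<partial>P) + \<sigma>\<^sup>2 * (\<Sum>j<n. \<Sum>m=1..M. \<integral>\<omega>. (norm (w j m \<omega>))\<^sup>2 \<partial>P)"
    by (simp add: sum.distrib sum_distrib_left)
  also have "(\<Sum>j<n. \<Sum>m=1..M. \<integral>\<omega>. (norm (w j m \<omega>))\<^sup>2 \<partial>P) = (\<Sum>j<n. \<integral>\<omega>. (\<Sum>m=1..M. (norm (w j m \<omega>))\<^sup>2) \<partial>P)"
    by (rule sum.cong[OF refl], rule Bochner_Integration.integral_sum[symmetric]) (intro w_int, auto)
  also have "\<dots> = (\<integral>\<omega>. (\<Sum>j<n. \<Sum>m=1..M. (norm (w j m \<omega>))\<^sup>2) \<partial>P)"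
    by (rule Bochner_Integration.integral_sum[symmetric]) (intro Bochner_Integration.integrable_sum w_int, auto)
  also have "\<dots> \<le> (\<integral>\<omega>. t / real M \<partial>P)"
  proof (rule integral_mono)
    show "integrable P (\<lambda>\<omega>. \<Sum>j<n. \<Sum>m=1..M. (norm (w j m \<omega>))\<^sup>2)"
      by (intro Bochner_Integration.integrable_sum w_int) auto
    fix \<omega> assume \<omega>: "\<omega> \<in> space P"
    have "(\<Sum>j<n. \<Sum>m=1..M. (norm (w j m \<omega>))\<^sup>2)
      = 1 / (real M)\<^sup>2 * (\<Sum>j<n. \<Sum>m=1..M. (norm (\<Sum>k<n. G j k \<omega> *\<^sub>R r k (us m \<omega>)))\<^sup>2)"
      unfolding sum_distrib_left w_def by (simp add: power_divide power_mult_distrib)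
    \<comment> \<open>One factor 1 / M^2 comes from the averaging inside \<open>w\<close> and one
      factor M from \<open>trace\<close>; the quotient is the rate 1 / M.\<close>
    also have "\<dots> \<le> 1 / (real M)\<^sup>2 * (real M * t)" using trace[OF \<omega>] by (intro mult_left_mono) auto
    finally show "(\<Sum>j<n. \<Sum>m=1..M. (norm (w j m \<omega>))\<^sup>2) \<le> t / real M"
      using M by (simp add: power2_eq_square)
  qed simp
  finally show ?thesis unfolding split Z_def by (simp add: prob_space mult_left_mono)
qed

text \<open>The bound for the truncations does not depend on \<open>N\<close> and so survives the
  mean-square limit.\<close>

lemma weighted_error:
  shows "j < n \<Longrightarrow> (\<lambda>\<omega>. \<Sum>k<n. G j k \<omega> * (d k \<omega> + noise_vector r k \<omega>)) \<in> L2 P"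
    and "(\<Sum>j<n. \<integral>\<omega>. (\<Sum>k<n. G j k \<omega> * (d k \<omega> + noise_vector r k \<omega>))\<^sup>2 \<partial>P)
    \<le> (\<Sum>j<n. \<integral>\<omega>. (\<Sum>k<n. G j k \<omega> * d k \<omega>)\<^sup>2 \<partial>P) + \<sigma>\<^sup>2 * t / real M"
proof -
  show "j < n \<Longrightarrow> (\<lambda>\<omega>. \<Sum>k<n. G j k \<omega> * (d k \<omega> + noise_vector r k \<omega>)) \<in> L2 P"
    using weighted_error_tendsto by (simp add: L2_tendsto_iff)
  have "(\<lambda>N. \<Sum>j<n. \<integral>\<omega>. (\<Sum>k<n. G j k \<omega> * (d k \<omega> + truncated_noise N k \<omega>))\<^sup>2 \<partial>P)
    \<longlonglongrightarrow> (\<Sum>j<n. \<integral>\<omega>. (\<Sum>k<n. G j k \<omega> * (d k \<omega> + noise_vector r k \<omega>))\<^sup>2 \<partial>P)"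
    by (intro tendsto_sum L2_tendsto_square weighted_error_tendsto) auto
  then show "(\<Sum>j<n. \<integral>\<omega>. (\<Sum>k<n. G j k \<omega> * (d k \<omega> + noise_vector r k \<omega>))\<^sup>2 \<partial>P)
    \<le> (\<Sum>j<n. \<integral>\<omega>. (\<Sum>k<n. G j k \<omega> * d k \<omega>)\<^sup>2 \<partial>P) + \<sigma>\<^sup>2 * t / real M"
    by (rule LIMSEQ_le_const2) (use weighted_error_truncated in auto)
qed

end
end

section \<open>The tail of the expansion\<close>

text \<open>The inner product of a partial sum with \<open>\<psi> k\<close> is constant once
  \<open>N \<ge> k\<close>. In particular the coefficients of an expansion are unique.\<close>

lemma L2_expansion_coeff:
  assumes orth: "\<forall>k\<ge>1. \<forall>l\<ge>1. L2_inner \<rho> (\<psi> k) (\<psi> l) = (if k = l then 1 else 0)"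
    and psi: "\<forall>k\<ge>1. \<psi> k \<in> L2 \<rho>"
    and ex: "L2_expansion \<rho> \<psi> \<theta> \<phi>" and k: "k \<ge> 1"
  shows "L2_inner \<rho> \<phi> (\<psi> k) = \<theta> k"
proof -
  have "(\<lambda>N. \<integral>s. (\<Sum>j=1..N. \<theta> j * \<psi> j s) * \<psi> k s \<partial>\<rho>) \<longlonglongrightarrow> (\<integral>s. \<phi> s * \<psi> k s \<partial>\<rho>)"
    using ex psi k unfolding L2_expansion_def by (intro L2_tendsto_inner) auto
  moreover have "(\<integral>s. (\<Sum>j=1..N. \<theta> j * \<psi> j s) * \<psi> k s \<partial>\<rho>) = \<theta> k" if "N \<ge> k" for N
  proof -
    have "(\<integral>s. (\<Sum>j=1..N. \<theta> j * \<psi> j s) * \<psi> k s \<partial>\<rho>) = (\<integral>s. (\<Sum>j=1..N. \<theta> j * (\<psi> j s * \<psi> k s)) \<partial>\<rho>)"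
      by (simp add: sum_distrib_right mult.assoc)
    also have "\<dots> = (\<Sum>j=1..N. \<theta> j * (\<integral>s. \<psi> j s * \<psi> k s \<partial>\<rho>))"
      using psi k by (subst Bochner_Integration.integral_sum) (auto intro!: L2_mult_integrable)
    also have "\<dots> = (\<Sum>j=1..N. if j = k then \<theta> j else 0)"
      using orth k by (intro sum.cong) (auto simp: L2_inner_def)
    finally show ?thesis using that k by simp
  qed
  then have "(\<lambda>N. \<integral>s. (\<Sum>j=1..N. \<theta> j * \<psi> j s) * \<psi> k s \<partial>\<rho>) \<longlonglongrightarrow> \<theta> k"
    by (intro tendsto_eventually eventually_sequentiallyI[of k]) auto
  ultimately show ?thesis unfolding L2_inner_def using LIMSEQ_unique by blast
qed

text \<open>For \<open>N \<ge> n\<close> the partial sums of the two expansions differ by the fixed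
  sum up to \<open>n\<close>, as do the two functions, so the approximation errors coincide.\<close>

lemma L2_expansion_tail:
  assumes ex: "L2_expansion \<rho> \<psi> \<theta> \<phi>" and psi: "\<forall>k\<ge>1. \<psi> k \<in> L2 \<rho>"
  shows "L2_expansion \<rho> \<psi> (\<lambda>k. if k \<le> n then 0 else \<theta> k) (\<lambda>s. \<phi> s - (\<Sum>k=1..n. \<theta> k * \<psi> k s))"
proof -
  let ?t = "\<lambda>k. if k \<le> n then 0 else \<theta> k" and ?S = "\<lambda>N s. \<Sum>k=1..N. \<theta> k * \<psi> k s"
  have split: "(\<Sum>k=1..N. ?t k * \<psi> k s) = ?S N s - ?S n s" if "N \<ge> n" for N s
  proof -
    have "?S N s = ?S n s + (\<Sum>k=n+1..N. \<theta> k * \<psi> k s)"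
      using that sum.ub_add_nat[of 1 n "\<lambda>k. \<theta> k * \<psi> k s" "N - n"] by simp
    moreover have "(\<Sum>k=1..N. ?t k * \<psi> k s) = (\<Sum>k=1..n. ?t k * \<psi> k s) + (\<Sum>k=n+1..N. ?t k * \<psi> k s)"
      using that sum.ub_add_nat[of 1 n "\<lambda>k. ?t k * \<psi> k s" "N - n"] by simp
    ultimately show ?thesis by simp
  qed
  have L: "(\<lambda>s. \<Sum>k=1..N. a k * \<psi> k s) \<in> L2 \<rho>" for N a
    using psi by (intro L2_sum L2_cmult) auto
  have E: "\<phi> \<in> L2 \<rho>" "(\<lambda>N. \<integral>s. (?S N s - \<phi> s)\<^sup>2 \<partial>\<rho>) \<longlonglongrightarrow> 0"
    using ex by (auto simp: L2_expansion_def L2_tendsto_iff)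
  have "(\<lambda>N. \<integral>s. ((\<Sum>k=1..N. ?t k * \<psi> k s) - (\<phi> s - ?S n s))\<^sup>2 \<partial>\<rho>) \<longlonglongrightarrow> 0"
  proof (rule Lim_transform_eventually[OF E(2)])
    show "\<forall>\<^sub>F N in sequentially. (\<integral>s. (?S N s - \<phi> s)\<^sup>2 \<partial>\<rho>)
        = (\<integral>s. ((\<Sum>k=1..N. ?t k * \<psi> k s) - (\<phi> s - ?S n s))\<^sup>2 \<partial>\<rho>)"
      by (rule eventually_sequentiallyI[of n]) (simp only: split, simp)
  qed
  then show ?thesis
    unfolding L2_expansion_def L2_tendsto_iff using L E(1) by (auto intro: L2_diff)
qed

lemma forward_operatorD:
  assumes "forward_operator \<rho> R"
  shows "f \<in> L2 \<rho> \<Longrightarrow> R f \<in> borel \<rightarrow>\<^sub>M borel"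
    and "f \<in> L2 \<rho> \<Longrightarrow> g \<in> L2 \<rho> \<Longrightarrow> R (\<lambda>s. f s + g s) v = R f v + R g v"
    and "f \<in> L2 \<rho> \<Longrightarrow> R (\<lambda>s. c * f s) v = c *\<^sub>R R f v"
proof -
  note R = assms[unfolded forward_operator_def]
  show "f \<in> L2 \<rho> \<Longrightarrow> R f \<in> borel \<rightarrow>\<^sub>M borel" by (rule R[THEN conjunct1, rule_format])
  show "f \<in> L2 \<rho> \<Longrightarrow> g \<in> L2 \<rho> \<Longrightarrow> R (\<lambda>s. f s + g s) v = R f v + R g v"
    by (rule R[THEN conjunct2, THEN conjunct2, THEN conjunct1, rule_format])
  show "f \<in> L2 \<rho> \<Longrightarrow> R (\<lambda>s. c * f s) v = c *\<^sub>R R f v"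
    by (rule R[THEN conjunct2, THEN conjunct2, THEN conjunct2, rule_format])
qed

lemma forward_operator_zero:
  assumes "forward_operator \<rho> R"
  shows "R (\<lambda>s. 0) v = 0"
  using forward_operatorD(3)[OF assms L2_zero, of 0 v] by simp

lemma forward_operator_sum:
  assumes R: "forward_operator \<rho> R" and f: "\<And>k. k \<in> K \<Longrightarrow> f k \<in> L2 \<rho>"
  shows "R (\<lambda>s. \<Sum>k\<in>K. a k * f k s) v = (\<Sum>k\<in>K. a k *\<^sub>R R (f k) v)"
  using f
proof (induction K rule: infinite_finite_induct)
  case (insert j K)
  have "R (\<lambda>s. a j * f j s + (\<Sum>k\<in>K. a k * f k s)) v = R (\<lambda>s. a j * f j s) v + R (\<lambda>s. \<Sum>k\<in>K. a k * f k s) v"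
    using insert.prems by (intro forward_operatorD(2)[OF R] L2_cmult L2_sum) auto
  moreover have "R (\<lambda>s. a j * f j s) v = a j *\<^sub>R R (f j) v"
    using insert.prems by (intro forward_operatorD(3)[OF R]) auto
  ultimately show ?case using insert by simp
qed (simp_all add: forward_operator_zero[OF R])

section \<open>The eigenfunctions, the Sobolev coefficients and the moments of the tail\<close>

locale spectral_setting =
  fixes \<rho> :: "'s measure" and P :: "'w measure"
    and R :: "('s \<Rightarrow> real) \<Rightarrow> 'x::banach \<Rightarrow> 'y::{real_inner, polish_space}" and u :: "'w \<Rightarrow> 'x"
    and T :: "('s \<Rightarrow> real) \<Rightarrow> ('s \<Rightarrow> real)" and lam :: "nat \<Rightarrow> real" and \<psi> :: "nat \<Rightarrow> 's \<Rightarrow> real"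
    and \<beta> L \<kappa> :: real and n :: nat and \<phi> :: "'s \<Rightarrow> real" and \<theta> :: "nat \<Rightarrow> real"
  assumes u: "u \<in> P \<rightarrow>\<^sub>M borel" and R: "forward_operator \<rho> R" and T: "normal_operator \<rho> P R u T"
    and sa: "L2_self_adjoint \<rho> T" and es: "positive_eigensystem \<rho> T lam \<psi>"
    and \<beta>: "\<beta> > 0" and n: "n \<ge> 1" and \<kappa>: "\<kappa> \<ge> 1"
    and fm: "fourth_moment_condition P R u (sobolev_space \<rho> lam \<psi> \<beta>) \<kappa>"
    and ball: "\<phi> \<in> sobolev_ball \<rho> lam \<psi> \<beta> L" and ex: "L2_expansion \<rho> \<psi> \<theta> \<phi>"
begin

text \<open>The \<zeta> of the overview.\<close>

definition tail :: "'s \<Rightarrow> real" where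
  "tail s = \<phi> s - (\<Sum>k=1..n. \<theta> k * \<psi> k s)"

lemma psi_L2: "k \<ge> 1 \<Longrightarrow> \<psi> k \<in> L2 \<rho>"
  and lam_pos: "k \<ge> 1 \<Longrightarrow> lam k > 0"
  and psi_orth: "k \<ge> 1 \<Longrightarrow> l \<ge> 1 \<Longrightarrow> L2_inner \<rho> (\<psi> k) (\<psi> l) = (if k = l then 1 else 0)"
  using es by (auto simp: positive_eigensystem_def)

lemma lam_antimono:
  assumes "1 \<le> k" "k \<le> l"
  shows "lam l \<le> lam k"
  using assms(2)
proof (induction l rule: dec_induct)
  case (step l)
  have "lam (Suc l) \<le> lam l" using es step assms(1) by (simp add: positive_eigensystem_def)
  then show ?case using step by simp
qed simp

lemma T_L2: "f \<in> L2 \<rho> \<Longrightarrow> T f \<in> L2 \<rho>"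
  using T by (auto simp: normal_operator_def L2_linear_operator_def)

lemma T_inner: "f \<in> L2 \<rho> \<Longrightarrow> g \<in> L2 \<rho> \<Longrightarrow> L2_inner \<rho> (T f) g = (\<integral>\<omega>. R f (u \<omega>) \<bullet> R g (u \<omega>) \<partial>P)"
  and R_inner_integrable: "f \<in> L2 \<rho> \<Longrightarrow> g \<in> L2 \<rho> \<Longrightarrow> integrable P (\<lambda>\<omega>. R f (u \<omega>) \<bullet> R g (u \<omega>))"
  using T by (auto simp: normal_operator_def)

lemma T_psi_inner:
  assumes "k \<ge> 1" "g \<in> L2 \<rho>"
  shows "L2_inner \<rho> (T (\<psi> k)) g = lam k * L2_inner \<rho> (\<psi> k) g"
proof -
  have "AE s in \<rho>. T (\<psi> k) s = lam k * \<psi> k s" using es assms by (auto simp: positive_eigensystem_def)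
  then have "L2_inner \<rho> (T (\<psi> k)) g = (\<integral>s. lam k * (\<psi> k s * g s) \<partial>\<rho>)"
    unfolding L2_inner_def using L2D(1)[OF T_L2[OF psi_L2[OF assms(1)]]] L2D(1)[OF psi_L2[OF assms(1)]] L2D(1)[OF assms(2)]
    by (intro integral_cong_AE) auto
  then show ?thesis by (simp add: L2_inner_def)
qed

lemma phi_L2: "\<phi> \<in> L2 \<rho>"
  using ball by (auto simp: sobolev_ball_def)

lemma tail_L2: "tail \<in> L2 \<rho>"
  unfolding tail_def using phi_L2 psi_L2 by (intro L2_diff L2_sum L2_cmult) auto

lemma coeff: "L2_expansion \<rho> \<psi> \<eta> f \<Longrightarrow> k \<ge> 1 \<Longrightarrow> L2_inner \<rho> f (\<psi> k) = \<eta> k"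
  using psi_L2 psi_orth by (intro L2_expansion_coeff) auto

text \<open>Membership in the ball provides the bound for some expansion; by uniqueness of the
  coefficients it is the given one.\<close>

lemma theta_summable:
  "summable (\<lambda>k. lam (Suc k) powr (-\<beta>) * (\<theta> (Suc k))\<^sup>2)"
  "(\<Sum>k. lam (Suc k) powr (-\<beta>) * (\<theta> (Suc k))\<^sup>2) \<le> L\<^sup>2"
proof -
  obtain \<eta> where \<eta>: "L2_expansion \<rho> \<psi> \<eta> \<phi>" "summable (\<lambda>k. lam (Suc k) powr (-\<beta>) * (\<eta> (Suc k))\<^sup>2)"
     "(\<Sum>k. lam (Suc k) powr (-\<beta>) * (\<eta> (Suc k))\<^sup>2) \<le> L\<^sup>2"
    using ball by (auto simp: sobolev_ball_def)
  have "\<eta> (Suc k) = \<theta> (Suc k)" for k using coeff[OF \<eta>(1), of "Suc k"] coeff[OF ex, of "Suc k"] by simp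
  then show "summable (\<lambda>k. lam (Suc k) powr (-\<beta>) * (\<theta> (Suc k))\<^sup>2)"
    "(\<Sum>k. lam (Suc k) powr (-\<beta>) * (\<theta> (Suc k))\<^sup>2) \<le> L\<^sup>2" using \<eta> by simp_all
qed

lemma tail_expansion: "L2_expansion \<rho> \<psi> (\<lambda>k. if k \<le> n then 0 else \<theta> k) tail"
  unfolding tail_def[abs_def] using psi_L2 by (intro L2_expansion_tail ex) auto

text \<open>The fourth-moment condition is available only on the Sobolev space, so the tail has to
  be placed there before its moments can be bounded.\<close>

lemma tail_sobolev: "tail \<in> sobolev_space \<rho> lam \<psi> \<beta>"
proof -
  have "summable (\<lambda>k. lam (Suc k) powr (-\<beta>) * (if Suc k \<le> n then 0 else \<theta> (Suc k))\<^sup>2)"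
    by (rule summable_comparison_test'[OF theta_summable(1), of 0]) auto
  with tail_expansion tail_L2 show ?thesis unfolding sobolev_space_def by blast
qed

text \<open>Opens the fourth-moment condition to the eigenfunctions; the coefficients are a
  Kronecker delta, so the Sobolev series has a single nonzero term.\<close>

lemma psi_sobolev:
  assumes "k \<ge> 1"
  shows "\<psi> k \<in> sobolev_space \<rho> lam \<psi> \<beta>"
proof -
  let ?d = "\<lambda>j. if j = k then 1 else 0 :: real"
  have *: "(\<Sum>j=1..N. ?d j * \<psi> j s) = (if k \<le> N then \<psi> k s else 0)" for N s
  proof -
    have "(\<Sum>j=1..N. ?d j * \<psi> j s) = (\<Sum>j=1..N. if j = k then \<psi> k s else 0)" by (intro sum.cong) auto
    then show ?thesis using assms by auto
  qed
  have "L2_expansion \<rho> \<psi> ?d (\<psi> k)"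
    unfolding L2_expansion_def L2_tendsto_iff *
  proof (intro conjI allI)
    show "(\<lambda>s. if k \<le> N then \<psi> k s else 0) \<in> L2 \<rho>" for N
      using psi_L2[OF assms] L2_zero by (cases "k \<le> N") auto
  qed (use psi_L2[OF assms] in \<open>auto intro!: tendsto_eventually eventually_sequentiallyI[of k]\<close>)
  moreover have "summable (\<lambda>j. lam (Suc j) powr (-\<beta>) * (?d (Suc j))\<^sup>2)"
    by (rule summable_finite[of "{k - 1}"]) auto
  ultimately show ?thesis unfolding sobolev_space_def using psi_L2[OF assms] by blast
qed

text \<open>The forward operator is linear with no continuity assumed, so only the first
  \<open>n\<close> terms are split off and the infinite remainder stays inside one argument.\<close>

lemma R_phi: "R \<phi> v = R tail v + (\<Sum>k=1..n. \<theta> k *\<^sub>R R (\<psi> k) v)"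
proof -
  have "\<phi> = (\<lambda>s. tail s + (\<Sum>k=1..n. \<theta> k * \<psi> k s))" by (simp add: tail_def)
  then have "R \<phi> v = R (\<lambda>s. tail s + (\<Sum>k=1..n. \<theta> k * \<psi> k s)) v" by simp
  also have "\<dots> = R tail v + R (\<lambda>s. \<Sum>k=1..n. \<theta> k * \<psi> k s) v"
    using psi_L2 by (intro forward_operatorD(2)[OF R] tail_L2 L2_sum L2_cmult) auto
  also have "R (\<lambda>s. \<Sum>k=1..n. \<theta> k * \<psi> k s) v = (\<Sum>k=1..n. \<theta> k *\<^sub>R R (\<psi> k) v)"
    using psi_L2 by (intro forward_operator_sum[OF R]) auto
  finally show ?thesis .
qed

lemma R_psi_norm: "k \<ge> 1 \<Longrightarrow> (\<integral>\<omega>. (norm (R (\<psi> k) (u \<omega>)))\<^sup>2 \<partial>P) = lam k"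
  using T_inner[OF psi_L2 psi_L2, of k k] T_psi_inner[OF _ psi_L2, of k k] psi_orth[of k k]
  by (simp add: power2_norm_eq_inner)

lemma R_tail_psi: "1 \<le> k \<Longrightarrow> k \<le> n \<Longrightarrow> (\<integral>\<omega>. R tail (u \<omega>) \<bullet> R (\<psi> k) (u \<omega>) \<partial>P) = 0"
proof -
  assume k: "1 \<le> k" "k \<le> n"
  have "(\<integral>\<omega>. R tail (u \<omega>) \<bullet> R (\<psi> k) (u \<omega>) \<partial>P) = L2_inner \<rho> (T (\<psi> k)) tail"
    using T_inner[OF psi_L2[OF k(1)] tail_L2] by (simp add: inner_commute)
  also have "\<dots> = lam k * L2_inner \<rho> tail (\<psi> k)"
    using T_psi_inner[OF k(1) tail_L2] by (simp add: L2_inner_def mult.commute)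
  also have "\<dots> = 0" using coeff[OF tail_expansion k(1)] k by simp
  finally show ?thesis .
qed

text \<open>The quantity is <T tail, tail>, formally the sum of lam_k theta_k^2 over k > n. Only one
  of the two occurrences of \<open>tail\<close> is expanded, with \<open>T tail\<close> held fixed,
  and self-adjointness moves \<open>T\<close> onto the eigenfunctions; no limit is taken inside
  \<open>T\<close>.\<close>

lemma R_tail_norm: "(\<integral>\<omega>. (norm (R tail (u \<omega>)))\<^sup>2 \<partial>P) \<le> lam n powr (1 + \<beta>) * L\<^sup>2"
proof -
  let ?t = "\<lambda>k. if k \<le> n then 0 else \<theta> k"
  let ?a = "\<lambda>k. lam (Suc k) powr (-\<beta>) * (\<theta> (Suc k))\<^sup>2"
  have lim: "(\<lambda>N. \<integral>s. (\<Sum>k=1..N. ?t k * \<psi> k s) * T tail s \<partial>\<rho>) \<longlonglongrightarrow> (\<integral>s. tail s * T tail s \<partial>\<rho>)"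
    using tail_expansion unfolding L2_expansion_def by (rule L2_tendsto_inner) (intro T_L2 tail_L2)
  have "(\<integral>s. (\<Sum>k=1..N. ?t k * \<psi> k s) * T tail s \<partial>\<rho>) \<le> lam n powr (1 + \<beta>) * L\<^sup>2" for N
  proof -
    have "(\<integral>s. (\<Sum>k=1..N. ?t k * \<psi> k s) * T tail s \<partial>\<rho>) = (\<integral>s. (\<Sum>k=1..N. ?t k * (\<psi> k s * T tail s)) \<partial>\<rho>)"
      by (simp add: sum_distrib_right mult.assoc)
    also have "\<dots> = (\<Sum>k=1..N. \<integral>s. ?t k * (\<psi> k s * T tail s) \<partial>\<rho>)"
      using psi_L2 T_L2[OF tail_L2]
      by (intro Bochner_Integration.integral_sum integrable_mult_right L2_mult_integrable) auto
    also have "\<dots> = (\<Sum>k=1..N. ?t k * L2_inner \<rho> (\<psi> k) (T tail))"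
      unfolding L2_inner_def by simp
    also have "\<dots> = (\<Sum>k=1..N. lam k * (?t k)\<^sup>2)"
    proof (rule sum.cong[OF refl])
      fix k assume "k \<in> {1..N}"
      then have k: "k \<ge> 1" by simp
      have "L2_inner \<rho> (\<psi> k) (T tail) = L2_inner \<rho> (T (\<psi> k)) tail"
        using sa psi_L2[OF k] tail_L2 by (simp add: L2_self_adjoint_def)
      also have "\<dots> = lam k * L2_inner \<rho> tail (\<psi> k)"
        using T_psi_inner[OF k tail_L2] by (simp add: L2_inner_def mult.commute)
      also have "L2_inner \<rho> tail (\<psi> k) = ?t k" by (rule coeff[OF tail_expansion k])
      finally show "?t k * L2_inner \<rho> (\<psi> k) (T tail) = lam k * (?t k)\<^sup>2" by (simp add: power2_eq_square)
    qed
    also have "\<dots> \<le> (\<Sum>k=1..N. lam n powr (1 + \<beta>) * (lam k powr (-\<beta>) * (\<theta> k)\<^sup>2))"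
    proof (rule sum_mono)
      fix k assume "k \<in> {1..N}"
      then have k: "k \<ge> 1" by simp
      show "lam k * (?t k)\<^sup>2 \<le> lam n powr (1 + \<beta>) * (lam k powr (-\<beta>) * (\<theta> k)\<^sup>2)"
      proof (cases "k \<le> n")
        case False
        \<comment> \<open>The factor lam_k^-beta is kept for the Sobolev norm; the rest is at most
          lam_n^(1+beta), since the eigenvalues decrease and k exceeds n.\<close>
        have "lam k = lam k powr (1 + \<beta>) * lam k powr (-\<beta>)"
          using lam_pos[OF k] by (simp flip: powr_add)
        also have "\<dots> \<le> lam n powr (1 + \<beta>) * lam k powr (-\<beta>)"
          using lam_antimono[of n k] n False lam_pos[OF k] \<beta> by (intro mult_right_mono powr_mono2) auto
        finally have "lam k * (\<theta> k)\<^sup>2 \<le> lam n powr (1 + \<beta>) * lam k powr (-\<beta>) * (\<theta> k)\<^sup>2"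
          by (rule mult_right_mono) simp
        then show ?thesis using False by (simp add: mult.assoc)
      qed simp
    qed
    also have "\<dots> = lam n powr (1 + \<beta>) * (\<Sum>k<N. ?a k)"
      by (simp add: sum_distrib_left sum.atLeast1_atMost_eq)
    also have "\<dots> \<le> lam n powr (1 + \<beta>) * L\<^sup>2"
      using sum_le_suminf[OF theta_summable(1), of "{..<N}"] theta_summable(2)
      by (intro mult_left_mono) auto
    finally show ?thesis .
  qed
  with lim have "(\<integral>s. tail s * T tail s \<partial>\<rho>) \<le> lam n powr (1 + \<beta>) * L\<^sup>2"
    by (intro LIMSEQ_le_const2[OF lim]) auto
  moreover have "(\<integral>\<omega>. (norm (R tail (u \<omega>)))\<^sup>2 \<partial>P) = (\<integral>s. tail s * T tail s \<partial>\<rho>)"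
    using T_inner[OF tail_L2 tail_L2] by (simp add: L2_inner_def power2_norm_eq_inner mult.commute)
  ultimately show ?thesis by simp
qed

lemma R_measurable: "f \<in> L2 \<rho> \<Longrightarrow> R f \<in> borel \<rightarrow>\<^sub>M borel"
  by (rule forward_operatorD(1)[OF R])

lemma R_u_measurable: "f \<in> L2 \<rho> \<Longrightarrow> (\<lambda>\<omega>. R f (u \<omega>)) \<in> P \<rightarrow>\<^sub>M borel"
  by (rule measurable_compose[OF u R_measurable])

text \<open>Cauchy-Schwarz is used twice: pointwise for the inner product of the two outputs, then
  in mean for their squared norms, which produces fourth moments. Each fourth moment brings one
  kappa, so taking the square root leaves a single kappa.\<close>

lemma R_tail_psi_square:
  assumes k: "k \<ge> 1"
  shows "(\<lambda>\<omega>. R tail (u \<omega>) \<bullet> R (\<psi> k) (u \<omega>)) \<in> L2 P"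
    and "(\<integral>\<omega>. (R tail (u \<omega>) \<bullet> R (\<psi> k) (u \<omega>))\<^sup>2 \<partial>P) \<le> \<kappa> * lam k * (lam n powr (1 + \<beta>) * L\<^sup>2)"
proof -
  let ?f = "\<lambda>\<omega>. (norm (R tail (u \<omega>)))\<^sup>2" and ?g = "\<lambda>\<omega>. (norm (R (\<psi> k) (u \<omega>)))\<^sup>2"
  note [measurable] = R_u_measurable[OF tail_L2] R_u_measurable[OF psi_L2[OF k]]
  have sq: "(a\<^sup>2)\<^sup>2 = a ^ 4" for a :: real by (simp add: power_mult[symmetric])
  have f: "?f \<in> L2 P" "(\<integral>\<omega>. (?f \<omega>)\<^sup>2 \<partial>P) \<le> \<kappa> * (\<integral>\<omega>. ?f \<omega> \<partial>P)\<^sup>2"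
    using fm tail_sobolev unfolding fourth_moment_condition_def L2_def sq by auto
  have g: "?g \<in> L2 P" "(\<integral>\<omega>. (?g \<omega>)\<^sup>2 \<partial>P) \<le> \<kappa> * (\<integral>\<omega>. ?g \<omega> \<partial>P)\<^sup>2"
    using fm psi_sobolev[OF k] unfolding fourth_moment_condition_def L2_def sq by auto
  have le: "(R tail v \<bullet> R (\<psi> k) v)\<^sup>2 \<le> (norm (R tail v))\<^sup>2 * (norm (R (\<psi> k) v))\<^sup>2" for v
    using Cauchy_Schwarz_ineq[of "R tail v" "R (\<psi> k) v"] by (simp add: power2_norm_eq_inner)
  have int: "integrable P (\<lambda>\<omega>. (R tail (u \<omega>) \<bullet> R (\<psi> k) (u \<omega>))\<^sup>2)"
    by (rule Bochner_Integration.integrable_bound[OF L2_mult_integrable[OF f(1) g(1)]]) (use le in auto)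
  then show "(\<lambda>\<omega>. R tail (u \<omega>) \<bullet> R (\<psi> k) (u \<omega>)) \<in> L2 P" by (simp add: L2_def)
  let ?F = "\<integral>\<omega>. ?f \<omega> \<partial>P" and ?G = "\<integral>\<omega>. ?g \<omega> \<partial>P"
  have "(\<integral>\<omega>. (?f \<omega>)\<^sup>2 \<partial>P) * (\<integral>\<omega>. (?g \<omega>)\<^sup>2 \<partial>P) \<le> (\<kappa> * ?F\<^sup>2) * (\<kappa> * ?G\<^sup>2)"
    using \<kappa> by (intro mult_mono f(2) g(2)) auto
  with L2_Cauchy_Schwarz[OF f(1) g(1)]
  have "(\<integral>\<omega>. ?f \<omega> * ?g \<omega> \<partial>P)\<^sup>2 \<le> (\<kappa> * ?F\<^sup>2) * (\<kappa> * ?G\<^sup>2)" by (rule order_trans)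
  also have "\<dots> = (\<kappa> * (?F * ?G))\<^sup>2" by (simp add: power2_eq_square)
  finally have "(\<integral>\<omega>. ?f \<omega> * ?g \<omega> \<partial>P) \<le> \<kappa> * (?F * ?G)"
    by (rule power2_le_imp_le) (use \<kappa> in auto)
  also have "\<dots> \<le> \<kappa> * ((lam n powr (1 + \<beta>) * L\<^sup>2) * lam k)"
    using R_tail_norm R_psi_norm[OF k] lam_pos[OF k] \<kappa> by (intro mult_left_mono mult_mono) auto
  finally have "(\<integral>\<omega>. ?f \<omega> * ?g \<omega> \<partial>P) \<le> \<kappa> * lam k * (lam n powr (1 + \<beta>) * L\<^sup>2)" by (simp add: mult_ac)
  moreover have "(\<integral>\<omega>. (R tail (u \<omega>) \<bullet> R (\<psi> k) (u \<omega>))\<^sup>2 \<partial>P) \<le> (\<integral>\<omega>. ?f \<omega> * ?g \<omega> \<partial>P)"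
    using le by (intro integral_mono int L2_mult_integrable f g) auto
  ultimately show "(\<integral>\<omega>. (R tail (u \<omega>) \<bullet> R (\<psi> k) (u \<omega>))\<^sup>2 \<partial>P) \<le> \<kappa> * lam k * (lam n powr (1 + \<beta>) * L\<^sup>2)"
    by linarith
qed

end

section \<open>The estimator\<close>

lemma det_measurable:
  fixes F :: "'w \<Rightarrow> real mat"
  assumes F: "\<And>\<omega>. F \<omega> \<in> carrier_mat n n"
    and m: "\<And>i j. i < n \<Longrightarrow> j < n \<Longrightarrow> (\<lambda>\<omega>. F \<omega> $$ (i,j)) \<in> borel_measurable N"
  shows "(\<lambda>\<omega>. det (F \<omega>)) \<in> borel_measurable N"
  unfolding det_def'[OF F]
proof (intro borel_measurable_sum borel_measurable_times borel_measurable_const borel_measurable_prod m)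
  fix p i assume "p \<in> {p. p permutes {0..<n}}" "i \<in> {0..<n}"
  then show "p i < n" using permutes_in_image[of p "{0..<n}" i] by auto
qed auto

text \<open>An entry of the adjugate is a signed minor with the two indices exchanged, hence again a
  determinant in entries of the matrix; the conditionals describe the indices after deletion of a
  row and a column.\<close>

lemma adj_mat_measurable:
  fixes F :: "'w \<Rightarrow> real mat"
  assumes F: "\<And>\<omega>. F \<omega> \<in> carrier_mat n n"
    and m: "\<And>i j. i < n \<Longrightarrow> j < n \<Longrightarrow> (\<lambda>\<omega>. F \<omega> $$ (i,j)) \<in> borel_measurable N"
    and ij: "i < n" "j < n"
  shows "(\<lambda>\<omega>. adj_mat (F \<omega>) $$ (i,j)) \<in> borel_measurable N"
proof -
  have "(\<lambda>\<omega>. det (mat_delete (F \<omega>) j i)) \<in> borel_measurable N"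
  proof (rule det_measurable[where n = "n - 1"])
    show "mat_delete (F \<omega>) j i \<in> carrier_mat (n - 1) (n - 1)" for \<omega>
      using F[of \<omega>] by (intro mat_delete_carrier)
    fix k l assume kl: "k < n - 1" "l < n - 1"
    have "mat_delete (F \<omega>) j i $$ (k,l) = F \<omega> $$ (if k < j then k else Suc k, if l < i then l else Suc l)" for \<omega>
      using F[of \<omega>] kl by (simp add: mat_delete_def)
    then show "(\<lambda>\<omega>. mat_delete (F \<omega>) j i $$ (k,l)) \<in> borel_measurable N"
      using kl by (simp only:) (intro m, auto)
  qed
  moreover have "adj_mat (F \<omega>) $$ (i,j) = (-1) ^ (j + i) * det (mat_delete (F \<omega>) j i)" for \<omega>
    using F[of \<omega>] ij by (simp add: adj_mat_def cofactor_def)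
  ultimately show ?thesis by simp
qed

section \<open>The error of the estimator on the event\<close>

locale kernel_estimation =
  noisy_sample_moments P u \<epsilon> M us \<epsilon>s \<sigma> D yb + spectral_setting \<rho> P R u T lam \<psi> \<beta> L \<kappa> n \<phi> \<theta>
  for P :: "'w measure" and u :: "'w \<Rightarrow> 'x::banach" and \<epsilon> :: "'y::{real_inner, polish_space} \<Rightarrow> 'w \<Rightarrow> real"
    and M :: nat and us \<epsilon>s and \<sigma> :: real and D :: enat and yb :: "nat \<Rightarrow> 'y" and \<rho> :: "'s measure"
    and R :: "('s \<Rightarrow> real) \<Rightarrow> 'x \<Rightarrow> 'y" and T lam \<psi> and \<beta> L \<kappa> :: real and n :: nat and \<phi> \<theta>
begin

abbreviation "A \<equiv> normal_matrix R \<psi> us n M"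
abbreviation "b \<equiv> normal_vector P D yb R \<psi> \<phi> us \<epsilon>s n M"

text \<open>Absorbs the shift between matrix indices, which start at 0, and eigenfunctions, which
  start at 1.\<close>

definition feature :: "nat \<Rightarrow> 'x \<Rightarrow> 'y" where
  "feature k = R (\<psi> (Suc k))"

text \<open>The vector d of the overview.\<close>

definition bias :: "nat \<Rightarrow> 'w \<Rightarrow> real" where
  "bias k \<omega> = 1 / real M * (\<Sum>m=1..M. R tail (us m \<omega>) \<bullet> feature k (us m \<omega>))"

lemma A_carrier: "A \<omega> \<in> carrier_mat n n"
  by (simp add: normal_matrix_def)

lemma A_entry: "i < n \<Longrightarrow> j < n \<Longrightarrow>
    A \<omega> $$ (i,j) = 1 / real M * (\<Sum>m=1..M. feature i (us m \<omega>) \<bullet> feature j (us m \<omega>))"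
  by (simp add: normal_matrix_def feature_def)

lemma A_symmetric: "transpose_mat (A \<omega>) = A \<omega>"
  by (rule eq_matI) (auto simp: normal_matrix_def inner_commute)

lemma feature_measurable: "feature k \<in> borel \<rightarrow>\<^sub>M borel"
  unfolding feature_def by (intro R_measurable psi_L2) simp

lemma feature_us_measurable: "m \<in> {1..M} \<Longrightarrow> (\<lambda>\<omega>. feature k (us m \<omega>)) \<in> borel_measurable input_algebra"
  by (rule measurable_compose[OF us_input_measurable feature_measurable])

lemma tail_us_measurable: "m \<in> {1..M} \<Longrightarrow> (\<lambda>\<omega>. R tail (us m \<omega>)) \<in> borel_measurable input_algebra"
  by (rule measurable_compose[OF us_input_measurable R_measurable[OF tail_L2]])

lemma A_measurable: "i < n \<Longrightarrow> j < n \<Longrightarrow> (\<lambda>\<omega>. A \<omega> $$ (i,j)) \<in> borel_measurable input_algebra"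
  unfolding A_entry
  by (intro borel_measurable_times borel_measurable_const borel_measurable_sum borel_measurable_inner feature_us_measurable)

lemma bias_measurable: "bias k \<in> borel_measurable input_algebra"
  unfolding bias_def
  by (intro borel_measurable_times borel_measurable_const borel_measurable_sum borel_measurable_inner
      feature_us_measurable tail_us_measurable)

text \<open>For \<open>k < n\<close> the averaged variables are centred, since the tail is
  orthogonal to the first \<open>n\<close> eigenfunctions; averaging then divides the second moment
  by M.\<close>

lemma bias_square:
  assumes k: "k < n"
  shows "bias k \<in> L2 P"
    and "(\<integral>\<omega>. (bias k \<omega>)\<^sup>2 \<partial>P) \<le> \<kappa> * lam (Suc k) * (lam n powr (1 + \<beta>) * L\<^sup>2) / real M"
proof -
  let ?g = "\<lambda>v. R tail v \<bullet> feature k v"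
  have g: "?g \<in> borel \<rightarrow>\<^sub>M borel"
    by (intro borel_measurable_inner R_measurable tail_L2 feature_measurable)
  have gL: "(\<lambda>\<omega>. ?g (u \<omega>)) \<in> L2 P" "(\<integral>\<omega>. (?g (u \<omega>))\<^sup>2 \<partial>P) \<le> \<kappa> * lam (Suc k) * (lam n powr (1 + \<beta>) * L\<^sup>2)"
    using R_tail_psi_square[of "Suc k"] by (simp_all add: feature_def)
  have g0: "(\<integral>\<omega>. ?g (u \<omega>) \<partial>P) = 0" using R_tail_psi[of "Suc k"] k by (simp add: feature_def)
  show "bias k \<in> L2 P" unfolding bias_def by (rule sample_mean_square(1)[OF g gL(1) g0])
  show "(\<integral>\<omega>. (bias k \<omega>)\<^sup>2 \<partial>P) \<le> \<kappa> * lam (Suc k) * (lam n powr (1 + \<beta>) * L\<^sup>2) / real M"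
    unfolding bias_def sample_mean_square(2)[OF g gL(1) g0] using gL(2) by (intro divide_right_mono) auto
qed

lemma b_decomposition:
  assumes k: "k < n"
  shows "vec_index (b \<omega>) k = (\<Sum>l<n. A \<omega> $$ (k,l) * \<theta> (Suc l)) + (bias k \<omega> + noise_vector feature k \<omega>)"
proof -
  have "R \<phi> v \<bullet> feature k v = R tail v \<bullet> feature k v + (\<Sum>l<n. \<theta> (Suc l) * (feature k v \<bullet> feature l v))" for v
    unfolding R_phi inner_add_left inner_sum_left feature_def One_nat_def sum.atLeast1_atMost_eq
    by (intro arg_cong2[where f = "(+)"] sum.cong refl) (simp add: inner_commute)
  then have "vec_index (b \<omega>) k = 1 / real M * (\<Sum>m=1..M. R tail (us m \<omega>) \<bullet> feature k (us m \<omega>)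
      + (\<Sum>l<n. \<theta> (Suc l) * (feature k (us m \<omega>) \<bullet> feature l (us m \<omega>)))
      + noise_pairing P D yb (\<epsilon>s m) (\<lambda>\<omega>. feature k (us m \<omega>)) \<omega>)"
    using k by (simp add: normal_vector_def data_pairing_def feature_def)
  also have "\<dots> = bias k \<omega> + 1 / real M * (\<Sum>m=1..M. \<Sum>l<n. \<theta> (Suc l) * (feature k (us m \<omega>) \<bullet> feature l (us m \<omega>)))
      + noise_vector feature k \<omega>"
    by (simp only: sum.distrib distrib_left bias_def noise_vector_def)
  also have "(\<Sum>m=1..M. \<Sum>l<n. \<theta> (Suc l) * (feature k (us m \<omega>) \<bullet> feature l (us m \<omega>)))
      = (\<Sum>l<n. \<theta> (Suc l) * (\<Sum>m=1..M. feature k (us m \<omega>) \<bullet> feature l (us m \<omega>)))"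
    by (subst sum.swap) (simp add: sum_distrib_left)
  also have "1 / real M * \<dots> = (\<Sum>l<n. A \<omega> $$ (k,l) * \<theta> (Suc l))"
    using k by (subst sum_distrib_left) (simp add: A_entry mult_ac)
  finally show ?thesis by simp
qed

lemma estimation_error_inverse:
  assumes B: "B \<in> carrier_mat n n" "A \<omega> * B = 1\<^sub>m n" "B * A \<omega> = 1\<^sub>m n"
  shows "estimation_error n (A \<omega>) (b \<omega>) \<theta> =
    (\<Sum>i<n. (\<Sum>k<n. B $$ (i,k) * (bias k \<omega> + noise_vector feature k \<omega>))\<^sup>2)"
proof -
  have inv: "mat_inverse (A \<omega>) = Some B" by (rule mat_inverse_eq_adj_mat[OF A_carrier B])
  have bd: "dim_vec (b \<omega>) = n" by (simp add: normal_vector_def)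
  have "vec_index (B *\<^sub>v b \<omega> - Matrix.vec n (\<lambda>i. \<theta> (Suc i))) i
      = (\<Sum>k<n. B $$ (i,k) * (bias k \<omega> + noise_vector feature k \<omega>))" if i: "i < n" for i
  proof -
    have "vec_index (B *\<^sub>v b \<omega>) i = (\<Sum>k<n. B $$ (i,k) * vec_index (b \<omega>) k)"
      using B(1) i bd by (simp add: scalar_prod_def atLeast0LessThan)
    also have "\<dots> = (\<Sum>k<n. B $$ (i,k) * (\<Sum>l<n. A \<omega> $$ (k,l) * \<theta> (Suc l)))
        + (\<Sum>k<n. B $$ (i,k) * (bias k \<omega> + noise_vector feature k \<omega>))"
      by (simp add: b_decomposition distrib_left sum.distrib)
    also have "(\<Sum>k<n. B $$ (i,k) * (\<Sum>l<n. A \<omega> $$ (k,l) * \<theta> (Suc l)))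
        = (\<Sum>l<n. (\<Sum>k<n. B $$ (i,k) * A \<omega> $$ (k,l)) * \<theta> (Suc l))"
      unfolding sum_distrib_left sum_distrib_right by (subst sum.swap) (simp add: mult.assoc)
    also have "\<dots> = (\<Sum>l<n. (if i = l then 1 else 0) * \<theta> (Suc l))"
    proof (rule sum.cong[OF refl])
      fix l assume "l \<in> {..<n}"
      then have "(\<Sum>k<n. B $$ (i,k) * A \<omega> $$ (k,l)) = (B * A \<omega>) $$ (i,l)"
        using B(1) A_carrier[of \<omega>] i by (simp add: scalar_prod_def atLeast0LessThan)
      then show "(\<Sum>k<n. B $$ (i,k) * A \<omega> $$ (k,l)) * \<theta> (Suc l) = (if i = l then 1 else 0) * \<theta> (Suc l)"
        using B(3) i \<open>l \<in> {..<n}\<close> by simp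
    qed
    also have "\<dots> = (\<Sum>l<n. if i = l then \<theta> (Suc l) else 0)" by (intro sum.cong) auto
    also have "\<dots> = \<theta> (Suc i)" using i by simp
    finally show ?thesis using i B(1) by simp
  qed
  then show ?thesis unfolding estimation_error_def inv by simp
qed

text \<open>An event enters through two numbers only: \<open>1 / c\<close> bounds the norm of the
  inverse and controls the bias, \<open>t\<close> bounds its trace and controls the noise. Both
  decay cases are instances.\<close>

lemma estimation_error_on_event:
  assumes E: "E \<subseteq> space P" and c: "c > 0" and t: "t \<ge> 0"
    and good: "\<And>\<omega>. \<omega> \<in> E \<Longrightarrow> \<exists>B. B \<in> carrier_mat n n \<and> A \<omega> * B = 1\<^sub>m n \<and> B * A \<omega> = 1\<^sub>m n \<and>
      (\<Sum>i<n. B $$ (i,i)) \<le> t \<and> (\<forall>x\<in>carrier_vec n. (B *\<^sub>v x) \<bullet> (B *\<^sub>v x) \<le> (x \<bullet> x) / c\<^sup>2)"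
  shows "expectation_on P E (\<lambda>\<omega>. estimation_error n (A \<omega>) (b \<omega>) \<theta>)
    \<le> ennreal ((\<Sum>k=1..n. \<kappa> * lam k * (lam n powr (1 + \<beta>) * L\<^sup>2) / real M) / c\<^sup>2 + \<sigma>\<^sup>2 * t / real M)"
proof -
  \<comment> \<open>On singular matrices the quotient is 0 by convention, so \<open>H\<close> is a
    total measurable function of the inputs.\<close>
  define H where "H j k \<omega> = adj_mat (A \<omega>) $$ (j,k) / det (A \<omega>)" for j k \<omega>
  have H_meas: "H j k \<in> borel_measurable input_algebra" if "j < n" "k < n" for j k
    unfolding H_def using A_carrier A_measurable that
    by (intro borel_measurable_divide adj_mat_measurable[where n = n] det_measurable[where n = n]) auto
  \<comment> \<open>Measurability of \<open>E\<close> is not at hand, since eigenvalues and \<open>mat_inverse\<close> are not manifestly measurable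
    functions of the entries. \<open>S\<close> is a measurable superset on which the cofactor formula \<open>H\<close> for the inverse
    still satisfies the required bounds.\<close>
  define S where "S = {\<omega> \<in> space input_algebra. det (A \<omega>) \<noteq> 0 \<and> (\<Sum>j<n. H j j \<omega>) \<le> t \<and>
    (\<forall>j\<in>{..<n}. \<forall>k\<in>{..<n}. \<bar>H j k \<omega>\<bar> \<le> 1 / c) \<and>
    (\<Sum>j<n. (\<Sum>k<n. H j k \<omega> * bias k \<omega>)\<^sup>2) \<le> (\<Sum>k<n. (bias k \<omega>)\<^sup>2) / c\<^sup>2}"
  \<comment> \<open>The norm bound for the inverse concerns all vectors, an uncountable family of
    conditions. \<open>S\<close> records just two consequences, the bound on the entries and the
    inequality at the vector \<open>bias\<close>, so finitely many measurable conditions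
    suffice.\<close>
  have S: "S \<in> sets input_algebra"
    unfolding S_def
  proof (intro sets.sets_Collect_conj)
    have "(\<lambda>\<omega>. det (A \<omega>)) \<in> borel_measurable input_algebra"
      using A_carrier A_measurable by (intro det_measurable[where n = n]) auto
    then show "{\<omega> \<in> space input_algebra. det (A \<omega>) \<noteq> 0} \<in> sets input_algebra"
      by (rule borel_measurable_neq) (rule borel_measurable_const)
    have "(\<lambda>\<omega>. \<Sum>j<n. H j j \<omega>) \<in> borel_measurable input_algebra"
      using H_meas by (intro borel_measurable_sum) auto
    then show "{\<omega> \<in> space input_algebra. (\<Sum>j<n. H j j \<omega>) \<le> t} \<in> sets input_algebra"
      by (rule borel_measurable_le) (rule borel_measurable_const)
    have "{\<omega> \<in> space input_algebra. \<bar>H j k \<omega>\<bar> \<le> 1 / c} \<in> sets input_algebra" if "j < n" "k < n" for j k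
      by (intro borel_measurable_le borel_measurable_abs H_meas[OF that] borel_measurable_const)
    then show "{\<omega> \<in> space input_algebra. \<forall>j\<in>{..<n}. \<forall>k\<in>{..<n}. \<bar>H j k \<omega>\<bar> \<le> 1 / c} \<in> sets input_algebra"
      using n by (intro sets.sets_Collect_finite_All') (auto simp: lessThan_empty_iff)
    show "{\<omega> \<in> space input_algebra. (\<Sum>j<n. (\<Sum>k<n. H j k \<omega> * bias k \<omega>)\<^sup>2) \<le> (\<Sum>k<n. (bias k \<omega>)\<^sup>2) / c\<^sup>2}
        \<in> sets input_algebra"
      using H_meas
      by (intro borel_measurable_le borel_measurable_sum borel_measurable_power borel_measurable_times
          borel_measurable_divide borel_measurable_const bias_measurable) auto
  qed
  \<comment> \<open>Extension by zero makes the weights bounded everywhere, as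
    \<open>weighted_error\<close> requires.\<close>
  define G where "G j k \<omega> = indicator S \<omega> * H j k \<omega>" for j k \<omega>
  have G_meas: "G j k \<in> borel_measurable input_algebra" if "j < n" "k < n" for j k
    unfolding G_def using H_meas[OF that] S by simp
  have G_bound: "\<bar>G j k \<omega>\<bar> \<le> 1 / c" if "j < n" "k < n" for j k \<omega>
    using that c by (auto simp: G_def S_def split: split_indicator)
  \<comment> \<open>With H in place of the inverse, the inner sum for row j is M times the j-th
    diagonal entry of H A H^T. Since H A = 1, it equals M H(j,j), and summing over j gives M times
    the trace of H.\<close>
  have trace: "(\<Sum>j<n. \<Sum>m=1..M. (norm (\<Sum>k<n. G j k \<omega> *\<^sub>R feature k (us m \<omega>)))\<^sup>2) \<le> real M * t" for \<omega>
  proof (cases "\<omega> \<in> S")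
    case True
    then have GH: "G j k \<omega> = H j k \<omega>" for j k by (simp add: G_def)
    have inv: "(\<Sum>k<n. H j k \<omega> * A \<omega> $$ (k,l)) = (if j = l then 1 else 0)" if jl: "j < n" "l < n" for j l
    proof -
      have "(\<Sum>k<n. adj_mat (A \<omega>) $$ (j,k) * A \<omega> $$ (k,l)) = (adj_mat (A \<omega>) * A \<omega>) $$ (j,l)"
        using adj_mat(1)[OF A_carrier[of \<omega>]] A_carrier[of \<omega>] jl by (simp add: scalar_prod_def atLeast0LessThan)
      also have "\<dots> = det (A \<omega>) * (if j = l then 1 else 0)"
        unfolding adj_mat(3)[OF A_carrier[of \<omega>]] using jl by simp
      finally have "(\<Sum>k<n. adj_mat (A \<omega>) $$ (j,k) * A \<omega> $$ (k,l)) / det (A \<omega>) = (if j = l then 1 else 0)"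
        using True by (simp add: S_def)
      then show ?thesis by (simp add: H_def sum_divide_distrib)
    qed
    have "(\<Sum>m=1..M. (norm (\<Sum>k<n. H j k \<omega> *\<^sub>R feature k (us m \<omega>)))\<^sup>2) = real M * H j j \<omega>" if j: "j < n" for j
    proof -
      have "(\<Sum>m=1..M. (norm (\<Sum>k<n. H j k \<omega> *\<^sub>R feature k (us m \<omega>)))\<^sup>2)
        = (\<Sum>m=1..M. \<Sum>l<n. \<Sum>k<n. H j l \<omega> * H j k \<omega> * (feature k (us m \<omega>) \<bullet> feature l (us m \<omega>)))"
        unfolding power2_norm_eq_inner
        by (simp add: inner_sum_left inner_sum_right sum_distrib_left mult_ac)
      also have "\<dots> = (\<Sum>l<n. \<Sum>m=1..M. \<Sum>k<n. H j l \<omega> * H j k \<omega> * (feature k (us m \<omega>) \<bullet> feature l (us m \<omega>)))"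
        by (rule sum.swap)
      also have "\<dots> = (\<Sum>l<n. \<Sum>k<n. \<Sum>m=1..M. H j l \<omega> * H j k \<omega> * (feature k (us m \<omega>) \<bullet> feature l (us m \<omega>)))"
        by (intro sum.cong refl sum.swap)
      also have "\<dots> = (\<Sum>l<n. real M * (H j l \<omega> * (\<Sum>k<n. H j k \<omega> * A \<omega> $$ (k,l))))"
      proof (rule sum.cong[OF refl])
        fix l assume "l \<in> {..<n}"
        have "(\<Sum>m=1..M. H j l \<omega> * H j k \<omega> * (feature k (us m \<omega>) \<bullet> feature l (us m \<omega>)))
          = real M * (H j l \<omega> * (H j k \<omega> * A \<omega> $$ (k,l)))" if "k < n" for k
          using that \<open>l \<in> {..<n}\<close> M by (simp add: A_entry sum_distrib_left mult_ac)
        then show "(\<Sum>k<n. \<Sum>m=1..M. H j l \<omega> * H j k \<omega> * (feature k (us m \<omega>) \<bullet> feature l (us m \<omega>)))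
          = real M * (H j l \<omega> * (\<Sum>k<n. H j k \<omega> * A \<omega> $$ (k,l)))"
          by (simp add: sum_distrib_left)
      qed
      also have "\<dots> = (\<Sum>l<n. if j = l then real M * H j l \<omega> else 0)"
        using j by (intro sum.cong refl) (simp add: inv)
      finally show ?thesis using j by simp
    qed
    then have "(\<Sum>j<n. \<Sum>m=1..M. (norm (\<Sum>k<n. H j k \<omega> *\<^sub>R feature k (us m \<omega>)))\<^sup>2) = real M * (\<Sum>j<n. H j j \<omega>)"
      by (simp add: sum_distrib_left)
    then show ?thesis unfolding GH using True by (simp add: S_def mult_left_mono)
  next
    case False
    then show ?thesis using t by (simp add: G_def)
  qed
  note est = weighted_error[where r = feature and G = G and d = bias and n = n and K = "1 / c" and t = t]
  have feature_int: "integrable P (\<lambda>\<omega>. (norm (feature k (u \<omega>)))\<^sup>2)" for k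
    using R_inner_integrable[OF psi_L2 psi_L2, of "Suc k" "Suc k"] by (simp add: feature_def power2_norm_eq_inner)
  let ?X = "\<lambda>j \<omega>. \<Sum>k<n. G j k \<omega> * (bias k \<omega> + noise_vector feature k \<omega>)"
  have X_L2: "?X j \<in> L2 P" if "j < n" for j
    using feature_measurable feature_int G_meas G_bound bias_measurable bias_square(1) trace that
    by (intro est(1)) auto
  have X_bound: "(\<Sum>j<n. \<integral>\<omega>. (?X j \<omega>)\<^sup>2 \<partial>P) \<le> (\<Sum>j<n. \<integral>\<omega>. (\<Sum>k<n. G j k \<omega> * bias k \<omega>)\<^sup>2 \<partial>P) + \<sigma>\<^sup>2 * t / real M"
    using feature_measurable feature_int G_meas G_bound bias_measurable bias_square(1) trace
    by (intro est(2)) auto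
  have Gb_L2: "(\<lambda>\<omega>. \<Sum>k<n. G j k \<omega> * bias k \<omega>) \<in> L2 P" if "j < n" for j
    using that by (intro L2_sum L2_bounded_mult[where K = "1 / c"] bias_square(1) input_measurableD[OF G_meas] G_bound) auto
  have "(\<Sum>j<n. \<integral>\<omega>. (\<Sum>k<n. G j k \<omega> * bias k \<omega>)\<^sup>2 \<partial>P) = (\<integral>\<omega>. (\<Sum>j<n. (\<Sum>k<n. G j k \<omega> * bias k \<omega>)\<^sup>2) \<partial>P)"
    using L2D(2)[OF Gb_L2] by (intro Bochner_Integration.integral_sum[symmetric]) auto
  also have "\<dots> \<le> (\<integral>\<omega>. (\<Sum>k<n. (bias k \<omega>)\<^sup>2) / c\<^sup>2 \<partial>P)"
  proof (rule integral_mono)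
    show "integrable P (\<lambda>\<omega>. \<Sum>j<n. (\<Sum>k<n. G j k \<omega> * bias k \<omega>)\<^sup>2)"
      using L2D(2)[OF Gb_L2] by (intro Bochner_Integration.integrable_sum) auto
    show "integrable P (\<lambda>\<omega>. (\<Sum>k<n. (bias k \<omega>)\<^sup>2) / c\<^sup>2)"
      using L2D(2)[OF bias_square(1)] by (intro integrable_divide Bochner_Integration.integrable_sum) auto
    show "(\<Sum>j<n. (\<Sum>k<n. G j k \<omega> * bias k \<omega>)\<^sup>2) \<le> (\<Sum>k<n. (bias k \<omega>)\<^sup>2) / c\<^sup>2" for \<omega>
    proof (cases "\<omega> \<in> S")
      case True
      then show ?thesis by (simp add: G_def S_def)
    next
      case False
      then show ?thesis by (simp add: G_def sum_nonneg)
    qed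
  qed
  also have "\<dots> = (\<Sum>k<n. \<integral>\<omega>. (bias k \<omega>)\<^sup>2 \<partial>P) / c\<^sup>2"
    using L2D(2)[OF bias_square(1)] by (simp add: Bochner_Integration.integral_sum)
  also have "\<dots> \<le> (\<Sum>k<n. \<kappa> * lam (Suc k) * (lam n powr (1 + \<beta>) * L\<^sup>2) / real M) / c\<^sup>2"
    using bias_square(2) by (intro divide_right_mono sum_mono) auto
  also have "(\<Sum>k<n. \<kappa> * lam (Suc k) * (lam n powr (1 + \<beta>) * L\<^sup>2) / real M)
      = (\<Sum>k=1..n. \<kappa> * lam k * (lam n powr (1 + \<beta>) * L\<^sup>2) / real M)"
    by (simp add: sum.atLeast1_atMost_eq)
  finally have total: "(\<Sum>j<n. \<integral>\<omega>. (?X j \<omega>)\<^sup>2 \<partial>P)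
    \<le> (\<Sum>k=1..n. \<kappa> * lam k * (lam n powr (1 + \<beta>) * L\<^sup>2) / real M) / c\<^sup>2 + \<sigma>\<^sup>2 * t / real M"
    using X_bound by linarith
  have pointwise: "estimation_error n (A \<omega>) (b \<omega>) \<theta> = (\<Sum>j<n. (?X j \<omega>)\<^sup>2)" if \<omega>: "\<omega> \<in> E" for \<omega>
  proof -
    obtain B where B: "B \<in> carrier_mat n n" "A \<omega> * B = 1\<^sub>m n" "B * A \<omega> = 1\<^sub>m n"
      and tr: "(\<Sum>i<n. B $$ (i,i)) \<le> t"
      and bound: "\<And>x. x \<in> carrier_vec n \<Longrightarrow> (B *\<^sub>v x) \<bullet> (B *\<^sub>v x) \<le> (x \<bullet> x) / c\<^sup>2"
      using good[OF \<omega>] by blast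
    have H: "H j k \<omega> = B $$ (j,k)" if "j < n" "k < n" for j k
      unfolding H_def using mat_inverse_eq_adj_mat(3)[OF A_carrier B that] ..
    have Bx: "(\<Sum>j<n. (\<Sum>k<n. B $$ (j,k) * f k)\<^sup>2) \<le> (\<Sum>k<n. (f k)\<^sup>2) / c\<^sup>2" for f
      using bound[of "Matrix.vec n f"] B(1) by (simp add: scalar_prod_def atLeast0LessThan power2_eq_square)
    \<comment> \<open>Column k of \<open>B\<close> is the image of the k-th unit vector, so its
      norm, and with it each of its entries, is at most \<open>1 / c\<close>.\<close>
    have entry: "\<bar>B $$ (j,k)\<bar> \<le> 1 / c" if "j < n" "k < n" for j k
    proof -
      have delta: "(\<Sum>l<n. B $$ (i,l) * (if l = k then 1 else 0)) = B $$ (i,k)" for i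
      proof -
        have "(\<Sum>l<n. B $$ (i,l) * (if l = k then 1 else 0)) = (\<Sum>l<n. if l = k then B $$ (i,l) else 0)"
          by (intro sum.cong) auto
        then show ?thesis using that by simp
      qed
      have "(B $$ (j,k))\<^sup>2 \<le> (\<Sum>i<n. (B $$ (i,k))\<^sup>2)"
        using that by (intro member_le_sum) auto
      also have "\<dots> \<le> (\<Sum>l<n. (if l = k then 1 else 0 :: real)\<^sup>2) / c\<^sup>2"
        using Bx[of "\<lambda>l. if l = k then 1 else 0"] unfolding delta .
      also have "(\<Sum>l<n. (if l = k then 1 else 0 :: real)\<^sup>2) = (\<Sum>l<n. if l = k then 1 else 0)"
        by (intro sum.cong) auto
      also have "\<dots> = 1" using that by simp
      finally have "(B $$ (j,k))\<^sup>2 \<le> (1 / c)\<^sup>2" by (simp add: power_divide)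
      then have "\<bar>B $$ (j,k)\<bar> \<le> \<bar>1 / c\<bar>" unfolding abs_le_square_iff .
      then show ?thesis using c by simp
    qed
    have "\<omega> \<in> S"
      unfolding S_def
      using E \<omega> mat_inverse_eq_adj_mat(1)[OF A_carrier B] tr entry Bx[of "\<lambda>k. bias k \<omega>"] by (auto simp: H)
    then have "G j k \<omega> = B $$ (j,k)" if "j < n" "k < n" for j k using H[OF that] by (simp add: G_def)
    then show ?thesis unfolding estimation_error_inverse[OF B] by simp
  qed
  \<comment> \<open>Monotonicity of the extended integral requires no measurability, so
    \<open>E\<close> itself can be used here; the dominating function is measurable.\<close>
  have "expectation_on P E (\<lambda>\<omega>. estimation_error n (A \<omega>) (b \<omega>) \<theta>) \<le> (\<integral>\<^sup>+\<omega>. ennreal (\<Sum>j<n. (?X j \<omega>)\<^sup>2) \<partial>P)"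
    unfolding expectation_on_def
    by (intro nn_integral_mono) (auto simp: pointwise split: split_indicator)
  also have "\<dots> = ennreal (\<integral>\<omega>. (\<Sum>j<n. (?X j \<omega>)\<^sup>2) \<partial>P)"
    using L2D(2)[OF X_L2] by (intro nn_integral_eq_integral Bochner_Integration.integrable_sum) (auto intro!: AE_I2 sum_nonneg)
  also have "(\<integral>\<omega>. (\<Sum>j<n. (?X j \<omega>)\<^sup>2) \<partial>P) = (\<Sum>j<n. \<integral>\<omega>. (?X j \<omega>)\<^sup>2 \<partial>P)"
    using L2D(2)[OF X_L2] by (intro Bochner_Integration.integral_sum) auto
  finally show ?thesis using total by (meson ennreal_leI order_trans)
qed

end

theorem lemma3p5:
  fixes S :: "(real ^ 'd) set" and \<rho> :: "(real ^ 'd) measure"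
    and P :: "'w measure"
    and R :: "(real ^ 'd \<Rightarrow> real) \<Rightarrow> 'x::banach \<Rightarrow> 'y::{real_inner, polish_space}"
    and u :: "'w \<Rightarrow> 'x" and us :: "nat \<Rightarrow> 'w \<Rightarrow> 'x"
    and \<epsilon> :: "'y \<Rightarrow> 'w \<Rightarrow> real" and \<epsilon>s :: "nat \<Rightarrow> 'y \<Rightarrow> 'w \<Rightarrow> real"
    and T :: "(real ^ 'd \<Rightarrow> real) \<Rightarrow> (real ^ 'd \<Rightarrow> real)"
    and lam :: "nat \<Rightarrow> real" and \<psi> :: "nat \<Rightarrow> real ^ 'd \<Rightarrow> real"
    and D :: enat and yb :: "nat \<Rightarrow> 'y"
    and \<beta> L \<sigma> \<kappa> :: real and n M :: nat
    and \<phi> :: "real ^ 'd \<Rightarrow> real" and \<theta> :: "nat \<Rightarrow> real"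
  assumes "compact S" and "sets \<rho> = sets (restrict_space borel S)"
    and "prob_space P" and "complete_measure P"
    and "u \<in> P \<rightarrow>\<^sub>M borel"
    and "forward_operator \<rho> R"
    and "normal_operator \<rho> P R u T"
    and "L2_nonneg \<rho> T" and "L2_self_adjoint \<rho> T" and "L2_compact \<rho> T"
    and "positive_eigensystem \<rho> T lam \<psi>"
    and "polynomial_decay lam \<or> exponential_decay lam"
    and "linear_noise P \<epsilon>" and "noise_indep P u \<epsilon>"
    and "\<sigma> > 0" and "noise_moments P \<epsilon> \<sigma>"
    and "orthonormal_basis D yb" and "noise_shift_entropy P D yb \<epsilon>"
    and "\<beta> > 0" and "L > 0" and "n \<ge> 1" and "M \<ge> 1"
    and "\<kappa> \<ge> 1" and "fourth_moment_condition P R u (sobolev_space \<rho> lam \<psi> \<beta>) \<kappa>"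
    and "\<phi> \<in> sobolev_ball \<rho> lam \<psi> \<beta> L" and "L2_expansion \<rho> \<psi> \<theta> \<phi>"
    and "iid_copies P u \<epsilon> M us \<epsilon>s"
  defines "A \<equiv> normal_matrix R \<psi> us n M"
    and "b \<equiv> normal_vector P D yb R \<psi> \<phi> us \<epsilon>s n M"
  shows "(polynomial_decay lam \<longrightarrow>
            expectation_on P (event_polynomial P lam n A) (\<lambda>\<omega>. estimation_error n (A \<omega>) (b \<omega>) \<theta>)
              \<le> ennreal (16 * \<kappa> * L\<^sup>2 / real M * lam n powr (\<beta> - 1) * (\<Sum>k=1..n. lam k)
                         + 4 * \<sigma>\<^sup>2 / real M * (real n / lam n)))
       \<and> (exponential_decay lam \<longrightarrow>
            expectation_on P (event_exponential P lam n A) (\<lambda>\<omega>. estimation_error n (A \<omega>) (b \<omega>) \<theta>)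
              \<le> ennreal (16 * \<kappa> * L\<^sup>2 / real M * lam n powr (\<beta> - 1) * (\<Sum>k=1..n. lam k)
                         + 4 * \<sigma>\<^sup>2 / real M * (\<Sum>k=1..n. inverse (lam k))))"
proof -
  interpret prob_space P by fact
  interpret kernel_estimation P u \<epsilon> M us \<epsilon>s \<sigma> D yb \<rho> R T lam \<psi> \<beta> L \<kappa> n \<phi> \<theta>
    by unfold_locales (use assms in auto)
  have ln: "lam n > 0" using lam_pos \<open>n \<ge> 1\<close> by simp
  have A: "A = normal_matrix R \<psi> us n M" and b: "b = normal_vector P D yb R \<psi> \<phi> us \<epsilon>s n M"
    by (simp_all add: A_def b_def)
  \<comment> \<open>The 16 is the square of the 4 in the threshold \<open>lam n / 4\<close>; the
    division by the square of \<open>lam n\<close> lowers the exponent from 1 + beta to beta -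
    1.\<close>
  have bias_term: "(\<Sum>k=1..n. \<kappa> * lam k * (lam n powr (1 + \<beta>) * L\<^sup>2) / real M) / (lam n / 4)\<^sup>2
    = 16 * \<kappa> * L\<^sup>2 / real M * lam n powr (\<beta> - 1) * (\<Sum>k=1..n. lam k)"
  proof -
    have "lam n powr (1 + \<beta>) = lam n powr (\<beta> - 1) * (lam n)\<^sup>2"
      using ln by (simp flip: powr_numeral powr_add add: add.commute)
    then have "\<kappa> * lam k * (lam n powr (1 + \<beta>) * L\<^sup>2) / real M / (lam n / 4)\<^sup>2
      = 16 * \<kappa> * L\<^sup>2 / real M * lam n powr (\<beta> - 1) * lam k" for k
      using ln by (simp add: power_divide field_simps)
    then show ?thesis by (simp add: sum_divide_distrib sum_distrib_left)
  qed
  have polynomial: "expectation_on P (event_polynomial P lam n A) (\<lambda>\<omega>. estimation_error n (A \<omega>) (b \<omega>) \<theta>)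
    \<le> ennreal (16 * \<kappa> * L\<^sup>2 / real M * lam n powr (\<beta> - 1) * (\<Sum>k=1..n. lam k)
        + 4 * \<sigma>\<^sup>2 / real M * (real n / lam n))"
  proof -
    \<comment> \<open>Here \<open>c\<close> is \<open>lam n / 4\<close> and \<open>t\<close> is n /
      c, whence the 4 in the noise term.\<close>
    have "expectation_on P (event_polynomial P lam n A) (\<lambda>\<omega>. estimation_error n (A \<omega>) (b \<omega>) \<theta>)
      \<le> ennreal ((\<Sum>k=1..n. \<kappa> * lam k * (lam n powr (1 + \<beta>) * L\<^sup>2) / real M) / (lam n / 4)\<^sup>2
        + \<sigma>\<^sup>2 * (real n / (lam n / 4)) / real M)"
      unfolding A b
    proof (rule estimation_error_on_event)
      fix \<omega> assume "\<omega> \<in> event_polynomial P lam n (normal_matrix R \<psi> us n M)"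
      then have "matrix_min_eigenvalue (normal_matrix R \<psi> us n M \<omega>) > lam n / 4"
        by (simp add: event_polynomial_def)
      then show "\<exists>B. B \<in> carrier_mat n n \<and> normal_matrix R \<psi> us n M \<omega> * B = 1\<^sub>m n \<and>
          B * normal_matrix R \<psi> us n M \<omega> = 1\<^sub>m n \<and> (\<Sum>i<n. B $$ (i,i)) \<le> real n / (lam n / 4) \<and>
          (\<forall>x\<in>carrier_vec n. (B *\<^sub>v x) \<bullet> (B *\<^sub>v x) \<le> (x \<bullet> x) / (lam n / 4)\<^sup>2)"
        using ln by (intro matrix_min_eigenvalue_gt[OF A_carrier A_symmetric, of "lam n / 4"]) auto
    qed (use ln in \<open>auto simp: event_polynomial_def\<close>)
    then show ?thesis unfolding bias_term by (simp add: field_simps)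
  qed
  have exponential: "expectation_on P (event_exponential P lam n A) (\<lambda>\<omega>. estimation_error n (A \<omega>) (b \<omega>) \<theta>)
    \<le> ennreal (16 * \<kappa> * L\<^sup>2 / real M * lam n powr (\<beta> - 1) * (\<Sum>k=1..n. lam k)
        + 4 * \<sigma>\<^sup>2 / real M * (\<Sum>k=1..n. inverse (lam k)))"
  proof -
    \<comment> \<open>The trace is bounded with the individual thresholds, but the norm of the
      inverse is governed by the smallest one, \<open>lam n / 4\<close>; so the bias term is the
      same as in the polynomial case.\<close>
    have "expectation_on P (event_exponential P lam n A) (\<lambda>\<omega>. estimation_error n (A \<omega>) (b \<omega>) \<theta>)
      \<le> ennreal ((\<Sum>k=1..n. \<kappa> * lam k * (lam n powr (1 + \<beta>) * L\<^sup>2) / real M) / (lam n / 4)\<^sup>2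
        + \<sigma>\<^sup>2 * (\<Sum>k=1..n. 1 / (lam k / 4)) / real M)"
      unfolding A b
    proof (rule estimation_error_on_event)
      fix \<omega> assume "\<omega> \<in> event_exponential P lam n (normal_matrix R \<psi> us n M)"
      then have "matrix_eigenvalue (normal_matrix R \<psi> us n M \<omega>) k > lam k / 4" if "k \<in> {1..n}" for k
        using that by (simp add: event_exponential_def)
      then show "\<exists>B. B \<in> carrier_mat n n \<and> normal_matrix R \<psi> us n M \<omega> * B = 1\<^sub>m n \<and>
          B * normal_matrix R \<psi> us n M \<omega> = 1\<^sub>m n \<and> (\<Sum>i<n. B $$ (i,i)) \<le> (\<Sum>k=1..n. 1 / (lam k / 4)) \<and>
          (\<forall>x\<in>carrier_vec n. (B *\<^sub>v x) \<bullet> (B *\<^sub>v x) \<le> (x \<bullet> x) / (lam n / 4)\<^sup>2)"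
        using ln lam_antimono \<open>n \<ge> 1\<close>
        by (intro matrix_eigenvalue_gt[OF A_carrier A_symmetric, of "\<lambda>k. lam k / 4"]) auto
    next
      show "0 \<le> (\<Sum>k=1..n. 1 / (lam k / 4))" using lam_pos by (intro sum_nonneg) (simp add: less_imp_le)
    qed (use ln in \<open>auto simp: event_exponential_def\<close>)
    also have "\<sigma>\<^sup>2 * (\<Sum>k=1..n. 1 / (lam k / 4)) / real M = 4 * \<sigma>\<^sup>2 / real M * (\<Sum>k=1..n. inverse (lam k))"
    proof -
      have "(\<Sum>k=1..n. 1 / (lam k / 4)) = 4 * (\<Sum>k=1..n. inverse (lam k))"
        unfolding sum_distrib_left by (intro sum.cong refl) (simp add: inverse_eq_divide)
      then show ?thesis by (simp only:) (simp only: divide_inverse mult_ac)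
    qed
    finally show ?thesis unfolding bias_term .
  qed
  show ?thesis using polynomial exponential by blast
qed

end
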